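(* Let $n,k\ge1$ and consider the recursive sequence of correlated sampling algorithms $\mathcal{A}'_0,\mathcal{A}'_1,\dots$ for $\Delta_{n,k}$ described in the context. For some $i=\log^* n+O(\log\log^* n)=O(\log^* n)$, the algorithm $\mathcal{A}'_i$ has stretch $O(\log k)$, with absolute implied constants.
   Context: $\Delta_{n,k}=\{\mathbf{x}\in[0,1]^n:\|\mathbf{x}\|_1\le k\}$. A correlated sampling algorithm for $\Delta_{n,k}$ is a distribution over deterministic maps $\Delta_{n,k}\to2^{[n]}$, drawn once and applied to all inputs; it has stretch $\alpha$ if for all $\mathbf{x},\mathbf{y}$: (P1) output size is $\lfloor\|\mathbf{x}\|_1\rfloor$ or $\lceil\|\mathbf{x}\|_1\rceil$; (P2) $\Pr[i\in\text{output}(\mathbf{x})]=x_i$; (P3) $\mathbb{E}|\text{output}(\mathbf{x})\oplus\text{output}(\mathbf{y})|\le\alpha\|\mathbf{x}-\mathbf{y}\|_1$. Logs base 2; $\log^{(i)}$ is the $i$-fold iterated log and $\log^*n=\min\{i:\log^{(i)}n\le1\}$. Tree pivotal sampling on $[d]$: fix a binary tree of depth $\lceil\log d\rceil$ with leaves $1,\dots,d$; independent $\theta_z\sim\mathrm{Uni}[0,1]$ per internal node plus an extra $\theta_{root}$. On $\mathbf{z}\in\Delta_{d,k}$, leaves pass $(i,z_i)$ up; a node receiving $(i,a),(j,b)$: if $a+b\le1$, with $\theta_z\le a/(a+b)$ set $(a+b,0)$ for $(i,j)$ and fix $j$, else $(0,a+b)$ and fix $i$; if $a+b>1$, with $\theta_z\le(1-b)/(2-a-b)$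 set $(1,a+b-1)$ and fix $i$, else $(a+b-1,1)$ and fix $j$; pass the non-fixed coordinate up; at the root the remaining coordinate with value $\gamma$ gets 1 iff $\theta_{root}<\gamma$; output the coordinates with value 1. Composed algorithm $\mathrm{ALG}[\mathcal{A},\alpha]$ from an $\alpha$-stretch algorithm $\mathcal{A}$ for $\Delta_{n,k}$: $m=2^5k^5\alpha^5$, $d=m^3$; $\mathcal{A}_1$ is exponential clocks (i.i.d. $E_i\sim\mathrm{Exp}(1)$, on probability vector $\mathbf{p}$ output $\{\arg\min_{i:p_i>0}E_i/p_i\}$); $\mathcal{A}_k$ is tree pivotal sampling on $[d]$. Shared randomness (drawn once, independently): that of $\mathcal{A},\mathcal{A}_1,\mathcal{A}_k$; $R_b\sim\mathrm{Uni}([d])$, $b\in[m]$; $C_i\sim\mathrm{Uni}([d])$ and uniform bucket $\beta(i)\in[m]$, $i\in[n]$, $\mathcal{B}_b=\{i:\beta(i)=b\}$; $\sigma,\tau\sim\mathrm{Uni}[0,1/10]$. On $\mathbf{x}$: $S=\{i:0<x_i\le1/10+\sigma\}$, $L=\{i:x_i>1/10+\sigma\}$. (a) If two distinct members of $(C_i)_{i\in L},(R_b)_{b\in[m]}$ coincide, return $\mathcal{A}(\mathbf{x})$. (b) Else if some $b$ has $\sum_{i\in S\cap\mathcal{B}_b}x_i>1-\tau$, return $\mathcal{A}(\mathbf{x})$. (c) Else for each $b$ with $s_b=\sum_{i\in S\cap\mathcal{B}_b}x_i>0$ let $REP_b=\mathcal{A}_1(\mathbf{p}^b)$, $p^b_i=x_i/s_b$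 on $S\cap\mathcal{B}_b$; set $\hat x_{R_b}=s_b$, $\hat x_{C_i}=x_i$ ($i\in L$), others $0$; $T=\mathcal{A}_k(\hat{\mathbf{x}})$; return $\{i\in L:C_i\in T\}\cup\bigcup_{b:s_b>0,R_b\in T}REP_b$. Recursion: $\mathcal{A}'_0$ is tree pivotal sampling on $[n]$ with stretch $\alpha_0\le2\lceil\log n\rceil$; for $i\ge1$, $\mathcal{A}'_i=\mathrm{ALG}[\mathcal{A}'_{i-1},\alpha_{i-1}]$ where $\alpha_{i-1}$ is the stretch of $\mathcal{A}'_{i-1}$. *)

theory Defs
  imports "HOL-Probability.Probability"
begin

section \<open>Correlated sampling\<close>

definition l1norm :: "nat \<Rightarrow> (nat \<Rightarrow> real) \<Rightarrow> real" where
  "l1norm n x = (\<Sum>i=1..n. \<bar>x i\<bar>)"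

text \<open>Vectors of \<open>\<real>\<^sup>n\<close> are functions on \<open>{1..n}\<close>, extended by \<^term>\<open>undefined\<close>.\<close>

definition Delta :: "nat \<Rightarrow> nat \<Rightarrow> (nat \<Rightarrow> real) set" where
  "Delta n k = {x \<in> {1..n} \<rightarrow>\<^sub>E {0..1}. l1norm n x \<le> real k}"

text \<open>
  An algorithm is the law of a random map from \<^term>\<open>Delta n k\<close> to subsets of \<open>[n]\<close>; the maps carry
  the \<open>\<sigma>\<close>-algebra generated by the evaluations at the points of \<^term>\<open>Delta n k\<close>.
\<close>

type_synonym sampler = "((nat \<Rightarrow> real) \<Rightarrow> nat set) measure"

definition map_space :: "nat \<Rightarrow> nat \<Rightarrow> sampler" where
  "map_space n k = (\<Pi>\<^sub>M x\<in>Delta n k. count_space (Pow {1..n}))"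

definition correlated_sampling :: "nat \<Rightarrow> nat \<Rightarrow> sampler \<Rightarrow> bool" where
  "correlated_sampling n k A \<longleftrightarrow> prob_space A \<and> sets A = sets (map_space n k)"

definition has_stretch :: "nat \<Rightarrow> nat \<Rightarrow> sampler \<Rightarrow> real \<Rightarrow> bool" where
  "has_stretch n k A \<alpha> \<longleftrightarrow>
     correlated_sampling n k A \<and>
     (\<forall>x\<in>Delta n k. AE f in A. int (card (f x)) \<in> {\<lfloor>l1norm n x\<rfloor>, \<lceil>l1norm n x\<rceil>}) \<and>
     (\<forall>x\<in>Delta n k. \<forall>i\<in>{1..n}. measure A {f \<in> space A. i \<in> f x} = x i) \<and>
     (\<forall>x\<in>Delta n k. \<forall>y\<in>Delta n k.
        (\<integral>f. real (card (sym_diff (f x) (f y))) \<partial>A) \<le> \<alpha> * l1norm n (\<lambda>i. x i - y i))"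

text \<open>
  ``The'' stretch of an algorithm is the least one. For \<open>n, k \<ge> 1\<close> every \<open>\<alpha>\<close> with
  \<^term>\<open>has_stretch n k A \<alpha>\<close> is at least \<open>1\<close>, and the infimum is attained if there is such an \<open>\<alpha>\<close>.
\<close>

definition stretch :: "nat \<Rightarrow> nat \<Rightarrow> sampler \<Rightarrow> real" where
  "stretch n k A = Inf {\<alpha>. has_stretch n k A \<alpha>}"


section \<open>Tree pivotal sampling\<close>

datatype btree = Lf nat | Nd btree btree

fun leaves :: "btree \<Rightarrow> nat list" where
  "leaves (Lf i) = [i]"
| "leaves (Nd l r) = leaves l @ leaves r"

fun depth :: "btree \<Rightarrow> nat" where
  "depth (Lf i) = 0"
| "depth (Nd l r) = Suc (max (depth l) (depth r))"

definition pivotal_tree :: "nat \<Rightarrow> btree \<Rightarrow> bool" where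
  "pivotal_tree d t \<longleftrightarrow>
     distinct (leaves t) \<and> set (leaves t) = {1..d} \<and> int (depth t) = \<lceil>log 2 (real d)\<rceil>"

text \<open>Such trees exist for every \<open>d \<ge> 1\<close>.\<close>

lemma tree_of_list:
  assumes "xs \<noteq> []" "length xs \<le> 2 ^ h"
  shows "\<exists>t. leaves t = xs \<and> depth t \<le> h"
  using assms
proof (induction h arbitrary: xs)
  case 0
  then have "xs = [hd xs]" by (cases xs) auto
  then show ?case by (intro exI[of _ "Lf (hd xs)"]) auto
next
  case (Suc h)
  show ?case
  proof (cases "length xs \<le> 2 ^ h")
    case True
    then show ?thesis using Suc.IH[OF Suc.prems(1)] le_Suc_eq by blast
  next
    case False
    have "take (2^h) xs \<noteq> []" "drop (2^h) xs \<noteq> []" using False by auto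
    moreover have "length (take (2^h) xs) \<le> 2^h" "length (drop (2^h) xs) \<le> 2^h"
      using Suc.prems by auto
    ultimately obtain l r where "leaves l = take (2^h) xs" "depth l \<le> h"
      "leaves r = drop (2^h) xs" "depth r \<le> h" using Suc.IH by meson
    then show ?thesis by (intro exI[of _ "Nd l r"]) auto
  qed
qed

lemma length_leaves: "length (leaves t) \<le> 2 ^ depth t"
proof (induction t)
  case (Nd l r)
  have "(2::nat) ^ depth l \<le> 2 ^ max (depth l) (depth r)" "(2::nat) ^ depth r \<le> 2 ^ max (depth l) (depth r)"
    by (auto intro: power_increasing)
  with Nd have "length (leaves l) + length (leaves r) \<le> 2 ^ max (depth l) (depth r) + 2 ^ max (depth l) (depth r)"
    by linarith
  then show ?case by simp
qed auto

lemma pivotal_tree_exists: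
  assumes "d \<ge> 1" shows "\<exists>t. pivotal_tree d t"
proof -
  define h where "h = nat \<lceil>log 2 (real d)\<rceil>"
  have l0: "log 2 (real d) \<ge> 0" using assms by simp
  have "real d = 2 powr (log 2 (real d))" using assms by simp
  also have "\<dots> \<le> 2 powr (real h)" unfolding h_def using l0 by (intro powr_mono) linarith+
  also have "\<dots> = 2 ^ h" by (simp add: powr_realpow)
  finally have "d \<le> 2 ^ h" by (metis of_nat_le_iff of_nat_numeral of_nat_power)
  then obtain t where t: "leaves t = [1..<Suc d]" "depth t \<le> h"
    using tree_of_list[of "[1..<Suc d]" h] assms by auto
  have "d \<le> 2 ^ depth t" using length_leaves[of t] unfolding t(1) by (simp only: length_upt diff_Suc_1)
  then have "real d \<le> 2 ^ depth t" by (metis of_nat_le_iff of_nat_numeral of_nat_power)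
  then have "log 2 (real d) \<le> real (depth t)" using assms
    by (simp add: log_le_iff powr_realpow)
  then have "h \<le> depth t" unfolding h_def by linarith
  with t l0 show ?thesis unfolding pivotal_tree_def h_def
    by (intro exI[of _ t]) (auto simp: atLeastLessThanSuc_atLeastAtMost)
qed

text \<open>Internal nodes are named by their path from the root (\<^const>\<open>False\<close> for left).\<close>

fun internal_nodes :: "btree \<Rightarrow> bool list set" where
  "internal_nodes (Lf i) = {}"
| "internal_nodes (Nd l r) =
     insert [] ((#) False ` internal_nodes l \<union> (#) True ` internal_nodes r)"

text \<open>
  The result \<open>((i, a), F)\<close> consists of the pair passed up by the root of the tree and the set \<open>F\<close> of
  coordinates fixed to \<open>1\<close> so far; all other coordinates below the root except \<open>i\<close> are fixed to \<open>0\<close>.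
  The quotients with denominator \<open>0\<close> occur only for \<open>a = b = 0\<close> and \<open>a = b = 1\<close>, where both
  outcomes assign the same values.
\<close>

fun pivot :: "(bool list \<Rightarrow> real) \<Rightarrow> (nat \<Rightarrow> real) \<Rightarrow> btree \<Rightarrow> (nat \<times> real) \<times> nat set" where
  "pivot \<theta> z (Lf i) = ((i, z i), {})"
| "pivot \<theta> z (Nd l r) =
     (let ((i, a), F) = pivot (\<lambda>p. \<theta> (False # p)) z l;
          ((j, b), G) = pivot (\<lambda>p. \<theta> (True # p)) z r
      in if a + b \<le> 1 then
           (if \<theta> [] \<le> a / (a + b) then ((i, a + b), F \<union> G) else ((j, a + b), F \<union> G))
         else
           (if \<theta> [] \<le> (1 - b) / (2 - a - b) then ((j, a + b - 1), insert i (F \<union> G))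
            else ((i, a + b - 1), insert j (F \<union> G))))"

definition tree_output :: "btree \<Rightarrow> real \<Rightarrow> (bool list \<Rightarrow> real) \<Rightarrow> (nat \<Rightarrow> real) \<Rightarrow> nat set" where
  "tree_output t \<theta>root \<theta> z =
     (let ((i, \<gamma>), F) = pivot \<theta> z t in if \<theta>root < \<gamma> then insert i F else F)"

definition tree_space :: "btree \<Rightarrow> (real \<times> (bool list \<Rightarrow> real)) measure" where
  "tree_space t = uniform_measure lborel {0..1} \<Otimes>\<^sub>M
     (\<Pi>\<^sub>M p\<in>internal_nodes t. uniform_measure lborel {0..1})"

definition tree_pivotal :: "btree \<Rightarrow> nat \<Rightarrow> nat \<Rightarrow> sampler" where
  "tree_pivotal t d k =
     distr (tree_space t) (map_space d k) (\<lambda>(\<theta>root, \<theta>). \<lambda>z\<in>Delta d k. tree_output t \<theta>root \<theta> z)"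


section \<open>Exponential clocks\<close>

definition clock_space :: "nat \<Rightarrow> (nat \<Rightarrow> real) measure" where
  "clock_space n = (\<Pi>\<^sub>M i\<in>{1..n}. density lborel (exponential_density 1))"

text \<open>The set of minimisers; for every probability vector \<open>p\<close> it is almost surely a singleton.\<close>

definition clock_output :: "nat \<Rightarrow> (nat \<Rightarrow> real) \<Rightarrow> (nat \<Rightarrow> real) \<Rightarrow> nat set" where
  "clock_output n E p = {i. is_arg_min (\<lambda>i. E i / p i) (\<lambda>i. i \<in> {1..n} \<and> p i > 0) i}"


section \<open>The composed algorithm\<close>

definition small :: "nat \<Rightarrow> real \<Rightarrow> (nat \<Rightarrow> real) \<Rightarrow> nat set" where
  "small n \<sigma> x = {i \<in> {1..n}. 0 < x i \<and> x i \<le> 1/10 + \<sigma>}"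

definition large :: "nat \<Rightarrow> real \<Rightarrow> (nat \<Rightarrow> real) \<Rightarrow> nat set" where
  "large n \<sigma> x = {i \<in> {1..n}. x i > 1/10 + \<sigma>}"

definition small_bucket :: "nat \<Rightarrow> real \<Rightarrow> (nat \<Rightarrow> nat) \<Rightarrow> (nat \<Rightarrow> real) \<Rightarrow> nat \<Rightarrow> nat set" where
  "small_bucket n \<sigma> \<beta> x b = {i \<in> small n \<sigma> x. \<beta> i = b}"

definition bucket_sum :: "nat \<Rightarrow> real \<Rightarrow> (nat \<Rightarrow> nat) \<Rightarrow> (nat \<Rightarrow> real) \<Rightarrow> nat \<Rightarrow> real" where
  "bucket_sum n \<sigma> \<beta> x b = (\<Sum>i\<in>small_bucket n \<sigma> \<beta> x b. x i)"

definition rep :: "nat \<Rightarrow> real \<Rightarrow> (nat \<Rightarrow> nat) \<Rightarrow> (nat \<Rightarrow> real) \<Rightarrow> (nat \<Rightarrow> real) \<Rightarrow> nat \<Rightarrow> nat set" where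
  "rep n \<sigma> \<beta> E x b = clock_output n E
     (\<lambda>i. if i \<in> small_bucket n \<sigma> \<beta> x b then x i / bucket_sum n \<sigma> \<beta> x b else 0)"

definition collision :: "nat \<Rightarrow> nat set \<Rightarrow> (nat \<Rightarrow> nat) \<Rightarrow> (nat \<Rightarrow> nat) \<Rightarrow> bool" where
  "collision m L R C \<longleftrightarrow>
     (\<exists>i\<in>L. \<exists>i'\<in>L. i \<noteq> i' \<and> C i = C i') \<or>
     (\<exists>b\<in>{1..m}. \<exists>b'\<in>{1..m}. b \<noteq> b' \<and> R b = R b') \<or>
     (\<exists>i\<in>L. \<exists>b\<in>{1..m}. C i = R b)"

text \<open>
  Used only in the absence of collisions, when the two sums have at most one term in total, which
  makes \<open>R b \<mapsto> s\<^sub>b\<close>, \<open>C i \<mapsto> x\<^sub>i\<close> and everything else \<open>0\<close>.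
\<close>

definition hat :: "nat \<Rightarrow> nat \<Rightarrow> nat \<Rightarrow> (nat \<Rightarrow> nat) \<Rightarrow> (nat \<Rightarrow> nat) \<Rightarrow> (nat \<Rightarrow> nat) \<Rightarrow> real \<Rightarrow>
    (nat \<Rightarrow> real) \<Rightarrow> nat \<Rightarrow> real" where
  "hat n m d R C \<beta> \<sigma> x = (\<lambda>j\<in>{1..d}.
     (\<Sum>b | b \<in> {1..m} \<and> R b = j. bucket_sum n \<sigma> \<beta> x b) + (\<Sum>i | i \<in> large n \<sigma> x \<and> C i = j. x i))"

text \<open>Here \<open>t\<close> is the tree on \<open>[d]\<close> and \<open>f\<close> is the map drawn from the given algorithm.\<close>

definition composed_output :: "nat \<Rightarrow> nat \<Rightarrow> nat \<Rightarrow> btree \<Rightarrow>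
    ((nat \<Rightarrow> real) \<Rightarrow> nat set) \<Rightarrow> (nat \<Rightarrow> real) \<Rightarrow> real \<times> (bool list \<Rightarrow> real) \<Rightarrow>
    (nat \<Rightarrow> nat) \<Rightarrow> (nat \<Rightarrow> nat) \<Rightarrow> (nat \<Rightarrow> nat) \<Rightarrow> real \<Rightarrow> real \<Rightarrow> (nat \<Rightarrow> real) \<Rightarrow> nat set" where
  "composed_output n m d t f E \<theta> R C \<beta> \<sigma> \<tau> x =
     (if collision m (large n \<sigma> x) R C then f x
      else if \<exists>b\<in>{1..m}. bucket_sum n \<sigma> \<beta> x b > 1 - \<tau> then f x
      else let T = tree_output t (fst \<theta>) (snd \<theta>) (hat n m d R C \<beta> \<sigma> x) in
        {i \<in> large n \<sigma> x. C i \<in> T} \<union>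
        (\<Union>b\<in>{b \<in> {1..m}. bucket_sum n \<sigma> \<beta> x b > 0 \<and> R b \<in> T}. rep n \<sigma> \<beta> E x b))"

text \<open>
  As the stretch \<open>\<alpha>\<close> need not be an integer, the number \<open>2\<^sup>5 k\<^sup>5 \<alpha>\<^sup>5\<close> of buckets is rounded up.
\<close>

definition num_buckets :: "nat \<Rightarrow> real \<Rightarrow> nat" where
  "num_buckets k \<alpha> = nat \<lceil>2 ^ 5 * real k ^ 5 * \<alpha> ^ 5\<rceil>"

text \<open>The argument \<open>tr\<close> supplies the tree \<open>tr d\<close> on \<open>[d]\<close> for every \<open>d\<close>.\<close>

definition ALG :: "(nat \<Rightarrow> btree) \<Rightarrow> nat \<Rightarrow> nat \<Rightarrow> sampler \<Rightarrow> real \<Rightarrow> sampler" where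
  "ALG tr n k A \<alpha> =
     (let m = num_buckets k \<alpha>; d = m ^ 3 in
      distr
        (A \<Otimes>\<^sub>M clock_space n \<Otimes>\<^sub>M tree_space (tr d) \<Otimes>\<^sub>M
         (\<Pi>\<^sub>M b\<in>{1..m}. uniform_count_measure {1..d}) \<Otimes>\<^sub>M
         (\<Pi>\<^sub>M i\<in>{1..n}. uniform_count_measure {1..d}) \<Otimes>\<^sub>M
         (\<Pi>\<^sub>M i\<in>{1..n}. uniform_count_measure {1..m}) \<Otimes>\<^sub>M
         uniform_measure lborel {0..1/10} \<Otimes>\<^sub>M uniform_measure lborel {0..1/10})
        (map_space n k)
        (\<lambda>(f, E, \<theta>, R, C, \<beta>, \<sigma>, \<tau>). \<lambda>x\<in>Delta n k. composed_output n m d (tr d) f E \<theta> R C \<beta> \<sigma> \<tau> x))"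

fun recursive_alg :: "(nat \<Rightarrow> btree) \<Rightarrow> nat \<Rightarrow> nat \<Rightarrow> nat \<Rightarrow> sampler" where
  "recursive_alg tr n k 0 = tree_pivotal (tr n) n k"
| "recursive_alg tr n k (Suc i) =
     ALG tr n k (recursive_alg tr n k i) (stretch n k (recursive_alg tr n k i))"

definition log_star :: "nat \<Rightarrow> nat" where
  "log_star n = (LEAST i. (log 2 ^^ i) (real n) \<le> 1)"

end

theory Submission
  imports Defs
begin

text \<open>
  The values passed up in tree pivotal sampling are deterministic; only the identities of the
  coordinates are random. Read from the root downwards, each node therefore receives one random bit
  whose mean is its value, and hands bits to its two children. If one coordinate changes by \<open>\<epsilon>\<close>,
  the two bits at a node on the path to it are coupled, monotonically as long as the partial sum at
  the node does not pass an integer, and the subtree hanging off the path sees different bits with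
  probability at most \<open>4\<epsilon>\<close>. Different bits in a subtree with unchanged input change exactly one
  output, so the stretch is at most \<open>1 + 4 h\<close> for a tree of depth \<open>h\<close>.

  For the composed algorithm, condition on the coins \<open>R, C, \<beta>, \<sigma>, \<tau>\<close> and change one coordinate. Both
  inputs fall back only on a bad event that depends on \<open>R, C, \<beta>\<close> alone and has probability
  \<open>O(k\<^sup>2/m)\<close>, which absorbs the factor \<open>\<alpha>\<close>. A change of class (small or large) has probability
  \<open>O(\<epsilon>)\<close> over \<open>\<sigma>\<close>; a change of the fallback decision forces the bad event and a window of length \<open>\<epsilon>\<close>
  for \<open>\<tau>\<close>. In all other cases the tree and the clocks contribute \<open>O(\<epsilon> log d)\<close>. Hence the new stretch
  is \<open>O(1 + log k + log \<alpha>)\<close>, and \<open>log\<^sup>* n\<close> iterations suffice.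
\<close>

section \<open>One node of the tree\<close>

text \<open>Values are partial sums modulo 1, so a tiny change of a leaf can turn a value near 1
  into one near 0, and then no coupling of the two bits is close. This is harmless: at such a wrap
  the sibling's bit is almost constant, almost decided by \<theta> alone, or almost a copy of the
  node's bit. Hence \<open>step_coupling\<close> demands monotonicity only where nothing wraps, and
  \<open>pivotal_step\<close> restores it below a wrap that ends at the node.

  In a light bucket a step of size \<epsilon> may change the winning clock with probability of order
  \<epsilon> / s, where s is the bucket's mass; but the winner is output only with probability s, by
  independent randomness, and the two factors cancel.

  Fixed thresholds would make the map discontinuous; \<sigma> and \<tau> turn each threshold into an
  event of probability at most 10 \<epsilon>.

  The choice of m keeps \<alpha> k^2 / m bounded while log d stays linear in log k + log \<alpha>.
  So one round replaces the stretch by a multiple of its logarithm plus O(1 + log k), and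
  multiplicative constants do not pile up over the rounds, as the next logarithm turns them into
  summands.\<close>

text \<open>
  A node with values \<open>a, b\<close> below it and bit \<open>B\<close> sends \<open>B\<close> to the child whose coordinate is passed
  up. The fixed coordinate gets \<open>0\<close> if \<open>s\<close>, that is \<open>a + b \<le> 1\<close>, and \<open>1\<close> otherwise. In both cases the
  left bit is \<open>route s e B\<close> and the right one \<open>route s (\<not> e) B\<close>, where \<open>e\<close> is the event
  \<open>\<theta> \<le> threshold\<close>.
\<close>

definition route :: "bool \<Rightarrow> bool \<Rightarrow> bool \<Rightarrow> bool" where
  "route s e B = (if s then B \<and> e else B \<or> e)"

text \<open>The joint law of \<open>\<theta> \<le> p\<close> and \<open>\<theta> \<le> p'\<close> for one uniform \<open>\<theta>\<close>.\<close>

definition joint_weight :: "real \<Rightarrow> real \<Rightarrow> bool \<Rightarrow> bool \<Rightarrow> real" where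
  "joint_weight p p' e e' =
     (if e then if e' then min p p' else max 0 (p - p')
      else if e' then max 0 (p' - p) else 1 - max p p')"

lemma joint_weight_nonneg:
  assumes "p \<in> {0..1}" "p' \<in> {0..1}" shows "0 \<le> joint_weight p p' e e'"
  using assms by (auto simp: joint_weight_def)

text \<open>The event \<theta> > p has probability 1 - p, so both events are replaced by their
  complements. This lets the right child be treated as a left child.\<close>

lemma joint_weight_flip:
  "joint_weight (1 - p) (1 - p') e e' = joint_weight p p' (\<not> e) (\<not> e')"
  by (auto simp: joint_weight_def min_def max_def)

text \<open>
  Determines the threshold unless \<open>a = b = 0\<close> or \<open>a = b = 1\<close>, where every \<open>p\<close> is allowed. Unlike the
  quotients, this is symmetric under exchanging the children.
\<close>

definition pass_prob :: "real \<Rightarrow> real \<Rightarrow> real \<Rightarrow> bool" where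
  "pass_prob a b p \<longleftrightarrow> 0 \<le> p \<and> p \<le> 1 \<and>
     (if a + b \<le> 1 then p * (a + b) = a else p * (2 - a - b) = 1 - b)"

lemma pass_prob_flip: "pass_prob a b p \<Longrightarrow> pass_prob b a (1 - p)"
  by (auto simp: pass_prob_def algebra_simps split: if_splits)

text \<open>The sum modulo 1, with representative 1 rather than 0 for positive integers.\<close>

definition merge_value :: "real \<Rightarrow> real \<Rightarrow> real" where
  "merge_value a b = (if a + b \<le> 1 then a + b else a + b - 1)"

text \<open>The pair of bits of the left child, one bit per input. The node's own bits are
  independent of its \<theta>, but both inputs share \<theta>. The law for the right child arises by
  replacing p with 1 - p.\<close>

definition child_law ::
  "bool \<Rightarrow> bool \<Rightarrow> real \<Rightarrow> real \<Rightarrow> (bool \<Rightarrow> bool \<Rightarrow> real) \<Rightarrow> bool \<Rightarrow> bool \<Rightarrow> real" where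
  "child_law s s' p p' q x x' = (\<Sum>B\<in>UNIV. \<Sum>B'\<in>UNIV. \<Sum>e\<in>UNIV. \<Sum>e'\<in>UNIV.
     joint_weight p p' e e' * q B B' * of_bool (route s e B = x \<and> route s' e' B' = x'))"

text \<open>A single number suffices for the sibling off the path: below it only disagreement of its
  two bits costs anything.\<close>

definition sibling_diff ::
  "bool \<Rightarrow> bool \<Rightarrow> real \<Rightarrow> real \<Rightarrow> (bool \<Rightarrow> bool \<Rightarrow> real) \<Rightarrow> real" where
  "sibling_diff s s' p p' q = (\<Sum>B\<in>UNIV. \<Sum>B'\<in>UNIV. \<Sum>e\<in>UNIV. \<Sum>e'\<in>UNIV.
     joint_weight p p' e e' * q B B' * of_bool (route s (\<not> e) B \<noteq> route s' (\<not> e') B'))"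

text \<open>
  In \<open>step_coupling\<close> the second alternative means that the partial sum passes an integer, so that the
  value wraps around; the coupling is then arbitrary.
\<close>

definition coupling :: "real \<Rightarrow> real \<Rightarrow> (bool \<Rightarrow> bool \<Rightarrow> real) \<Rightarrow> bool" where
  "coupling c c' q \<longleftrightarrow> (\<forall>B B'. 0 \<le> q B B') \<and> q True True + q True False = c \<and>
     q True True + q False True = c' \<and> q True True + q True False + q False True + q False False = 1"

definition step_coupling :: "real \<Rightarrow> real \<Rightarrow> real \<Rightarrow> (bool \<Rightarrow> bool \<Rightarrow> real) \<Rightarrow> bool" where
  "step_coupling \<epsilon> c c' q \<longleftrightarrow> coupling c c' q \<and>
     (c' = c + \<epsilon> \<and> q True False = 0 \<or> c' = c + \<epsilon> - 1)"

text \<open>Since B and e are independent, the left bit has mean p c in the small case, and its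
  complement has mean (1 - p) (1 - c) in the other; \<open>pass_prob\<close> turns these into a and
  1 - a. Any coupling q of the node's bits will do.\<close>

lemma coupling_child_law:
  assumes q: "coupling (merge_value a b) (merge_value a' b') q"
    and p: "pass_prob a b p" and p': "pass_prob a' b' p'"
  shows "coupling a a' (child_law (a + b \<le> 1) (a' + b' \<le> 1) p p' q)"
proof -
  have P: "p \<in> {0..1}" "p' \<in> {0..1}" using p p' by (auto simp: pass_prob_def)
  let ?w = "joint_weight p p'"
  define c c' where "c = merge_value a b" and "c' = merge_value a' b'"
  have q0: "\<And>B B'. 0 \<le> q B B'"
    and qc: "q True True + q True False = c" "q True True + q False True = c'"
      "q True True + q True False + q False True + q False False = 1"
    using q by (auto simp: coupling_def c_def c'_def)
  have w: "?w True True + ?w True False = p" "?w True True + ?w False True = p'"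
    "?w True True + ?w True False + ?w False True + ?w False False = 1"
    by (auto simp: joint_weight_def)
  obtain w1 w2 w3 w4 where W: "?w True True = w1" "?w True False = w2" "?w False True = w3" "?w False False = w4" by blast
  obtain q1 q2 q3 q4 where Q: "q True True = q1" "q True False = q2" "q False True = q3" "q False False = q4" by blast
  \<comment> \<open>With all but one entry of each law eliminated, the marginals become polynomial
    identities.\<close>
  have w2: "w2 = p - w1" and w3: "w3 = p' - w1" and w4: "w4 = 1 - p - p' + w1" using w W by auto
  have q2: "q2 = c - q1" and q3: "q3 = c' - q1" and q4: "q4 = 1 - c - c' + q1" using qc Q by auto
  have a: "if a + b \<le> 1 then p * c = a else (1-p) * (1-c) = 1-a"
    using p by (auto simp: pass_prob_def c_def merge_value_def algebra_simps)
  have a': "if a' + b' \<le> 1 then p' * c' = a' else (1-p') * (1-c') = 1-a'"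
    using p' by (auto simp: pass_prob_def c'_def merge_value_def algebra_simps)
  have nn: "0 \<le> child_law s s' p p' q B B'" for s s' B B'
    unfolding child_law_def
    by (intro sum_nonneg mult_nonneg_nonneg joint_weight_nonneg[OF P] q0) auto
  have "child_law s s' p p' q True True + child_law s s' p p' q True False =
     (if s then p * c else 1 - (1-p) * (1-c))" for s s'
    by (cases s; cases s') (simp_all add: child_law_def route_def UNIV_bool W Q w2 w3 w4 q2 q3 q4; algebra)+
  moreover have "child_law s s' p p' q True True + child_law s s' p p' q False True =
     (if s' then p' * c' else 1 - (1-p') * (1-c'))" for s s'
    by (cases s; cases s') (simp_all add: child_law_def route_def UNIV_bool W Q w2 w3 w4 q2 q3 q4; algebra)+
  moreover have "child_law s s' p p' q True True + child_law s s' p p' q True False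
     + child_law s s' p p' q False True + child_law s s' p p' q False False = 1" for s s'
    by (cases s; cases s') (simp_all add: child_law_def route_def UNIV_bool W Q w2 w3 w4 q2 q3 q4; algebra)+
  ultimately show ?thesis using a a' nn by (auto simp: coupling_def)
qed

text \<open>Four cases, by whether the sum at the node exceeds 1 before and after the step. The
  first two mirror each other under exchanging 0 and 1. Only the last needs the full 4 \<epsilon>;
  the others give 2 \<epsilon>.\<close>

lemma pivotal_step:
  assumes q: "step_coupling \<epsilon> (merge_value a b) (merge_value a' b) q"
    and p: "pass_prob a b p" and p': "pass_prob a' b p'"
    and ab: "a \<in> {0..1}" "b \<in> {0..1}" "a' \<in> {0..1}"
    and \<epsilon>: "0 \<le> \<epsilon>" "\<epsilon> \<le> 1" and aa: "a' = a + \<epsilon> \<or> a' = a + \<epsilon> - 1"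
  shows "step_coupling \<epsilon> a a' (child_law (a + b \<le> 1) (a' + b \<le> 1) p p' q)"
    and "sibling_diff (a + b \<le> 1) (a' + b \<le> 1) p p' q \<le> 4 * \<epsilon>"
proof -
  let ?w = "joint_weight p p'" and ?s = "a + b \<le> 1" and ?s' = "a' + b \<le> 1"
  have cl: "coupling a a' (child_law ?s ?s' p p' q)"
    using coupling_child_law[OF _ p p'] q by (auto simp: step_coupling_def)
  define c c' where "c = merge_value a b" and "c' = merge_value a' b"
  have q0: "\<And>B B'. 0 \<le> q B B'"
    and qc: "q True True + q True False = c" "q True True + q False True = c'"
      "q True True + q True False + q False True + q False False = 1"
    and mono: "c' = c + \<epsilon> \<and> q True False = 0 \<or> c' = c + \<epsilon> - 1"
    using q by (auto simp: step_coupling_def coupling_def c_def c'_def)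
  have P: "0 \<le> p" "p \<le> 1" "0 \<le> p'" "p' \<le> 1" using p p' by (auto simp: pass_prob_def)
  have w: "?w True True + ?w True False = p" "?w True True + ?w False True = p'"
    "?w True True + ?w True False + ?w False True + ?w False False = 1"
    by (auto simp: joint_weight_def)
  have wn: "0 \<le> ?w e e'" for e e' using P by (intro joint_weight_nonneg) auto
  obtain w1 w2 w3 w4 where W: "?w True True = w1" "?w True False = w2" "?w False True = w3" "?w False False = w4" by blast
  obtain q1 q2 q3 q4 where Q: "q True True = q1" "q True False = q2" "q False True = q3" "q False False = q4" by blast
  have W0: "0 \<le> w1" "0 \<le> w2" "0 \<le> w3" "0 \<le> w4" using wn W by metis+
  have W1: "w1 \<le> 1" "w2 \<le> 1" "w3 \<le> 1" "w4 \<le> 1" using W0 w W by linarith+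
  have Wp: "w2 = max 0 (p - p')" "w3 = max 0 (p' - p)" using W by (auto simp: joint_weight_def)
  have Q0: "0 \<le> q1" "0 \<le> q2" "0 \<le> q3" "0 \<le> q4" using q0 Q by metis+
  have C: "0 \<le> c" "c \<le> 1" "0 \<le> c'" "c' \<le> 1" using qc Q Q0 by linarith+
  have wsum: "w1 + w2 = p" "w1 + w3 = p'" "w1 + w2 + w3 + w4 = 1" using w W by auto
  have qsum: "q1 + q2 = c" "q1 + q3 = c'" "q1 + q2 + q3 + q4 = 1" using qc Q by auto
  have a: "?s \<Longrightarrow> p * c = a" "?s \<Longrightarrow> (1-p) * c = b" "\<not> ?s \<Longrightarrow> (1-p) * (1-c) = 1-a" "\<not> ?s \<Longrightarrow> p * (1-c) = 1-b"
    using p by (auto simp: pass_prob_def c_def merge_value_def algebra_simps)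
  have a': "?s' \<Longrightarrow> p' * c' = a'" "?s' \<Longrightarrow> (1-p') * c' = b" "\<not> ?s' \<Longrightarrow> (1-p') * (1-c') = 1-a'" "\<not> ?s' \<Longrightarrow> p' * (1-c') = 1-b"
    using p' by (auto simp: pass_prob_def c'_def merge_value_def algebra_simps)
  have cd: "?s \<Longrightarrow> c = a + b" "\<not> ?s \<Longrightarrow> c = a + b - 1" "?s' \<Longrightarrow> c' = a' + b" "\<not> ?s' \<Longrightarrow> c' = a' + b - 1"
    by (auto simp: c_def c'_def merge_value_def)
  let ?D = "sibling_diff ?s ?s' p p' q" and ?L = "child_law ?s ?s' p p' q"
  have D: "?D = (if ?s then if ?s' then w3 * c + w2 * c' + w4 * (q2 + q3)
                        else w1 * c' + w3 * (q2 + q3) + w2 + w4 * (1 - c)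
                  else if ?s' then w1 * c + w3 + w2 * (q2 + q3) + w4 * (1 - c')
                        else w1 * (q2 + q3) + w3 * (1 - c') + w2 * (1 - c))"
  proof -
    have *: "c = q1 + q2" "c' = q1 + q3" "q4 = 1 - q1 - q2 - q3" using qsum by auto
    show ?thesis
      by (cases ?s; cases ?s') (simp_all add: sibling_diff_def route_def UNIV_bool W Q * algebra_simps)
  qed
  have both: "(?L True False = 0 \<or> a' = a + \<epsilon> - 1) \<and> ?D \<le> 4 * \<epsilon>"
  proof (cases ?s; cases ?s')
    assume s: ?s ?s'
    have L: "?L True False = w2 * (q1 + q2) + w1 * q2"
      using s by (simp add: child_law_def route_def UNIV_bool W Q algebra_simps)
    have DD: "?D = w3 * c + w2 * c' + w4 * (q2 + q3)" using D s by simp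
    show "(?L True False = 0 \<or> a' = a + \<epsilon> - 1) \<and> ?D \<le> 4 * \<epsilon>"
    proof (cases "a' = a + \<epsilon>")
      case True
      then have cc: "c' = c + \<epsilon>" using cd s by auto
      then have q2: "q2 = 0" "q3 = \<epsilon>" using mono qsum Q by auto
      \<comment> \<open>p = a / c grows with a, so w2 vanishes unless c' = 0: raising a never takes
        the bit away from the left child.\<close>
      have "(p - p') * c' = p * c + p * \<epsilon> - p' * c'" "(p' - p) * c = p' * c' - p' * \<epsilon> - p * c"
        by (simp_all add: cc algebra_simps)
      moreover have "p * \<epsilon> \<le> \<epsilon>" "0 \<le> p' * \<epsilon>" using P \<epsilon> by (auto simp: mult_left_le_one_le)
      ultimately have h1: "(p - p') * c' \<le> 0" and h2: "(p' - p) * c \<le> \<epsilon>"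
        using a(1) a'(1) s True by linarith+
      have "w2 * c' \<le> 0" "0 \<le> w2 * c'" using h1 Wp W0 C by (simp_all add: max_def)
      then have h3: "w2 * c' = 0" by (rule antisym)
      have "w3 * c \<le> \<epsilon>" using h2 \<epsilon> Wp by (auto simp: max_def)
      moreover have "w4 * \<epsilon> \<le> \<epsilon>" using W1 W0 \<epsilon> by (simp add: mult_left_le_one_le)
      moreover have "w2 * c = 0"
      proof -
        have "w2 * c \<le> w2 * c'" using cc \<epsilon> W0 by (intro mult_left_mono) auto
        moreover have "0 \<le> w2 * c" using W0 C by simp
        ultimately show ?thesis using h3 by simp
      qed
      ultimately show ?thesis using L DD h3 q2 qsum \<epsilon> by simp
    next
      case False
      \<comment> \<open>The child wraps, so a is at least 1 - \<epsilon>. As a + b \<le> 1, the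
        sibling's bit is 1 with probability at most \<epsilon> in either input.\<close>
      then have "b \<le> \<epsilon>" using aa s ab by auto
      have "w3 * c + w4 * q2 + w4 * q3 + w2 * c' \<le> (w3 + w4) * c + (w2 + w4) * c'"
        using W0 Q0 qsum mult_left_mono[of "q2 + q3" "c + c'" w4] by (simp add: algebra_simps)
      also have "\<dots> = (1 - p) * c + (1 - p') * c'"
      proof -
        have "w3 + w4 = 1 - p" "w2 + w4 = 1 - p'" using wsum by auto
        then show ?thesis by simp
      qed
      also have "\<dots> = 2 * b" using a(2) a'(2) s by simp
      finally show ?thesis using DD aa False \<open>b \<le> \<epsilon>\<close> \<epsilon> by (simp add: algebra_simps)
    qed
  next
    \<comment> \<open>Mirror image of the first case: 1 - a, 1 - b, 1 - c take the roles of a, b,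
      c.\<close>
    assume s: "\<not> ?s" "\<not> ?s'"
    have L: "?L True False = w2 * (q2 + q4) + w4 * q2"
      using s by (simp add: child_law_def route_def UNIV_bool W Q algebra_simps)
    have DD: "?D = w1 * (q2 + q3) + w3 * (1 - c') + w2 * (1 - c)" using D s by simp
    show "(?L True False = 0 \<or> a' = a + \<epsilon> - 1) \<and> ?D \<le> 4 * \<epsilon>"
    proof (cases "a' = a + \<epsilon>")
      case True
      then have cc: "c' = c + \<epsilon>" using cd s by auto
      then have q2: "q2 = 0" "q3 = \<epsilon>" using mono qsum Q by auto
      have "(p - p') * (1 - c) = p * (1 - c) - p' * (1 - c') - p' * \<epsilon>"
        "(p' - p) * (1 - c') = p' * (1 - c') - p * (1 - c) + p * \<epsilon>"
        by (simp_all add: cc algebra_simps)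
      moreover have "p * \<epsilon> \<le> \<epsilon>" "0 \<le> p' * \<epsilon>" using P \<epsilon> by (auto simp: mult_left_le_one_le)
      ultimately have h1: "(p - p') * (1 - c) \<le> 0" and h2: "(p' - p) * (1 - c') \<le> \<epsilon>"
        using a(4) a'(4) s by linarith+
      have "w2 * (1 - c) \<le> 0" "0 \<le> w2 * (1 - c)" using h1 Wp W0 C by (simp_all add: max_def)
      then have h3: "w2 * (1 - c) = 0" by (rule antisym)
      have "w3 * (1 - c') \<le> \<epsilon>" using h2 \<epsilon> Wp by (auto simp: max_def)
      moreover have "w1 * \<epsilon> \<le> \<epsilon>" using W1 W0 \<epsilon> by (simp add: mult_left_le_one_le)
      moreover have "w2 * q4 = 0"
      proof -
        have "w2 * q4 \<le> w2 * (1 - c)" using qsum Q0 W0 by (intro mult_left_mono) auto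
        moreover have "0 \<le> w2 * q4" using W0 Q0 by simp
        ultimately show ?thesis using h3 by simp
      qed
      ultimately show ?thesis using L DD h3 q2 qsum \<epsilon> by simp
    next
      case False
      then have "1 - b \<le> \<epsilon>" using aa s ab by auto
      have "w1 * (q2 + q3) + w3 * (1 - c') + w2 * (1 - c) \<le> (w1 + w3) * (1 - c') + (w1 + w2) * (1 - c)"
        using W0 Q0 qsum mult_left_mono[of "q2 + q3" "(1 - c') + (1 - c)" w1] by (simp add: algebra_simps)
      also have "\<dots> = 2 * (1 - b)" using a(4) a'(4) s wsum by simp
      finally show ?thesis using DD aa False \<open>1 - b \<le> \<epsilon>\<close> \<epsilon> by (simp add: algebra_simps)
    qed
  next
    \<comment> \<open>The sum passes 1 at this node, so c is near 1, c' is near 0, and \<epsilon> is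
      exactly the sum of the two gaps. Both thresholds lie within \<epsilon> of 1 - b, on opposite
      sides, whence w2 = 0.\<close>
    assume s: ?s "\<not> ?s'"
    have L: "?L True False = w2 * q1 + w2 * q2 - w2 * q1"
      using s by (simp add: child_law_def route_def UNIV_bool W Q algebra_simps)
    have DD: "?D = w1 * c' + w3 * (q2 + q3) + w2 + w4 * (1 - c)" using D s by simp
    have aa1: "a' = a + \<epsilon>" using aa s ab \<epsilon> by auto
    have cc: "\<epsilon> = c' + (1 - c)" using cd s aa1 by simp
    have h: "p \<le> 1 - b"
    proof -
      have c0: "c \<noteq> 0" using s ab cd(1) by auto
      have "(1 - b - p) * c = b * (1 - c)" using a s cd by (simp add: algebra_simps)
      then have "0 \<le> (1 - b - p) * c" using ab C by simp
      then show ?thesis using c0 C by (simp add: zero_le_mult_iff)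
    qed
    have h': "1 - b \<le> p'" using a'(4) s C P mult_left_mono[of "1 - c'" 1 p'] by simp
    have "p' - (1 - b) = p' * c'" using a'(4) s by (simp add: algebra_simps)
    also have "\<dots> \<le> c'" using P C by (simp add: mult_left_le_one_le)
    finally have h1: "p' - (1 - b) \<le> c'" .
    have "(1 - b) - p = (1 - p) * (1 - c)" using a(2) s by (simp add: algebra_simps)
    also have "\<dots> \<le> 1 - c" using P C by (simp add: mult_left_le_one_le)
    finally have h2: "(1 - b) - p \<le> 1 - c" .
    have w2: "w2 = 0" "w3 \<le> \<epsilon>" using Wp h h' h1 h2 cc by auto
    have "w1 * c' \<le> c'" "w3 * (q2 + q3) \<le> w3" "w4 * (1 - c) \<le> 1 - c"
      using W0 W1 Q0 qsum C by (auto intro!: mult_left_le_one_le mult_left_le)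
    then show "(?L True False = 0 \<or> a' = a + \<epsilon> - 1) \<and> ?D \<le> 4 * \<epsilon>"
      using L DD w2 cc \<epsilon> by auto
  next
    \<comment> \<open>The child wraps but the node does not, so \<epsilon> = a' + (1 - a), and the
      node's bits are coupled monotonically.\<close>
    assume s: "\<not> ?s" ?s'
    have DD: "?D = w1 * c + w3 + w2 * (q2 + q3) + w4 * (1 - c')" using D s by simp
    have aa1: "a' = a + \<epsilon> - 1" using aa s ab \<epsilon> by auto
    then have cc: "c' = c + \<epsilon>" using cd s by auto
    then have q2: "q2 = 0" "q3 = \<epsilon>" using mono qsum Q by auto
    have "w1 * c \<le> p' * c'" using W0 wsum C cc \<epsilon> by (intro mult_mono) auto
    then have 1: "w1 * c \<le> a'" using a' s by simp
    have "w4 * (1 - c') \<le> (1 - p) * (1 - c)" using W0 wsum C cc \<epsilon> by (intro mult_mono) auto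
    then have 2: "w4 * (1 - c') \<le> 1 - a" using a s by simp
    have 3: "w2 * \<epsilon> \<le> \<epsilon>" using W1 W0 \<epsilon> by (simp add: mult_left_le_one_le)
    \<comment> \<open>If c' \<ge> 1/2, then p' is at most 2 a'; otherwise 1 - p is at most 2 (1 -
      a).\<close>
    have 4: "p' - p \<le> 2 * \<epsilon>"
    proof (cases "c' \<ge> 1/2")
      case True
      then have "p' * (1/2) \<le> p' * c'" using P by (intro mult_left_mono) auto
      then show ?thesis using a'(1) s P aa1 ab by auto
    next
      case False
      then have "(1 - p) * (1/2) \<le> (1 - p) * (1 - c)" using P cc \<epsilon> by (intro mult_left_mono) auto
      then show ?thesis using a(3) s P aa1 ab by auto
    qed
    have "w3 \<le> 2 * \<epsilon>" using Wp 4 \<epsilon> by auto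
    then show "(?L True False = 0 \<or> a' = a + \<epsilon> - 1) \<and> ?D \<le> 4 * \<epsilon>"
      using DD 1 2 3 q2 aa1 by simp
  qed
  show "?D \<le> 4 * \<epsilon>" using both by blast
  show "step_coupling \<epsilon> a a' ?L" using cl both aa by (auto simp: step_coupling_def)
qed

section \<open>Tree pivotal sampling from the root downwards\<close>

abbreviation unif01 :: "real measure" where "unif01 \<equiv> uniform_measure lborel {0..1}"

abbreviation tree_coins :: "btree \<Rightarrow> (bool list \<Rightarrow> real) measure" where
  "tree_coins t \<equiv> \<Pi>\<^sub>M p\<in>internal_nodes t. unif01"

lemma prob_space_unif01: "prob_space unif01"
  by (rule prob_space_uniform_measure) auto

interpretation unif01: prob_space unif01 by (rule prob_space_unif01)

lemma nn_integral_two_thresholds: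
  assumes p: "p \<in> {0..1}" "p' \<in> {0..1}" and H: "\<And>e e'. 0 \<le> H e e'"
  shows "(\<integral>\<^sup>+x. ennreal (H (x \<le> p) (x \<le> p')) \<partial>unif01) =
    ennreal (\<Sum>e\<in>UNIV. \<Sum>e'\<in>UNIV. joint_weight p p' e e' * H e e')"
proof -
  have em: "emeasure unif01 {x. (x \<le> p) = e \<and> (x \<le> p') = e'} = ennreal (joint_weight p p' e e')" for e e'
  proof -
    have eq: "{0..1} \<inter> {x. (x \<le> p) = e \<and> (x \<le> p') = e'} =
       (if e then if e' then {0..min p p'} else {p'<..p} else if e' then {p<..p'} else {max p p'<..1})"
      using p by auto
    have "emeasure unif01 {x. (x \<le> p) = e \<and> (x \<le> p') = e'} =
        emeasure lborel ({0..1} \<inter> {x. (x \<le> p) = e \<and> (x \<le> p') = e'})"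
      by (subst emeasure_uniform_measure) (auto simp: divide_ennreal_def)
    also have "\<dots> = ennreal (joint_weight p p' e e')"
    proof -
      have "emeasure lborel {u<..v::real} = ennreal (max 0 (v - u))" for u v
        by (cases "u \<le> v") (auto simp: max_def)
      then show ?thesis unfolding eq using p by (auto simp: joint_weight_def)
    qed
    finally show ?thesis .
  qed
  have "(\<integral>\<^sup>+x. ennreal (H (x \<le> p) (x \<le> p')) \<partial>unif01) =
     (\<integral>\<^sup>+x. (\<Sum>e\<in>UNIV. \<Sum>e'\<in>UNIV. ennreal (H e e') * indicator {x. (x \<le> p) = e \<and> (x \<le> p') = e'} x) \<partial>unif01)"
  proof (intro nn_integral_cong)
    fix x show "ennreal (H (x \<le> p) (x \<le> p')) = (\<Sum>e\<in>UNIV. \<Sum>e'\<in>UNIV.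
        ennreal (H e e') * indicator {x. (x \<le> p) = e \<and> (x \<le> p') = e'} x)"
      by (cases "x \<le> p"; cases "x \<le> p'") (simp_all add: UNIV_bool del: sum_mult_indicator sum_indicator_mult)
  qed
  also have "\<dots> = (\<Sum>e\<in>UNIV. \<Sum>e'\<in>UNIV. ennreal (H e e') * ennreal (joint_weight p p' e e'))"
    by (simp add: nn_integral_sum nn_integral_cmult_indicator em del: sum_mult_indicator sum_indicator_mult)
  also have "\<dots> = ennreal (\<Sum>e\<in>UNIV. \<Sum>e'\<in>UNIV. joint_weight p p' e e' * H e e')"
    using joint_weight_nonneg[OF p] H
    by (simp add: ennreal_mult'[symmetric] sum_nonneg mult.commute flip: sum_ennreal)
  finally show ?thesis .
qed

text \<open>The shifted coins are extensional without an explicit restriction: if p is no internal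
  node of the child, then c # p is none of the whole tree.\<close>

lemma measurable_child_randomness [measurable]:
  "(\<lambda>\<theta> p. \<theta> (c # p)) \<in> (tree_coins (Nd l r)) \<rightarrow>\<^sub>M
     (tree_coins (if c then r else l))"
proof (rule measurable_PiM_single')
  fix p assume "p \<in> internal_nodes (if c then r else l)"
  then have "c # p \<in> internal_nodes (Nd l r)" by (cases c) auto
  then show "(\<lambda>\<theta>. \<theta> (c # p)) \<in> (tree_coins (Nd l r)) \<rightarrow>\<^sub>M unif01" by measurable
next
  show "(\<lambda>\<theta> p. \<theta> (c # p)) \<in> space (tree_coins (Nd l r)) \<rightarrow>
      (\<Pi>\<^sub>E p\<in>internal_nodes (if c then r else l). space unif01)"
  proof (intro funcsetI PiE_I)
    fix \<theta> p assume \<theta>: "\<theta> \<in> space (tree_coins (Nd l r))"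
      and "p \<notin> internal_nodes (if c then r else l)"
    then have "c # p \<notin> internal_nodes (Nd l r)" by auto
    then show "\<theta> (c # p) = undefined" using \<theta> unfolding space_PiM by (rule PiE_arb[rotated])
  qed (simp only: space_uniform_measure space_lborel space_borel UNIV_I)
qed

lemma finite_internal_nodes [simp]: "finite (internal_nodes t)"
  by (induction t) auto

text \<open>The sibling's coins integrate out. What is left is the coin at the root and a reindexed
  copy of the child's product measure, independent of it.\<close>

lemma nn_integral_child_randomness:
  fixes f :: "real \<times> (bool list \<Rightarrow> real) \<Rightarrow> ennreal"
  assumes [measurable]: "f \<in> borel_measurable (unif01 \<Otimes>\<^sub>M (tree_coins (if c then r else l)))"
  shows "(\<integral>\<^sup>+\<theta>. f (\<theta> [], \<lambda>p. \<theta> (c # p)) \<partial>(tree_coins (Nd l r))) =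
    (\<integral>\<^sup>+x. \<integral>\<^sup>+y. f (x, y) \<partial>(tree_coins (if c then r else l)) \<partial>unif01)"
proof -
  interpret product_sigma_finite "\<lambda>_ :: bool list. unif01" by unfold_locales
  let ?K = "internal_nodes (if c then r else l)"
  let ?J = "(#) False ` internal_nodes l \<union> (#) True ` internal_nodes r"
  have J: "internal_nodes (Nd l r) = insert [] ?J" by simp
  have iff: "c # p \<in> ?J \<longleftrightarrow> p \<in> ?K" for p by auto
  have "(\<lambda>\<theta>. f (\<theta> [], \<lambda>p. \<theta> (c # p))) \<in> borel_measurable (tree_coins (Nd l r))"
    by measurable
  then have m: "(\<lambda>\<theta>. f (\<theta> [], \<lambda>p. \<theta> (c # p))) \<in> borel_measurable (\<Pi>\<^sub>M p\<in>insert [] ?J. unif01)"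
    unfolding J .
  have fin: "finite ?J" "[] \<notin> ?J" by auto
  have "(\<integral>\<^sup>+\<theta>. f (\<theta> [], \<lambda>p. \<theta> (c # p)) \<partial>(tree_coins (Nd l r))) =
     (\<integral>\<^sup>+x. \<integral>\<^sup>+\<theta>. f ((\<theta>([] := x)) [], \<lambda>p. (\<theta>([] := x)) (c # p)) \<partial>(\<Pi>\<^sub>M p\<in>?J. unif01) \<partial>unif01)"
    unfolding J by (rule product_nn_integral_insert_rev[OF fin m])
  also have "\<dots> = (\<integral>\<^sup>+x. \<integral>\<^sup>+\<theta>. f (x, \<lambda>p\<in>?K. \<theta> (c # p)) \<partial>(\<Pi>\<^sub>M p\<in>?J. unif01) \<partial>unif01)"
  proof (intro nn_integral_cong)
    fix x and \<theta> :: "bool list \<Rightarrow> real" assume "\<theta> \<in> space (\<Pi>\<^sub>M p\<in>?J. unif01)"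
    then have "(\<lambda>p. \<theta> (c # p)) = (\<lambda>p\<in>?K. \<theta> (c # p))"
      using iff by (auto simp: space_PiM PiE_def extensional_def restrict_def fun_eq_iff)
    then show "f ((\<theta>([] := x)) [], \<lambda>p. (\<theta>([] := x)) (c # p)) = f (x, \<lambda>p\<in>?K. \<theta> (c # p))" by simp
  qed
  also have "\<dots> = (\<integral>\<^sup>+x. \<integral>\<^sup>+y. f (x, y) \<partial>(\<Pi>\<^sub>M p\<in>?K. unif01) \<partial>unif01)"
  proof (rule nn_integral_cong)
    fix x :: real assume "x \<in> space unif01"
    have d: "distr (\<Pi>\<^sub>M p\<in>?J. unif01) (\<Pi>\<^sub>M p\<in>?K. unif01) (\<lambda>\<theta>. \<lambda>p\<in>?K. \<theta> (c # p)) = (\<Pi>\<^sub>M p\<in>?K. unif01)"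
      using iff by (intro distr_PiM_reindex prob_space_unif01) (auto simp: inj_on_def)
    show "(\<integral>\<^sup>+\<theta>. f (x, \<lambda>p\<in>?K. \<theta> (c # p)) \<partial>(\<Pi>\<^sub>M p\<in>?J. unif01)) = (\<integral>\<^sup>+y. f (x, y) \<partial>(\<Pi>\<^sub>M p\<in>?K. unif01))"
    proof -
      have r: "(\<lambda>\<theta>. \<lambda>p\<in>?K. \<theta> (c # p)) \<in> (\<Pi>\<^sub>M p\<in>?J. unif01) \<rightarrow>\<^sub>M (\<Pi>\<^sub>M p\<in>?K. unif01)"
        by (intro measurable_restrict measurable_component_singleton) (use iff in blast)
      have "(\<integral>\<^sup>+y. f (x, y) \<partial>distr (\<Pi>\<^sub>M p\<in>?J. unif01) (\<Pi>\<^sub>M p\<in>?K. unif01) (\<lambda>\<theta>. \<lambda>p\<in>?K. \<theta> (c # p))) =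
        (\<integral>\<^sup>+\<theta>. f (x, \<lambda>p\<in>?K. \<theta> (c # p)) \<partial>(\<Pi>\<^sub>M p\<in>?J. unif01))"
        by (rule nn_integral_distr[OF r]) measurable
      then show ?thesis unfolding d by simp
    qed
  qed
  finally show ?thesis .
qed

section \<open>Bits handed down the tree\<close>

fun tree_value :: "(nat \<Rightarrow> real) \<Rightarrow> btree \<Rightarrow> real" where
  "tree_value z (Lf i) = z i"
| "tree_value z (Nd l r) = merge_value (tree_value z l) (tree_value z r)"

definition threshold :: "real \<Rightarrow> real \<Rightarrow> real" where
  "threshold a b = (if a + b \<le> 1 then a / (a + b) else (1 - b) / (2 - a - b))"

definition node_small :: "(nat \<Rightarrow> real) \<Rightarrow> btree \<Rightarrow> btree \<Rightarrow> bool" where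
  "node_small z l r \<longleftrightarrow> tree_value z l + tree_value z r \<le> 1"

definition node_threshold :: "(nat \<Rightarrow> real) \<Rightarrow> btree \<Rightarrow> btree \<Rightarrow> real" where
  "node_threshold z l r = threshold (tree_value z l) (tree_value z r)"

fun out_bits :: "btree \<Rightarrow> (bool list \<Rightarrow> real) \<Rightarrow> (nat \<Rightarrow> real) \<Rightarrow> bool \<Rightarrow> nat set" where
  "out_bits (Lf i) \<theta> z B = (if B then {i} else {})"
| "out_bits (Nd l r) \<theta> z B =
     out_bits l (\<lambda>p. \<theta> (False # p)) z (route (node_small z l r) (\<theta> [] \<le> node_threshold z l r) B) \<union>
     out_bits r (\<lambda>p. \<theta> (True # p)) z (route (node_small z l r) (\<not> \<theta> [] \<le> node_threshold z l r) B)"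

lemma merge_value_bounds: "a \<in> {0..1} \<Longrightarrow> b \<in> {0..1} \<Longrightarrow> merge_value a b \<in> {0..1}"
  by (auto simp: merge_value_def)

lemma tree_value_bounds: "(\<And>j. j \<in> set (leaves t) \<Longrightarrow> z j \<in> {0..1}) \<Longrightarrow> tree_value z t \<in> {0..1}"
  by (induction t) (auto intro!: merge_value_bounds simp del: atLeastAtMost_iff)

text \<open>For a = b = 0 and a = b = 1 the quotient is 0 by the convention for division by 0, and
  \<open>pass_prob\<close> accepts it because both sides of its equation vanish.\<close>

lemma pass_prob_threshold:
  assumes "a \<in> {0..1}" "b \<in> {0..1}" shows "pass_prob a b (threshold a b)"
proof (cases "a + b \<le> 1")
  case True
  have "a / (a + b) * (a + b) = a" using assms by (cases "a + b = 0") auto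
  moreover have "0 \<le> a / (a + b)" "a / (a + b) \<le> 1" using assms by (auto simp: divide_le_eq)
  ultimately show ?thesis using True by (simp add: pass_prob_def threshold_def)
next
  case False
  have "(1 - b) / (2 - a - b) * (2 - a - b) = 1 - b" using assms by (cases "2 - a - b = 0") auto
  moreover have "0 \<le> (1 - b) / (2 - a - b)" "(1 - b) / (2 - a - b) \<le> 1" using assms by (auto simp: divide_le_eq)
  ultimately show ?thesis using False by (simp add: pass_prob_def threshold_def)
qed

lemma out_bits_subset: "out_bits t \<theta> z B \<subseteq> set (leaves t)"
proof (induction t arbitrary: \<theta> B)
  case (Nd l r) then show ?case unfolding out_bits.simps leaves.simps set_append by (intro Un_mono)
qed simp

text \<open>The bottom-up and the top-down reading agree: once the coordinate passed up by a subtree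
  receives its bit B, everything below is determined. The induction generalises over B, since the
  two children may receive different bits.\<close>

lemma pivot_eq_out_bits:
  "pivot \<theta> z t = ((i, a), F) \<Longrightarrow> a = tree_value z t \<and> out_bits t \<theta> z B = (if B then insert i F else F)"
proof (induction t arbitrary: \<theta> i a F B)
  case (Lf j) then show ?case by auto
next
  case (Nd l r)
  obtain i1 a1 F1 where l: "pivot (\<lambda>p. \<theta> (False # p)) z l = ((i1, a1), F1)" by (metis surj_pair)
  obtain i2 a2 F2 where r: "pivot (\<lambda>p. \<theta> (True # p)) z r = ((i2, a2), F2)" by (metis surj_pair)
  note IH = Nd.IH(1)[OF l] Nd.IH(2)[OF r]
  have a: "a1 = tree_value z l" "a2 = tree_value z r" using IH by blast+
  have o: "out_bits l (\<lambda>p. \<theta> (False # p)) z B = (if B then insert i1 F1 else F1)"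
    "out_bits r (\<lambda>p. \<theta> (True # p)) z B = (if B then insert i2 F2 else F2)" for B
    using IH by blast+
  show ?case using Nd.prems l r
    by (auto simp: o a route_def node_small_def node_threshold_def threshold_def merge_value_def
        split: if_splits)
qed

lemma tree_output_eq_out_bits:
  "tree_output t \<theta>r \<theta> z = out_bits t \<theta> z (\<theta>r < tree_value z t)"
proof -
  obtain i a F where p: "pivot \<theta> z t = ((i, a), F)" by (metis surj_pair)
  show ?thesis using pivot_eq_out_bits[OF p] by (auto simp: tree_output_def p)
qed

lemma measurable_tree_value [measurable (raw)]:
  assumes "\<And>j. j \<in> set (leaves t) \<Longrightarrow> (\<lambda>w. z w j) \<in> borel_measurable M"
  shows "(\<lambda>w. tree_value (z w) t) \<in> borel_measurable M"
  using assms by (induction t) (auto simp: merge_value_def)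

lemma pred_out_bits [measurable (raw)]:
  assumes "\<And>j. j \<in> set (leaves t) \<Longrightarrow> (\<lambda>w. z w j) \<in> borel_measurable M"
    and "\<And>p. p \<in> internal_nodes t \<Longrightarrow> (\<lambda>w. \<theta> w p) \<in> borel_measurable M"
    and "Measurable.pred M B"
  shows "Measurable.pred M (\<lambda>w. i \<in> out_bits t (\<theta> w) (z w) (B w))"
  using assms
proof (induction t arbitrary: \<theta> B)
  case (Lf j)
  note [measurable] = Lf(3)
  have "Measurable.pred M (\<lambda>w. B w \<and> i = j)" by measurable
  moreover have "(\<lambda>w. i \<in> out_bits (Lf j) (\<theta> w) (z w) (B w)) = (\<lambda>w. B w \<and> i = j)" by auto
  ultimately show ?case by simp
next
  case (Nd l r)
  note [measurable] = Nd.prems(3)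
  have [measurable]: "(\<lambda>w. \<theta> w []) \<in> borel_measurable M" using Nd.prems(2) by simp
  have [measurable]: "(\<lambda>w. tree_value (z w) l) \<in> borel_measurable M" "(\<lambda>w. tree_value (z w) r) \<in> borel_measurable M"
    using Nd.prems(1) by (auto intro!: measurable_tree_value)
  have [measurable]: "Measurable.pred M (\<lambda>w. node_small (z w) l r)" unfolding node_small_def by measurable
  have [measurable]: "(\<lambda>w. node_threshold (z w) l r) \<in> borel_measurable M"
    unfolding node_threshold_def threshold_def by measurable
  have [measurable]: "Measurable.pred M (\<lambda>w. i \<in> out_bits l (\<lambda>p. \<theta> w (False # p)) (z w)
      (route (node_small (z w) l r) (\<theta> w [] \<le> node_threshold (z w) l r) (B w)))"
    by (rule Nd.IH) (use Nd.prems in \<open>auto simp: route_def\<close>)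
  have [measurable]: "Measurable.pred M (\<lambda>w. i \<in> out_bits r (\<lambda>p. \<theta> w (True # p)) (z w)
      (route (node_small (z w) l r) (\<not> \<theta> w [] \<le> node_threshold (z w) l r) (B w)))"
    by (rule Nd.IH) (use Nd.prems in \<open>auto simp: route_def\<close>)
  show ?case by simp
qed

text \<open>
  The expectation of \<open>\<Sum>i. \<phi> i (i \<in> X) (i \<in> X')\<close> for the outputs \<open>X, X'\<close> of the tree on \<open>z, z'\<close> with root
  bits \<open>B, B'\<close>.
\<close>

fun bit_cost :: "(nat \<Rightarrow> bool \<Rightarrow> bool \<Rightarrow> real) \<Rightarrow> btree \<Rightarrow> (nat \<Rightarrow> real) \<Rightarrow> (nat \<Rightarrow> real) \<Rightarrow> bool \<Rightarrow> bool \<Rightarrow> real" where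
  "bit_cost \<phi> (Lf i) z z' B B' = \<phi> i B B'"
| "bit_cost \<phi> (Nd l r) z z' B B' = (\<Sum>e\<in>UNIV. \<Sum>e'\<in>UNIV.
     joint_weight (node_threshold z l r) (node_threshold z' l r) e e' *
     (bit_cost \<phi> l z z' (route (node_small z l r) e B) (route (node_small z' l r) e' B') +
      bit_cost \<phi> r z z' (route (node_small z l r) (\<not> e) B) (route (node_small z' l r) (\<not> e') B')))"

lemma node_threshold_bounds:
  assumes "\<And>j. j \<in> set (leaves (Nd l r)) \<Longrightarrow> z j \<in> {0..1}"
  shows "node_threshold z l r \<in> {0..1}"
  using pass_prob_threshold[of "tree_value z l" "tree_value z r"] tree_value_bounds[of l z] tree_value_bounds[of r z] assms
  by (auto simp: node_threshold_def pass_prob_def)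

lemma bit_cost_nonneg:
  assumes "\<And>j. j \<in> set (leaves t) \<Longrightarrow> z j \<in> {0..1}" "\<And>j. j \<in> set (leaves t) \<Longrightarrow> z' j \<in> {0..1}"
    and "\<And>i b b'. 0 \<le> \<phi> i b b'"
  shows "0 \<le> bit_cost \<phi> t z z' B B'"
  using assms
proof (induction t arbitrary: B B')
  case (Nd l r)
  have p: "node_threshold z l r \<in> {0..1}" "node_threshold z' l r \<in> {0..1}"
    using Nd.prems by (auto intro!: node_threshold_bounds simp del: atLeastAtMost_iff)
  show ?case unfolding bit_cost.simps
    by (intro sum_nonneg mult_nonneg_nonneg joint_weight_nonneg p add_nonneg_nonneg Nd.IH) (use Nd.prems in auto)
qed simp

text \<open>The cost is a sum over leaves, so it splits into one sum per child, and each sum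
  involves only the coin at the node and that child's coins. The joint behaviour of the two children
  never enters.\<close>

lemma nn_integral_out_bits:
  assumes "distinct (leaves t)"
    and "\<And>j. j \<in> set (leaves t) \<Longrightarrow> z j \<in> {0..1}" "\<And>j. j \<in> set (leaves t) \<Longrightarrow> z' j \<in> {0..1}"
    and \<phi>: "\<And>i b b'. 0 \<le> \<phi> i b b'"
  shows "(\<integral>\<^sup>+\<theta>. (\<Sum>i\<in>set (leaves t). ennreal (\<phi> i (i \<in> out_bits t \<theta> z B) (i \<in> out_bits t \<theta> z' B')))
      \<partial>(tree_coins t)) = ennreal (bit_cost \<phi> t z z' B B')"
  using assms(1-3)
proof (induction t arbitrary: B B')
  case (Lf i)
  have "prob_space (tree_coins (Lf i))" by (intro prob_space_PiM prob_space_unif01)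
  from prob_space.emeasure_space_1[OF this] show ?case by (simp del: internal_nodes.simps)
next
  case (Nd l r)
  let ?s = "node_small z l r" and ?s' = "node_small z' l r"
  let ?p = "node_threshold z l r" and ?p' = "node_threshold z' l r"
  have p: "?p \<in> {0..1}" "?p' \<in> {0..1}"
    using Nd.prems by (auto intro!: node_threshold_bounds simp del: atLeastAtMost_iff)
  \<comment> \<open>One definition serves both children: for c = True, the right child, the
    comparison \<open>\<noteq> c\<close> negates the event.\<close>
  define child where "child c = (if c then r else l)" for c
  define bit where "bit c x = route ?s ((x \<le> ?p) \<noteq> c) B" for c x
  define bit' where "bit' c x = route ?s' ((x \<le> ?p') \<noteq> c) B'" for c x
  define f where "f c xy = (\<Sum>i\<in>set (leaves (child c)).
      ennreal (\<phi> i (i \<in> out_bits (child c) (snd xy) z (bit c (fst xy))) (i \<in> out_bits (child c) (snd xy) z' (bit' c (fst xy)))))"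
    for c and xy :: "real \<times> (bool list \<Rightarrow> real)"
  have f_meas: "f c \<in> borel_measurable (unif01 \<Otimes>\<^sub>M (tree_coins (child c)))" for c
  proof -
    let ?M = "unif01 \<Otimes>\<^sub>M (tree_coins (child c))"
    have [measurable]: "Measurable.pred ?M (\<lambda>xy. bit c (fst xy))" "Measurable.pred ?M (\<lambda>xy. bit' c (fst xy))"
      unfolding bit_def bit'_def route_def by measurable
    have [measurable]: "Measurable.pred ?M (\<lambda>xy. i \<in> out_bits (child c) (snd xy) y (b xy))"
      if [measurable]: "Measurable.pred ?M b" for i y b
      by (rule pred_out_bits) measurable
    have "(\<lambda>xy. ennreal (\<phi> i (P xy) (Q xy))) \<in> borel_measurable ?M"
      if [measurable]: "Measurable.pred ?M P" "Measurable.pred ?M Q" for i P Q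
    proof -
      have "(\<lambda>xy. ennreal (\<phi> i (P xy) (Q xy))) = (\<lambda>xy. if P xy then if Q xy then ennreal (\<phi> i True True) else ennreal (\<phi> i True False)
          else if Q xy then ennreal (\<phi> i False True) else ennreal (\<phi> i False False))" by auto
      then show ?thesis by simp
    qed
    then show ?thesis unfolding f_def by (intro borel_measurable_sum) simp
  qed
  have split: "(\<Sum>i\<in>set (leaves (Nd l r)). ennreal (\<phi> i (i \<in> out_bits (Nd l r) \<theta> z B) (i \<in> out_bits (Nd l r) \<theta> z' B')))
     = f False (\<theta> [], \<lambda>p. \<theta> (False # p)) + f True (\<theta> [], \<lambda>p. \<theta> (True # p))" for \<theta>
  proof -
    have dj: "set (leaves l) \<inter> set (leaves r) = {}" using Nd.prems(1) by simp
    have L: "i \<in> out_bits (Nd l r) \<theta> y C \<longleftrightarrow> i \<in> out_bits l (\<lambda>p. \<theta> (False # p)) y (route (node_small y l r) (\<theta> [] \<le> node_threshold y l r) C)"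
      if "i \<in> set (leaves l)" for i y C
      using that dj by (auto dest: subsetD[OF out_bits_subset[of r]])
    have R: "i \<in> out_bits (Nd l r) \<theta> y C \<longleftrightarrow> i \<in> out_bits r (\<lambda>p. \<theta> (True # p)) y (route (node_small y l r) (\<not> \<theta> [] \<le> node_threshold y l r) C)"
      if "i \<in> set (leaves r)" for i y C
      using that dj by (auto dest: subsetD[OF out_bits_subset[of l]])
    show ?thesis
      using dj L R
      by (simp add: f_def child_def bit_def bit'_def sum.union_disjoint del: out_bits.simps)
  qed
  have int: "(\<integral>\<^sup>+\<theta>. f c (\<theta> [], \<lambda>p. \<theta> (c # p)) \<partial>(tree_coins (Nd l r))) =
     ennreal (\<Sum>e\<in>UNIV. \<Sum>e'\<in>UNIV. joint_weight ?p ?p' e e' *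
       bit_cost \<phi> (child c) z z' (route ?s (e \<noteq> c) B) (route ?s' (e' \<noteq> c) B'))" for c
  proof -
    have "(\<integral>\<^sup>+\<theta>. f c (\<theta> [], \<lambda>p. \<theta> (c # p)) \<partial>(tree_coins (Nd l r))) =
       (\<integral>\<^sup>+x. \<integral>\<^sup>+y. f c (x, y) \<partial>(tree_coins (child c)) \<partial>unif01)"
      using f_meas unfolding child_def by (rule nn_integral_child_randomness)
    also have "\<dots> = (\<integral>\<^sup>+x. ennreal (bit_cost \<phi> (child c) z z' (bit c x) (bit' c x)) \<partial>unif01)"
      unfolding f_def fst_conv snd_conv
      by (intro nn_integral_cong, cases c) (use Nd in \<open>simp_all add: child_def\<close>)
    also have "\<dots> = ennreal (\<Sum>e\<in>UNIV. \<Sum>e'\<in>UNIV. joint_weight ?p ?p' e e' *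
       bit_cost \<phi> (child c) z z' (route ?s (e \<noteq> c) B) (route ?s' (e' \<noteq> c) B'))"
      unfolding bit_def bit'_def
    proof (rule nn_integral_two_thresholds[OF p])
      show "0 \<le> bit_cost \<phi> (child c) z z' (route ?s (e \<noteq> c) B) (route ?s' (e' \<noteq> c) B')" for e e'
        using Nd.prems by (intro bit_cost_nonneg \<phi>) (auto simp: child_def split: if_splits)
    qed
    finally show ?thesis .
  qed
  have m: "(\<lambda>\<theta>. f c (\<theta> [], \<lambda>p. \<theta> (c # p))) \<in> borel_measurable (tree_coins (Nd l r))" for c
  proof -
    note [measurable] = f_meas[of c, unfolded child_def]
    show ?thesis by measurable
  qed
  have nn: "0 \<le> (\<Sum>e\<in>UNIV. \<Sum>e'\<in>UNIV. joint_weight ?p ?p' e e' *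
       bit_cost \<phi> (child c) z z' (route ?s (e \<noteq> c) B) (route ?s' (e' \<noteq> c) B'))" for c
    by (intro sum_nonneg mult_nonneg_nonneg joint_weight_nonneg p bit_cost_nonneg \<phi>)
       (use Nd.prems in \<open>auto simp: child_def split: if_splits\<close>)
  have "(\<integral>\<^sup>+\<theta>. (\<Sum>i\<in>set (leaves (Nd l r)). ennreal (\<phi> i (i \<in> out_bits (Nd l r) \<theta> z B) (i \<in> out_bits (Nd l r) \<theta> z' B')))
      \<partial>(tree_coins (Nd l r))) =
      (\<integral>\<^sup>+\<theta>. f False (\<theta> [], \<lambda>p. \<theta> (False # p)) \<partial>(tree_coins (Nd l r))) +
      (\<integral>\<^sup>+\<theta>. f True (\<theta> [], \<lambda>p. \<theta> (True # p)) \<partial>(tree_coins (Nd l r)))"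
    unfolding split by (rule nn_integral_add) (rule m)+
  also have "\<dots> = ennreal (bit_cost \<phi> (Nd l r) z z' B B')"
    unfolding int using nn[of False] nn[of True]
    by (simp add: child_def ennreal_plus[symmetric] sum.distrib distrib_left del: ennreal_plus)
  finally show ?case .
qed

text \<open>Averaged over the node's pair of bits, the cost becomes one average per child, against
  that child's own law. This is what lets the inductions carry a law on pairs of bits
  downwards.\<close>

lemma bit_cost_node_law:
  fixes q :: "bool \<Rightarrow> bool \<Rightarrow> real"
  defines "s z l r \<equiv> node_small z l r" and "p z l r \<equiv> node_threshold z l r"
  shows "(\<Sum>B\<in>UNIV. \<Sum>B'\<in>UNIV. q B B' * bit_cost \<phi> (Nd l r) z z' B B') =
     (\<Sum>x\<in>UNIV. \<Sum>x'\<in>UNIV. child_law (s z l r) (s z' l r) (p z l r) (p z' l r) q x x' * bit_cost \<phi> l z z' x x') +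
     (\<Sum>x\<in>UNIV. \<Sum>x'\<in>UNIV. child_law (s z l r) (s z' l r) (1 - p z l r) (1 - p z' l r) q x x' * bit_cost \<phi> r z z' x x')"
proof -
  obtain S S' where S: "node_small z l r = S" "node_small z' l r = S'" by blast
  define w where "w = joint_weight (node_threshold z l r) (node_threshold z' l r)"
  have w: "joint_weight (node_threshold z l r) (node_threshold z' l r) = w" by (simp add: w_def)
  show ?thesis unfolding bit_cost.simps s_def p_def child_law_def joint_weight_flip w S
    by (cases S; cases S') (simp_all add: UNIV_bool route_def algebra_simps)
qed

lemma merge_value_commute: "merge_value a b = merge_value b a"
  by (simp add: merge_value_def add.commute)

text \<open>This \<phi> reads off a single marginal. Every coupling gives the same result, since
  each child again receives a coupling with its values as means, down to the leaf u.\<close>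

lemma bit_cost_member:
  assumes "distinct (leaves t)"
    and "\<And>j. j \<in> set (leaves t) \<Longrightarrow> z j \<in> {0..1}" "\<And>j. j \<in> set (leaves t) \<Longrightarrow> z' j \<in> {0..1}"
    and "coupling (tree_value z t) (tree_value z' t) q"
  shows "(\<Sum>B\<in>UNIV. \<Sum>B'\<in>UNIV. q B B' * bit_cost (\<lambda>i b b'. of_bool (b \<and> i = u)) t z z' B B') =
    (if u \<in> set (leaves t) then z u else 0)"
  using assms
proof (induction t arbitrary: q)
  case (Lf i) then show ?case by (auto simp: UNIV_bool coupling_def)
next
  case (Nd l r)
  let ?a = "tree_value z l" and ?b = "tree_value z r" and ?a' = "tree_value z' l" and ?b' = "tree_value z' r"
  have ab: "?a \<in> {0..1}" "?b \<in> {0..1}" "?a' \<in> {0..1}" "?b' \<in> {0..1}"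
    using Nd.prems by (auto intro!: tree_value_bounds simp del: atLeastAtMost_iff)
  have q: "coupling (merge_value ?a ?b) (merge_value ?a' ?b') q" "coupling (merge_value ?b ?a) (merge_value ?b' ?a') q"
    using Nd.prems(4) merge_value_commute[of ?a ?b] merge_value_commute[of ?a' ?b'] by simp_all
  have p: "pass_prob ?a ?b (node_threshold z l r)" "pass_prob ?a' ?b' (node_threshold z' l r)"
    unfolding node_threshold_def using ab by (auto intro!: pass_prob_threshold simp del: atLeastAtMost_iff)
  have 1: "coupling ?a ?a' (child_law (node_small z l r) (node_small z' l r) (node_threshold z l r) (node_threshold z' l r) q)"
    unfolding node_small_def by (rule coupling_child_law[OF q(1) p])
  have 2: "coupling ?b ?b' (child_law (node_small z l r) (node_small z' l r) (1 - node_threshold z l r) (1 - node_threshold z' l r) q)"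
    using coupling_child_law[OF q(2) pass_prob_flip[OF p(1)] pass_prob_flip[OF p(2)]]
    by (simp add: node_small_def add.commute)
  show ?case using Nd.IH(1)[OF _ _ _ 1] Nd.IH(2)[OF _ _ _ 2] Nd.prems
    by (auto simp: bit_cost_node_law simp del: bit_cost.simps)
qed


section \<open>Expected difference of two outputs of the tree\<close>

definition bit_diff :: "nat \<Rightarrow> bool \<Rightarrow> bool \<Rightarrow> real" where
  "bit_diff i b b' = of_bool (b \<noteq> b')"

lemma tree_value_cong: "(\<And>j. j \<in> set (leaves t) \<Longrightarrow> z j = z' j) \<Longrightarrow> tree_value z t = tree_value z' t"
  by (induction t) auto

text \<open>Equal thresholds give equal events e, and then a difference of the bits survives in
  exactly one child, namely the one whose coordinate is passed up.\<close>

lemma bit_diff_same: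
  assumes "\<And>j. j \<in> set (leaves t) \<Longrightarrow> z j = z' j"
  shows "bit_cost bit_diff t z z' B B' = of_bool (B \<noteq> B')"
  using assms
proof (induction t arbitrary: B B')
  case (Nd l r)
  have v: "tree_value z l = tree_value z' l" "tree_value z r = tree_value z' r"
    using Nd.prems by (auto intro!: tree_value_cong)
  then have s: "node_small z l r = node_small z' l r" "node_threshold z l r = node_threshold z' l r"
    by (simp_all add: node_small_def node_threshold_def)
  have IH: "bit_cost bit_diff l z z' B B' = of_bool (B \<noteq> B')" "bit_cost bit_diff r z z' B B' = of_bool (B \<noteq> B')" for B B'
    using Nd by auto
  show ?case by (cases B; cases B') (auto simp: IH s UNIV_bool joint_weight_def route_def)
qed (simp add: bit_diff_def)

text \<open>Values are partial sums modulo 1, and \<epsilon> \<le> 1, so at most one integer is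
  passed.\<close>

lemma tree_value_step:
  assumes "u \<in> set (leaves t)" "distinct (leaves t)" "\<And>j. j \<in> set (leaves t) \<Longrightarrow> z j \<in> {0..1}"
    and "z' = z(u := z u + \<epsilon>)" "0 \<le> \<epsilon>" "z u + \<epsilon> \<le> 1"
  shows "tree_value z' t = tree_value z t + \<epsilon> \<or> tree_value z' t = tree_value z t + \<epsilon> - 1"
  using assms(1-3)
proof (induction t)
  case (Nd l r)
  have B: "z' j \<in> {0..1}" if "j \<in> set (leaves (Nd l r))" for j
    using Nd.prems(1) Nd.prems(3)[OF that] Nd.prems(3)[OF Nd.prems(1)] assms by auto
  have e1: "\<epsilon> \<le> 1" using assms(6) Nd.prems(3)[OF Nd.prems(1)] by simp
  have b: "tree_value y t \<in> {0..1}" if "t \<in> {l, r}" "y \<in> {z, z'}" for t y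
    using that Nd.prems B by (auto intro!: tree_value_bounds simp del: atLeastAtMost_iff)
  have b: "tree_value z l \<in> {0..1}" "tree_value z r \<in> {0..1}" "tree_value z' l \<in> {0..1}" "tree_value z' r \<in> {0..1}"
    by (rule b; simp)+
  consider "u \<in> set (leaves l)" "u \<notin> set (leaves r)" | "u \<in> set (leaves r)" "u \<notin> set (leaves l)"
    using Nd.prems by auto
  then show ?case
  proof cases
    case 1
    then have "tree_value z' r = tree_value z r" using assms by (auto intro!: tree_value_cong)
    moreover have "tree_value z' l = tree_value z l + \<epsilon> \<or> tree_value z' l = tree_value z l + \<epsilon> - 1"
      using Nd.prems 1 by (intro Nd.IH) auto
    ultimately show ?thesis using b assms(5) e1 by (auto simp: merge_value_def)
  next
    case 2
    then have "tree_value z' l = tree_value z l" using assms by (auto intro!: tree_value_cong)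
    moreover have "tree_value z' r = tree_value z r + \<epsilon> \<or> tree_value z' r = tree_value z r + \<epsilon> - 1"
      using Nd.prems 2 by (intro Nd.IH) auto
    ultimately show ?thesis using b assms(5) e1 by (auto simp: merge_value_def)
  qed
qed (use assms in auto)

text \<open>Each node on the path to u adds at most 4 \<epsilon> for its other child, and the leaf
  itself adds \<epsilon>. At the leaf nothing wraps, so the coupling that arrives there is
  monotone.\<close>

lemma bit_diff_step:
  assumes "u \<in> set (leaves t)" "distinct (leaves t)" "\<And>j. j \<in> set (leaves t) \<Longrightarrow> z j \<in> {0..1}"
    and z': "z' = z(u := z u + \<epsilon>)" "0 \<le> \<epsilon>" "z u + \<epsilon> \<le> 1"
    and "step_coupling \<epsilon> (tree_value z t) (tree_value z' t) q"
  shows "(\<Sum>B\<in>UNIV. \<Sum>B'\<in>UNIV. q B B' * bit_cost bit_diff t z z' B B') \<le> (1 + 4 * real (depth t)) * \<epsilon>"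
  using assms(1-3,7)
proof (induction t arbitrary: q)
  case (Lf i)
  then have "q False True = \<epsilon>" "q True False = 0" using z' by (auto simp: step_coupling_def coupling_def)
  then show ?case by (simp add: UNIV_bool bit_diff_def)
next
  case (Nd l r)
  let ?a = "tree_value z l" and ?b = "tree_value z r" and ?a' = "tree_value z' l" and ?b' = "tree_value z' r"
  let ?p = "node_threshold z l r" and ?p' = "node_threshold z' l r"
  have B: "z' j \<in> {0..1}" if "j \<in> set (leaves (Nd l r))" for j
    using Nd.prems(1) Nd.prems(3)[OF that] Nd.prems(3)[OF Nd.prems(1)] z' by auto
  have ab: "?a \<in> {0..1}" "?b \<in> {0..1}" "?a' \<in> {0..1}" "?b' \<in> {0..1}"
    using Nd.prems B by (auto intro!: tree_value_bounds simp del: atLeastAtMost_iff)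
  have e1: "\<epsilon> \<le> 1" using z' Nd.prems(3)[OF Nd.prems(1)] by simp
  have q: "step_coupling \<epsilon> (merge_value ?a ?b) (merge_value ?a' ?b') q" "step_coupling \<epsilon> (merge_value ?b ?a) (merge_value ?b' ?a') q"
    using Nd.prems(4) merge_value_commute[of ?a ?b] merge_value_commute[of ?a' ?b'] by simp_all
  have p: "pass_prob ?a ?b ?p" "pass_prob ?a' ?b' ?p'"
    unfolding node_threshold_def using ab by (auto intro!: pass_prob_threshold simp del: atLeastAtMost_iff)
  have dp: "real (depth l) + 1 \<le> real (depth (Nd l r))" "real (depth r) + 1 \<le> real (depth (Nd l r))" by auto
  consider "u \<in> set (leaves l)" "u \<notin> set (leaves r)" | "u \<in> set (leaves r)" "u \<notin> set (leaves l)"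
    using Nd.prems by auto
  then show ?case
  proof cases
    case 1
    have eq: "z j = z' j" if "j \<in> set (leaves r)" for j using that 1 z' by auto
    have same: "bit_cost bit_diff r z z' B B' = of_bool (B \<noteq> B')" for B B'
      by (rule bit_diff_same) (rule eq)
    have b': "?b' = ?b" by (rule tree_value_cong) (simp add: eq)
    have aa: "?a' = ?a + \<epsilon> \<or> ?a' = ?a + \<epsilon> - 1"
      using Nd.prems 1 z' by (intro tree_value_step[of u]) auto
    note st = pivotal_step[OF q(1)[unfolded b'] p(1) p(2)[unfolded b'] ab(1,2,3) z'(2) e1 aa]
    have S: "node_small z l r = (?a + ?b \<le> 1)" "node_small z' l r = (?a' + ?b \<le> 1)"
      by (simp_all add: node_small_def b')
    have "(\<Sum>x\<in>UNIV. \<Sum>x'\<in>UNIV. child_law (node_small z l r) (node_small z' l r) ?p ?p' q x x' * bit_cost bit_diff l z z' x x')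
        \<le> (1 + 4 * real (depth l)) * \<epsilon>"
      unfolding S using Nd.prems 1 st(1) by (intro Nd.IH) auto
    moreover have "(\<Sum>x\<in>UNIV. \<Sum>x'\<in>UNIV. child_law (node_small z l r) (node_small z' l r) (1 - ?p) (1 - ?p') q x x' * bit_cost bit_diff r z z' x x')
       = sibling_diff (node_small z l r) (node_small z' l r) ?p ?p' q"
      unfolding same child_law_def sibling_diff_def joint_weight_flip
      by (cases "node_small z l r"; cases "node_small z' l r") (simp_all add: UNIV_bool route_def algebra_simps)
    moreover have "\<dots> \<le> 4 * \<epsilon>" unfolding S by (rule st(2))
    ultimately show ?thesis unfolding bit_cost_node_law
      using mult_right_mono[OF dp(1) z'(2)] by (simp add: algebra_simps del: depth.simps)
  next
    case 2
    have eq: "z j = z' j" if "j \<in> set (leaves l)" for j using that 2 z' by auto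
    have same: "bit_cost bit_diff l z z' B B' = of_bool (B \<noteq> B')" for B B'
      by (rule bit_diff_same) (rule eq)
    have a': "?a' = ?a" by (rule tree_value_cong) (simp add: eq)
    have aa: "?b' = ?b + \<epsilon> \<or> ?b' = ?b + \<epsilon> - 1"
      using Nd.prems 2 z' by (intro tree_value_step[of u]) auto
    \<comment> \<open>The right child in the role of the left one: the values are exchanged and the
      thresholds replaced by their complements.\<close>
    note st = pivotal_step[OF q(2)[unfolded a'] pass_prob_flip[OF p(1)] pass_prob_flip[OF p(2)[unfolded a']] ab(2,1,4) z'(2) e1 aa]
    have S: "node_small z l r = (?b + ?a \<le> 1)" "node_small z' l r = (?b' + ?a \<le> 1)"
      by (simp_all add: node_small_def a' add.commute)
    have "(\<Sum>x\<in>UNIV. \<Sum>x'\<in>UNIV. child_law (node_small z l r) (node_small z' l r) (1 - ?p) (1 - ?p') q x x' * bit_cost bit_diff r z z' x x')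
        \<le> (1 + 4 * real (depth r)) * \<epsilon>"
      unfolding S using Nd.prems 2 st(1) by (intro Nd.IH) auto
    moreover have "(\<Sum>x\<in>UNIV. \<Sum>x'\<in>UNIV. child_law (node_small z l r) (node_small z' l r) ?p ?p' q x x' * bit_cost bit_diff l z z' x x')
       = sibling_diff (node_small z l r) (node_small z' l r) (1 - ?p) (1 - ?p') q"
      unfolding same child_law_def sibling_diff_def joint_weight_flip
      by (cases "node_small z l r"; cases "node_small z' l r") (simp_all add: UNIV_bool route_def algebra_simps)
    moreover have "\<dots> \<le> 4 * \<epsilon>" unfolding S by (rule st(2))
    ultimately show ?thesis unfolding bit_cost_node_law
      using mult_right_mono[OF dp(2) z'(2)] by (simp add: algebra_simps del: depth.simps)
  qed
qed

text \<open>Each merge above 1 lowers the value by 1 and fixes one coordinate to 1, so the size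
  depends on the randomness only through the root bit.\<close>

lemma card_out_bits:
  assumes "distinct (leaves t)"
  shows "real (card (out_bits t \<theta> z B)) = (\<Sum>j\<in>set (leaves t). z j) - tree_value z t + of_bool B"
  using assms
proof (induction t arbitrary: \<theta> B)
  case (Nd l r)
  have dj: "set (leaves l) \<inter> set (leaves r) = {}" using Nd.prems by auto
  have fin: "finite (out_bits l \<theta> z B)" "finite (out_bits r \<theta> z B)" for \<theta> B
    by (rule finite_subset[OF out_bits_subset]; simp)+
  have d: "out_bits l \<theta> z B \<inter> out_bits r \<theta>' z B' = {}" for \<theta> \<theta>' B B'
    using dj out_bits_subset[of l \<theta> z B] out_bits_subset[of r \<theta>' z B'] by blast
  show ?case using Nd dj
    by (auto simp: card_Un_disjoint[OF fin d] sum.union_disjoint merge_value_def route_def node_small_def)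
qed simp

section \<open>Cardinalities of symmetric differences\<close>

lemma card_eq_sum_of_bool:
  assumes "X \<subseteq> A" "finite A" shows "real (card X) = (\<Sum>i\<in>A. of_bool (i \<in> X))"
  using assms by (simp add: of_bool_def sum.If_cases Int_absorb1 Int_commute)

lemma card_sym_diff_eq_sum:
  assumes "X \<subseteq> A" "Y \<subseteq> A" "finite A"
  shows "real (card (sym_diff X Y)) = (\<Sum>i\<in>A. of_bool ((i \<in> X) \<noteq> (i \<in> Y)))"
proof -
  have "real (card (sym_diff X Y)) = (\<Sum>i\<in>A. of_bool (i \<in> sym_diff X Y))"
    using assms by (intro card_eq_sum_of_bool) auto
  also have "\<dots> = (\<Sum>i\<in>A. of_bool ((i \<in> X) \<noteq> (i \<in> Y)))"
    by (intro sum.cong arg_cong[where f=of_bool]) auto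
  finally show ?thesis .
qed

abbreviation set_dist :: "nat set \<Rightarrow> nat set \<Rightarrow> ennreal" where
  "set_dist X Y \<equiv> ennreal (real (card (sym_diff X Y)))"

lemma ennreal_card_sym_diff:
  assumes "X \<subseteq> A" "Y \<subseteq> A" "finite A"
  shows "set_dist X Y = (\<Sum>i\<in>A. ennreal (of_bool ((i \<in> X) \<noteq> (i \<in> Y))))"
  unfolding card_sym_diff_eq_sum[OF assms] by (rule sum_ennreal[symmetric]) simp

lemma sym_diff_triangle:
  assumes "finite X" "finite Y" "finite Z"
  shows "card (sym_diff X Z) \<le> card (sym_diff X Y) + card (sym_diff Y Z)"
proof -
  have "card (sym_diff X Z) \<le> card (sym_diff X Y \<union> sym_diff Y Z)"
    using assms by (intro card_mono) auto
  also have "\<dots> \<le> card (sym_diff X Y) + card (sym_diff Y Z)" by (rule card_Un_le)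
  finally show ?thesis .
qed

lemma borel_measurable_card_sym_diff:
  assumes "\<And>w. w \<in> space M \<Longrightarrow> X w \<subseteq> A" "\<And>w. w \<in> space M \<Longrightarrow> Y w \<subseteq> A" "finite A"
    and "\<And>i. i \<in> A \<Longrightarrow> Measurable.pred M (\<lambda>w. i \<in> X w)" "\<And>i. i \<in> A \<Longrightarrow> Measurable.pred M (\<lambda>w. i \<in> Y w)"
  shows "(\<lambda>w. real (card (sym_diff (X w) (Y w)))) \<in> borel_measurable M"
proof -
  have "(\<lambda>w. \<Sum>i\<in>A. of_bool ((i \<in> X w) \<noteq> (i \<in> Y w)) :: real) \<in> borel_measurable M"
  proof (rule borel_measurable_sum)
    fix i assume "i \<in> A"
    note [measurable] = assms(4,5)[OF this]
    show "(\<lambda>w. of_bool ((i \<in> X w) \<noteq> (i \<in> Y w)) :: real) \<in> borel_measurable M" by measurable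
  qed
  then show ?thesis
    by (rule measurable_cong[THEN iffD2, rotated]) (rule card_sym_diff_eq_sum[OF assms(1,2,3)])
qed

lemma floor_or_ceiling:
  assumes "\<bar>real m - s\<bar> < 1" shows "int m \<in> {\<lfloor>s\<rfloor>, \<lceil>s\<rceil>}"
  using assms by (simp; linarith)

section \<open>Stretch\<close>

lemma Delta_bounds: "x \<in> Delta n k \<Longrightarrow> i \<in> {1..n} \<Longrightarrow> 0 \<le> x i \<and> x i \<le> 1"
  by (auto simp: Delta_def PiE_def Pi_def)

lemma l1norm_Delta: "x \<in> Delta n k \<Longrightarrow> l1norm n x = (\<Sum>i=1..n. x i)"
  unfolding l1norm_def by (intro sum.cong) (auto dest: Delta_bounds)

lemma sum_Delta:
  assumes "x \<in> Delta n k" shows "(\<Sum>i=1..n. x i) \<le> real k"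
  unfolding l1norm_Delta[OF assms, symmetric] using assms by (simp add: Delta_def)

lemma Delta_lower:
  assumes "y \<in> Delta n k" "w \<in> extensional {1..n}" "\<And>i. i \<in> {1..n} \<Longrightarrow> 0 \<le> w i \<and> w i \<le> y i"
  shows "w \<in> Delta n k"
proof -
  have "l1norm n w = (\<Sum>i=1..n. w i)" unfolding l1norm_def using assms(3) by (intro sum.cong) auto
  also have "\<dots> \<le> (\<Sum>i=1..n. y i)" using assms(3) by (intro sum_mono) auto
  also have "\<dots> \<le> k" using assms(1) by (rule sum_Delta)
  finally have "l1norm n w \<le> k" .
  moreover have "w \<in> {1..n} \<rightarrow>\<^sub>E {0..1}"
  proof (rule PiE_I)
    show "w i \<in> {0..1}" if "i \<in> {1..n}" for i
      using assms(3)[OF that] Delta_bounds[OF assms(1) that] by simp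
    show "w i = undefined" if "i \<notin> {1..n}" for i
      using assms(2) that by (rule extensional_arb)
  qed
  ultimately show ?thesis by (simp add: Delta_def)
qed

lemma Delta_extensional: "x \<in> Delta n k \<Longrightarrow> x \<in> extensional {1..n}"
  by (auto simp: Delta_def PiE_def)

section \<open>From single coordinates to the l1 distance\<close>

context
  fixes n k :: nat and D :: "(nat \<Rightarrow> real) \<Rightarrow> (nat \<Rightarrow> real) \<Rightarrow> ennreal" and \<alpha> :: real
  assumes step: "\<And>x u v. x \<in> Delta n k \<Longrightarrow> u \<in> {1..n} \<Longrightarrow> x u \<le> v \<Longrightarrow> x(u := v) \<in> Delta n k \<Longrightarrow>
      D x (x(u := v)) \<le> ennreal (\<alpha> * (v - x u))"
    and refl: "\<And>x. D x x = 0" and sym: "\<And>x y. D x y = D y x"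
    and triangle: "\<And>x y z. x \<in> Delta n k \<Longrightarrow> y \<in> Delta n k \<Longrightarrow> z \<in> Delta n k \<Longrightarrow> D x z \<le> D x y + D y z"
    and \<alpha>: "0 \<le> \<alpha>"
begin

text \<open>The upper point is lowered to the lower one coordinate by coordinate;
  \<open>Delta n k\<close> is closed downwards, so no intermediate point leaves it.\<close>

lemma lipschitz_monotone:
  assumes "finite J" "J \<subseteq> {1..n}" "x \<in> Delta n k" "y \<in> Delta n k"
    and "\<And>i. i \<in> {1..n} \<Longrightarrow> x i \<le> y i" "\<And>i. i \<notin> J \<Longrightarrow> x i = y i"
  shows "D x y \<le> ennreal (\<alpha> * (\<Sum>i\<in>J. y i - x i))"
  using assms
proof (induction J arbitrary: y rule: finite_induct)
  case empty
  then have "x = y" by auto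
  then show ?case by (simp add: refl)
next
  case (insert j J)
  define y' where "y' = y(j := x j)"
  have j: "j \<in> {1..n}" using insert by auto
  have y': "y' \<in> Delta n k" unfolding y'_def
    using insert.prems j Delta_extensional[OF insert.prems(3)] Delta_bounds[OF insert.prems(2)] Delta_bounds[OF insert.prems(3)]
    by (intro Delta_lower[OF insert.prems(3)]) (auto simp: extensional_def)
  have yy: "y = y'(j := y j)" by (auto simp: y'_def)
  have "D x y \<le> D x y' + D y' y" using insert.prems y' by (intro triangle) auto
  also have "D x y' \<le> ennreal (\<alpha> * (\<Sum>i\<in>J. y' i - x i))"
  proof (rule insert.IH)
    show "x i \<le> y' i" if "i \<in> {1..n}" for i using insert.prems(4)[OF that] by (simp add: y'_def)
    show "x i = y' i" if "i \<notin> J" for i using insert.prems(5)[of i] that by (auto simp: y'_def)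
  qed (use insert.prems y' in auto)
  also have "(\<Sum>i\<in>J. y' i - x i) = (\<Sum>i\<in>J. y i - x i)"
    using insert.hyps by (intro sum.cong) (auto simp: y'_def)
  also have "D y' y \<le> ennreal (\<alpha> * (y j - y' j))"
  proof -
    have "D y' (y'(j := y j)) \<le> ennreal (\<alpha> * (y j - y' j))"
    proof (rule step[OF y' j])
      show "y' j \<le> y j" using insert.prems j by (simp add: y'_def)
      show "y'(j := y j) \<in> Delta n k" using insert.prems(3) yy by simp
    qed
    then show ?thesis using yy by simp
  qed
  finally have "D x y \<le> ennreal (\<alpha> * (\<Sum>i\<in>J. y i - x i)) + ennreal (\<alpha> * (y j - x j))"
    by (simp add: y'_def add_mono)
  also have "\<dots> = ennreal (\<alpha> * (\<Sum>i\<in>insert j J. y i - x i))"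
  proof -
    have "0 \<le> (\<Sum>i\<in>J. y i - x i)" "0 \<le> y j - x j"
      using insert.prems j by (auto intro!: sum_nonneg)
    then have "ennreal (\<alpha> * (\<Sum>i\<in>J. y i - x i)) + ennreal (\<alpha> * (y j - x j)) =
        ennreal (\<alpha> * (\<Sum>i\<in>J. y i - x i) + \<alpha> * (y j - x j))"
      using \<alpha> by (intro ennreal_plus[symmetric] mult_nonneg_nonneg)
    then show ?thesis using insert.hyps by (simp add: distrib_left add.commute)
  qed
  finally show ?case .
qed

text \<open>The way from x to y leads down to the componentwise minimum and up again, which keeps it
  inside \<open>Delta n k\<close>. The two halves together are exactly as long as the l1
  distance.\<close>

lemma lipschitz_from_steps:
  assumes "x \<in> Delta n k" "y \<in> Delta n k"
  shows "D x y \<le> ennreal (\<alpha> * l1norm n (\<lambda>i. x i - y i))"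
proof -
  define m where "m = (\<lambda>i\<in>{1..n}. min (x i) (y i))"
  have m: "m \<in> Delta n k"
    using Delta_bounds[OF assms(1)] Delta_bounds[OF assms(2)] by (intro Delta_lower[OF assms(1)]) (auto simp: m_def)
  have L: "D m w \<le> ennreal (\<alpha> * (\<Sum>i=1..n. w i - m i))" if "w \<in> {x, y}" for w
  proof (rule lipschitz_monotone)
    show "m i = w i" if "i \<notin> {1..n}" for i
      using that \<open>w \<in> {x, y}\<close> assms[THEN Delta_extensional] by (auto simp: m_def extensional_def)
  qed (use m assms that in \<open>auto simp: m_def\<close>)
  have "D x y \<le> D x m + D m y" using assms m by (intro triangle)
  also have "\<dots> \<le> ennreal (\<alpha> * (\<Sum>i=1..n. x i - m i)) + ennreal (\<alpha> * (\<Sum>i=1..n. y i - m i))"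
    using L sym[of x m] by (intro add_mono) auto
  also have "\<dots> = ennreal (\<alpha> * (\<Sum>i=1..n. x i - m i) + \<alpha> * (\<Sum>i=1..n. y i - m i))"
    using \<alpha> by (intro ennreal_plus[symmetric] mult_nonneg_nonneg sum_nonneg) (auto simp: m_def)
  also have "\<alpha> * (\<Sum>i=1..n. x i - m i) + \<alpha> * (\<Sum>i=1..n. y i - m i) = \<alpha> * l1norm n (\<lambda>i. x i - y i)"
    unfolding l1norm_def distrib_left[symmetric] sum.distrib[symmetric]
    by (intro arg_cong2[where f="(*)"] sum.cong) (auto simp: m_def)
  finally show ?thesis .
qed

end

section \<open>Laws of random maps\<close>

lemma sets_map_space_component:
  assumes "x \<in> Delta n k" "sets A = sets (map_space n k)"
  shows "(\<lambda>f. f x) \<in> A \<rightarrow>\<^sub>M count_space (Pow {1..n})"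
proof -
  have "(\<lambda>f. f x) \<in> map_space n k \<rightarrow>\<^sub>M count_space (Pow {1..n})"
    unfolding map_space_def using assms(1) by (rule measurable_component_singleton)
  then show ?thesis using measurable_cong_sets[OF assms(2) HOL.refl] by blast
qed

lemma pred_of_map:
  assumes "x \<in> Delta n k" "sets A = sets (map_space n k)"
  shows "Measurable.pred A (\<lambda>f. P (f x))"
  using measurable_compose[OF sets_map_space_component[OF assms], of P "count_space UNIV"] by simp

lemma map_space_subset:
  assumes "x \<in> Delta n k" "sets A = sets (map_space n k)" "f \<in> space A"
  shows "f x \<subseteq> {1..n}"
  using measurable_space[OF sets_map_space_component[OF assms(1,2)] assms(3)] by auto

text \<open>\<open>Delta n k\<close> is an uncountable index set, but the \<sigma>-algebra is
  generated by evaluations, and each value is a subset of a finite set; so membership of single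
  elements decides measurability. Stating the last premise with \<open>nn_integral\<close> keeps its
  users free of integrability obligations.\<close>

lemma has_stretch_distrI:
  fixes F :: "'w \<Rightarrow> (nat \<Rightarrow> real) \<Rightarrow> nat set"
  assumes M: "prob_space M" and \<alpha>: "0 \<le> \<alpha>"
    and pred: "\<And>x i. x \<in> Delta n k \<Longrightarrow> i \<in> {1..n} \<Longrightarrow> Measurable.pred M (\<lambda>w. i \<in> F w x)"
    and sub: "\<And>x w. x \<in> Delta n k \<Longrightarrow> w \<in> space M \<Longrightarrow> F w x \<subseteq> {1..n}"
    and P1: "\<And>x. x \<in> Delta n k \<Longrightarrow> AE w in M. int (card (F w x)) \<in> {\<lfloor>l1norm n x\<rfloor>, \<lceil>l1norm n x\<rceil>}"
    and P2: "\<And>x i. x \<in> Delta n k \<Longrightarrow> i \<in> {1..n} \<Longrightarrow> emeasure M {w \<in> space M. i \<in> F w x} = ennreal (x i)"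
    and P3: "\<And>x y. x \<in> Delta n k \<Longrightarrow> y \<in> Delta n k \<Longrightarrow>
        (\<integral>\<^sup>+w. set_dist (F w x) (F w y) \<partial>M) \<le> ennreal (\<alpha> * l1norm n (\<lambda>i. x i - y i))"
  shows "has_stretch n k (distr M (map_space n k) (\<lambda>w. \<lambda>x\<in>Delta n k. F w x)) \<alpha>"
proof -
  let ?G = "\<lambda>w. \<lambda>x\<in>Delta n k. F w x"
  let ?A = "distr M (map_space n k) ?G"
  have G: "?G \<in> M \<rightarrow>\<^sub>M map_space n k"
    unfolding map_space_def
  proof (rule measurable_restrict)
    fix x assume x: "x \<in> Delta n k"
    show "(\<lambda>w. F w x) \<in> M \<rightarrow>\<^sub>M count_space (Pow {1..n})"
    proof (subst measurable_count_space_eq2, simp, intro conjI ballI funcsetI)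
      show "F w x \<in> Pow {1..n}" if "w \<in> space M" for w using sub[OF x that] by simp
      fix S assume S: "S \<in> Pow {1..n}"
      have "(\<lambda>w. F w x) -` {S} \<inter> space M = {w \<in> space M. \<forall>i\<in>{1..n}. (i \<in> F w x) = (i \<in> S)}"
        using S sub[OF x] by blast
      also have "\<dots> \<in> sets M"
      proof (rule sets.sets_Collect_finite_All)
        fix i assume "i \<in> {1..n}"
        note [measurable] = pred[OF x this]
        show "{w \<in> space M. (i \<in> F w x) = (i \<in> S)} \<in> sets M" by measurable
      qed simp
      finally show "(\<lambda>w. F w x) -` {S} \<inter> space M \<in> sets M" .
    qed
  qed
  have A: "prob_space ?A" "sets ?A = sets (map_space n k)"
    using prob_space.prob_space_distr[OF M G] by auto
  show ?thesis unfolding has_stretch_def correlated_sampling_def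
  proof (intro conjI ballI A)
    fix x assume x: "x \<in> Delta n k"
    have "{f \<in> space (map_space n k). int (card (f x)) \<in> {\<lfloor>l1norm n x\<rfloor>, \<lceil>l1norm n x\<rceil>}} \<in> sets (map_space n k)"
      using pred_of_map[OF x HOL.refl] by (rule predE)
    from AE_distr_iff[OF G this] show "AE f in ?A. int (card (f x)) \<in> {\<lfloor>l1norm n x\<rfloor>, \<lceil>l1norm n x\<rceil>}"
      using P1[OF x] x by simp
    fix i assume i: "i \<in> {1..n}"
    have "{f \<in> space (map_space n k). i \<in> f x} \<in> sets (map_space n k)"
      using pred_of_map[OF x HOL.refl] by (rule predE)
    then have "emeasure ?A {f \<in> space ?A. i \<in> f x} = emeasure M (?G -` {f \<in> space (map_space n k). i \<in> f x} \<inter> space M)"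
      using G by (simp add: emeasure_distr)
    also have "?G -` {f \<in> space (map_space n k). i \<in> f x} \<inter> space M = {w \<in> space M. i \<in> F w x}"
      using x measurable_space[OF G] by auto
    also note P2[OF x i]
    finally have e: "emeasure ?A {f \<in> space ?A. i \<in> f x} = ennreal (x i)" .
    show "measure ?A {f \<in> space ?A. i \<in> f x} = x i"
      using Delta_bounds[OF x i] unfolding measure_def e by simp
  next
    fix x y assume x: "x \<in> Delta n k" and y: "y \<in> Delta n k"
    have m: "(\<lambda>f. real (card (sym_diff (f x) (f y)))) \<in> borel_measurable (map_space n k)"
      by (rule borel_measurable_card_sym_diff[where A="{1..n}"])
        (use x y map_space_subset pred_of_map in auto)
    have "(\<integral>f. real (card (sym_diff (f x) (f y))) \<partial>?A) = (\<integral>w. real (card (sym_diff (F w x) (F w y))) \<partial>M)"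
      using integral_distr[OF G m] x y by simp
    also have "\<dots> \<le> \<alpha> * l1norm n (\<lambda>i. x i - y i)"
      by (rule integral_real_bounded[OF _ P3[OF x y]]) (use \<alpha> in \<open>auto simp: l1norm_def intro!: mult_nonneg_nonneg sum_nonneg\<close>)
    finally show "(\<integral>f. real (card (sym_diff (f x) (f y))) \<partial>?A) \<le> \<alpha> * l1norm n (\<lambda>i. x i - y i)" .
  qed
qed


context
  fixes n k :: nat and A :: sampler and \<alpha> :: real
  assumes A: "has_stretch n k A \<alpha>"
begin

lemma has_stretch_prob_space: "prob_space A"
  and has_stretch_sets: "sets A = sets (map_space n k)"
  using A by (auto simp: has_stretch_def correlated_sampling_def)

lemma has_stretch_pred: "x \<in> Delta n k \<Longrightarrow> Measurable.pred A (\<lambda>f. P (f x))"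
  by (rule pred_of_map[OF _ has_stretch_sets])

lemma has_stretch_subset: "x \<in> Delta n k \<Longrightarrow> f \<in> space A \<Longrightarrow> f x \<subseteq> {1..n}"
  by (rule map_space_subset[OF _ has_stretch_sets])

lemma has_stretch_AE_card:
  "x \<in> Delta n k \<Longrightarrow> AE f in A. int (card (f x)) \<in> {\<lfloor>l1norm n x\<rfloor>, \<lceil>l1norm n x\<rceil>}"
  using A by (auto simp: has_stretch_def)

lemma has_stretch_emeasure:
  assumes "x \<in> Delta n k" "i \<in> {1..n}" shows "emeasure A {f \<in> space A. i \<in> f x} = ennreal (x i)"
proof -
  interpret prob_space A by (rule has_stretch_prob_space)
  have "measure A {f \<in> space A. i \<in> f x} = x i" using A assms unfolding has_stretch_def by blast
  then show ?thesis by (simp add: emeasure_eq_measure)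
qed

lemma has_stretch_nn_integral_eq:
  assumes "x \<in> Delta n k" "y \<in> Delta n k"
  shows "(\<integral>\<^sup>+f. set_dist (f x) (f y) \<partial>A) = ennreal (\<integral>f. real (card (sym_diff (f x) (f y))) \<partial>A)"
proof (rule nn_integral_eq_integral)
  interpret prob_space A by (rule has_stretch_prob_space)
  show "integrable A (\<lambda>f. real (card (sym_diff (f x) (f y))))"
  proof (rule integrable_const_bound)
    show "(\<lambda>f. real (card (sym_diff (f x) (f y)))) \<in> borel_measurable A"
      by (rule borel_measurable_card_sym_diff[where A="{1..n}"])
        (use assms has_stretch_subset has_stretch_pred in auto)
    show "AE f in A. norm (real (card (sym_diff (f x) (f y)))) \<le> real n"
    proof (rule AE_I2)
      fix f assume "f \<in> space A"
      then have "sym_diff (f x) (f y) \<subseteq> {1..n}" using assms has_stretch_subset by blast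
      from card_mono[OF _ this] show "norm (real (card (sym_diff (f x) (f y)))) \<le> real n" by simp
    qed
  qed
qed simp

lemma has_stretch_nn_integral:
  assumes "x \<in> Delta n k" "y \<in> Delta n k"
  shows "(\<integral>\<^sup>+f. set_dist (f x) (f y) \<partial>A) \<le> ennreal (\<alpha> * l1norm n (\<lambda>i. x i - y i))"
  unfolding has_stretch_nn_integral_eq[OF assms]
  using A assms by (intro ennreal_leI) (auto simp: has_stretch_def)

lemma has_stretch_mono:
  assumes "\<alpha> \<le> \<alpha>'" shows "has_stretch n k A \<alpha>'"
proof -
  have "\<alpha> * l1norm n x \<le> \<alpha>' * l1norm n x" for x
    using assms by (intro mult_right_mono) (auto simp: l1norm_def intro!: sum_nonneg)
  then show ?thesis using A unfolding has_stretch_def by (meson order_trans)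
qed

text \<open>The zero vector and the first unit vector force element 1 out of one output and into the
  other, almost surely. This makes the set of stretches bounded below, and later gives log \<alpha>
  \<ge> 0.\<close>

lemma has_stretch_ge_1:
  assumes "n \<ge> 1" "k \<ge> 1" shows "1 \<le> \<alpha>"
proof -
  interpret prob_space A by (rule has_stretch_prob_space)
  define x :: "nat \<Rightarrow> real" where "x = (\<lambda>i\<in>{1..n}. 0)"
  define y :: "nat \<Rightarrow> real" where "y = (\<lambda>i\<in>{1..n}. if i = 1 then 1 else 0)"
  have l: "l1norm n y = 1" unfolding l1norm_def y_def using assms
    by (subst sum.cong[OF HOL.refl, of _ _ "\<lambda>i. if i = 1 then 1 else 0"]) auto
  have xy: "x \<in> Delta n k" "y \<in> Delta n k" using l assms
    by (auto simp: Delta_def l1norm_def x_def y_def)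
  have d: "l1norm n (\<lambda>i. x i - y i) = 1"
    unfolding l[symmetric] l1norm_def by (intro sum.cong) (auto simp: x_def y_def)
  have 1: "1 \<in> {1..n}" using assms by simp
  have ex: "AE f in A. 1 \<notin> f x"
    using has_stretch_emeasure[OF xy(1) 1] has_stretch_pred[OF xy(1), of "\<lambda>S. 1 \<in> S"] assms
    by (subst AE_iff_measurable[OF _ HOL.refl]) (auto simp: x_def)
  have ey: "emeasure A {f \<in> space A. 1 \<in> f y} = 1"
    using has_stretch_emeasure[OF xy(2) 1] assms by (simp add: y_def)
  have "1 = (\<integral>\<^sup>+f. indicator {f \<in> space A. 1 \<in> f y} f \<partial>A)"
    using has_stretch_pred[OF xy(2), of "\<lambda>S. 1 \<in> S"] ey by (simp add: nn_integral_indicator)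
  also have "\<dots> \<le> (\<integral>\<^sup>+f. set_dist (f x) (f y) \<partial>A)"
  proof (rule nn_integral_mono_AE, rule AE_mp[OF ex], rule AE_I2, rule impI)
    fix f :: "(nat \<Rightarrow> real) \<Rightarrow> nat set" assume f: "1 \<notin> f x"
    show "indicator {f \<in> space A. 1 \<in> f y} f \<le> set_dist (f x) (f y)"
    proof (cases "f \<in> space A \<and> 1 \<in> f y")
      case True
      have "finite (sym_diff (f x) (f y))"
        using xy True has_stretch_subset by (meson finite_Diff finite_UnI finite_atLeastAtMost finite_subset)
      moreover have "1 \<in> sym_diff (f x) (f y)" using f True by simp
      ultimately have "1 \<le> card (sym_diff (f x) (f y))" by (metis One_nat_def Suc_leI card_gt_0_iff empty_iff)
      then show ?thesis by (simp add: indicator_def)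
    qed auto
  qed
  also have "\<dots> \<le> ennreal (\<alpha> * 1)" using has_stretch_nn_integral[OF xy] d by simp
  finally show ?thesis by (metis ennreal_1 ennreal_le_iff2 mult.right_neutral not_one_le_zero)
qed

end

text \<open>The size and marginal conditions do not mention \<alpha>, and the third condition is a
  closed lower bound on \<alpha> for each pair of points, so the infimum meets it too. Pairs at
  distance 0 are treated apart, to avoid a division by 0.\<close>

lemma has_stretch_stretch:
  assumes A: "has_stretch n k A \<alpha>" and nk: "n \<ge> 1" "k \<ge> 1"
  shows "has_stretch n k A (stretch n k A)" and "stretch n k A \<le> \<alpha>"
proof -
  let ?S = "{\<alpha>. has_stretch n k A \<alpha>}"
  have bdd: "bdd_below ?S" using has_stretch_ge_1[OF _ nk] by (intro bdd_belowI[of _ 1]) auto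
  show "stretch n k A \<le> \<alpha>" unfolding stretch_def using A bdd by (intro cInf_lower) auto
  have "(\<integral>f. real (card (sym_diff (f x) (f y))) \<partial>A) \<le> stretch n k A * l1norm n (\<lambda>i. x i - y i)"
    if xy: "x \<in> Delta n k" "y \<in> Delta n k" for x y
  proof (cases "l1norm n (\<lambda>i. x i - y i) = 0")
    case True
    then show ?thesis using A xy by (fastforce simp: has_stretch_def)
  next
    case False
    then have pos: "0 < l1norm n (\<lambda>i. x i - y i)"
      by (simp add: l1norm_def order_less_le sum_nonneg)
    have "(\<integral>f. real (card (sym_diff (f x) (f y))) \<partial>A) / l1norm n (\<lambda>i. x i - y i) \<le> Inf ?S"
    proof (rule cInf_greatest)
      fix \<beta> assume "\<beta> \<in> ?S"
      then have "(\<integral>f. real (card (sym_diff (f x) (f y))) \<partial>A) \<le> \<beta> * l1norm n (\<lambda>i. x i - y i)"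
        using xy by (simp add: has_stretch_def)
      then show "(\<integral>f. real (card (sym_diff (f x) (f y))) \<partial>A) / l1norm n (\<lambda>i. x i - y i) \<le> \<beta>"
        using pos by (simp add: divide_le_eq)
    qed (use A in auto)
    then show ?thesis using pos by (simp add: stretch_def divide_le_eq)
  qed
  then show "has_stretch n k A (stretch n k A)" using A unfolding has_stretch_def by blast
qed

section \<open>Stretch of tree pivotal sampling\<close>

lemma prob_space_tree_randomness: "prob_space (tree_coins t)"
  by (intro prob_space_PiM prob_space_unif01)

lemma prob_space_tree_space: "prob_space (tree_space t)"
  unfolding tree_space_def by (intro prob_space_pair prob_space_unif01 prob_space_tree_randomness)

lemma tree_output_subset: "tree_output t \<theta>r \<theta> z \<subseteq> set (leaves t)"
  unfolding tree_output_eq_out_bits by (rule out_bits_subset)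

lemma pred_tree_output:
  assumes "\<And>j. j \<in> set (leaves t) \<Longrightarrow> (\<lambda>w. z w j) \<in> borel_measurable M"
    and \<theta>: "\<theta> \<in> M \<rightarrow>\<^sub>M tree_space t"
  shows "Measurable.pred M (\<lambda>w. i \<in> tree_output t (fst (\<theta> w)) (snd (\<theta> w)) (z w))"
proof -
  have eq: "M \<rightarrow>\<^sub>M unif01 = borel_measurable M" by (rule measurable_cong_sets) simp_all
  have "(\<lambda>w. fst (\<theta> w)) \<in> M \<rightarrow>\<^sub>M unif01"
    using \<theta> unfolding tree_space_def by (rule measurable_compose[OF _ measurable_fst])
  then have [measurable]: "(\<lambda>w. fst (\<theta> w)) \<in> borel_measurable M" unfolding eq .
  have s: "(\<lambda>w. snd (\<theta> w)) \<in> M \<rightarrow>\<^sub>M (tree_coins t)"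
    using \<theta> unfolding tree_space_def by (rule measurable_compose[OF _ measurable_snd])
  have [measurable]: "(\<lambda>w. tree_value (z w) t) \<in> borel_measurable M"
    by (rule measurable_tree_value[OF assms(1)])
  show ?thesis unfolding tree_output_eq_out_bits
  proof (rule pred_out_bits[OF assms(1)])
    fix p assume "p \<in> internal_nodes t"
    from measurable_compose[OF s measurable_component_singleton[OF this]]
    show "(\<lambda>w. snd (\<theta> w) p) \<in> borel_measurable M" unfolding eq .
  qed (measurable)
qed

lemma AE_unif01_neq: "AE x in unif01. x \<noteq> c"
proof (rule AE_I)
  show "emeasure unif01 {c} = 0"
    by (subst emeasure_uniform_measure) (auto simp: divide_ennreal_def Int_insert_right)
qed auto

lemma AE_unif01_bounds: "AE x in unif01. 0 < x \<and> x < 1"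
proof -
  have "AE x in unif01. x \<in> {0..1}"
    by (rule AE_uniform_measureI) auto
  with AE_unif01_neq[of 0] AE_unif01_neq[of 1] show ?thesis by eventually_elim auto
qed

text \<open>The root compares strictly, unlike the inner nodes; the two versions differ on a null
  set.\<close>

lemma nn_integral_two_thresholds_strict:
  assumes "p \<in> {0..1}" "p' \<in> {0..1}" "\<And>e e'. 0 \<le> H e e'"
  shows "(\<integral>\<^sup>+x. ennreal (H (x < p) (x < p')) \<partial>unif01) =
    ennreal (\<Sum>e\<in>UNIV. \<Sum>e'\<in>UNIV. joint_weight p p' e e' * H e e')"
proof -
  have "(\<integral>\<^sup>+x. ennreal (H (x < p) (x < p')) \<partial>unif01) = (\<integral>\<^sup>+x. ennreal (H (x \<le> p) (x \<le> p')) \<partial>unif01)"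
  proof (rule nn_integral_cong_AE)
    show "AE x in unif01. ennreal (H (x < p) (x < p')) = ennreal (H (x \<le> p) (x \<le> p'))"
      using AE_unif01_neq[of p] AE_unif01_neq[of p'] by eventually_elim (simp add: order_less_le)
  qed
  with nn_integral_two_thresholds[OF assms] show ?thesis by simp
qed

text \<open>The coin \<theta>root supplies the pair of root bits, with law
  \<open>joint_weight\<close>; the inner nodes then contribute \<open>bit_cost\<close>.\<close>

lemma nn_integral_tree_output:
  assumes d: "distinct (leaves t)"
    and z: "\<And>j. j \<in> set (leaves t) \<Longrightarrow> z j \<in> {0..1}" "\<And>j. j \<in> set (leaves t) \<Longrightarrow> z' j \<in> {0..1}"
    and \<phi>: "\<And>i b b'. 0 \<le> \<phi> i b b'"
  shows "(\<integral>\<^sup>+w. (\<Sum>i\<in>set (leaves t). ennreal (\<phi> i (i \<in> tree_output t (fst w) (snd w) z) (i \<in> tree_output t (fst w) (snd w) z')))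
      \<partial>tree_space t) =
    ennreal (\<Sum>B\<in>UNIV. \<Sum>B'\<in>UNIV. joint_weight (tree_value z t) (tree_value z' t) B B' * bit_cost \<phi> t z z' B B')"
    (is "(\<integral>\<^sup>+w. ?f w \<partial>_) = _")
proof -
  interpret P: prob_space "tree_coins t" by (rule prob_space_tree_randomness)
  have [measurable]: "Measurable.pred (tree_space t) (\<lambda>w. i \<in> tree_output t (fst w) (snd w) y)" for i y
    by (rule pred_tree_output) auto
  have "(\<lambda>w. ennreal (\<phi> i (P w) (Q w))) \<in> borel_measurable (tree_space t)"
    if [measurable]: "Measurable.pred (tree_space t) P" "Measurable.pred (tree_space t) Q" for i P Q
  proof -
    have "(\<lambda>w. ennreal (\<phi> i (P w) (Q w))) = (\<lambda>w. if P w then if Q w then ennreal (\<phi> i True True) else ennreal (\<phi> i True False)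
        else if Q w then ennreal (\<phi> i False True) else ennreal (\<phi> i False False))" by auto
    then show ?thesis by simp
  qed
  then have f: "?f \<in> borel_measurable (tree_space t)" by (intro borel_measurable_sum) simp
  have "(\<integral>\<^sup>+w. ?f w \<partial>tree_space t) = (\<integral>\<^sup>+x. \<integral>\<^sup>+\<theta>. ?f (x, \<theta>) \<partial>(tree_coins t) \<partial>unif01)"
    using f unfolding tree_space_def by (rule P.nn_integral_fst[symmetric])
  also have "\<dots> = (\<integral>\<^sup>+x. ennreal (bit_cost \<phi> t z z' (x < tree_value z t) (x < tree_value z' t)) \<partial>unif01)"
    unfolding fst_conv snd_conv tree_output_eq_out_bits
    by (intro nn_integral_cong nn_integral_out_bits d z \<phi>)
  also have "\<dots> = ennreal (\<Sum>B\<in>UNIV. \<Sum>B'\<in>UNIV. joint_weight (tree_value z t) (tree_value z' t) B B' * bit_cost \<phi> t z z' B B')"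
    by (intro nn_integral_two_thresholds_strict tree_value_bounds bit_cost_nonneg z \<phi>)
  finally show ?thesis .
qed

lemma coupling_joint_weight:
  assumes "c \<in> {0..1}" "c' \<in> {0..1}" shows "coupling c c' (joint_weight c c')"
  using joint_weight_nonneg[OF assms] by (auto simp: coupling_def joint_weight_def)

context
  fixes d k :: nat and t :: btree
  assumes t: "pivotal_tree d t"
begin

lemma pivotal_tree_leaves: "set (leaves t) = {1..d}" "distinct (leaves t)"
  using t by (auto simp: pivotal_tree_def)

lemma tree_output_marginal:
  assumes z: "z \<in> Delta d k" and i: "i \<in> {1..d}"
  shows "emeasure (tree_space t) {w \<in> space (tree_space t). i \<in> tree_output t (fst w) (snd w) z} = ennreal (z i)"
proof -
  have b: "z j \<in> {0..1}" if "j \<in> set (leaves t)" for j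
    using Delta_bounds[OF z] that pivotal_tree_leaves by auto
  have m: "{w \<in> space (tree_space t). i \<in> tree_output t (fst w) (snd w) z} \<in> sets (tree_space t)"
    by (rule predE, rule pred_tree_output) auto
  let ?\<phi> = "\<lambda>j b b'. of_bool (b \<and> j = i) :: real"
  have "emeasure (tree_space t) {w \<in> space (tree_space t). i \<in> tree_output t (fst w) (snd w) z} =
     (\<integral>\<^sup>+w. indicator {w \<in> space (tree_space t). i \<in> tree_output t (fst w) (snd w) z} w \<partial>tree_space t)"
    using m by simp
  also have "\<dots> = (\<integral>\<^sup>+w. (\<Sum>j\<in>set (leaves t). ennreal (?\<phi> j (j \<in> tree_output t (fst w) (snd w) z) (j \<in> tree_output t (fst w) (snd w) z)))
      \<partial>tree_space t)"
  proof (rule nn_integral_cong)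
    fix w assume w: "w \<in> space (tree_space t)"
    have "(\<Sum>j\<in>set (leaves t). ennreal (?\<phi> j (j \<in> tree_output t (fst w) (snd w) z) (j \<in> tree_output t (fst w) (snd w) z))) =
      (\<Sum>j\<in>set (leaves t). if j = i then of_bool (i \<in> tree_output t (fst w) (snd w) z) else 0)"
      by (intro sum.cong) auto
    also have "\<dots> = of_bool (i \<in> tree_output t (fst w) (snd w) z)"
      using i pivotal_tree_leaves by simp
    finally show "indicator {w \<in> space (tree_space t). i \<in> tree_output t (fst w) (snd w) z} w =
      (\<Sum>j\<in>set (leaves t). ennreal (?\<phi> j (j \<in> tree_output t (fst w) (snd w) z) (j \<in> tree_output t (fst w) (snd w) z)))"
      using w by (simp add: indicator_def)
  qed
  also have "\<dots> = ennreal (\<Sum>B\<in>UNIV. \<Sum>B'\<in>UNIV. joint_weight (tree_value z t) (tree_value z t) B B' * bit_cost ?\<phi> t z z B B')"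
    by (rule nn_integral_tree_output) (use pivotal_tree_leaves b in auto)
  also have "(\<Sum>B\<in>UNIV. \<Sum>B'\<in>UNIV. joint_weight (tree_value z t) (tree_value z t) B B' * bit_cost ?\<phi> t z z B B') = z i"
  proof -
    have "coupling (tree_value z t) (tree_value z t) (joint_weight (tree_value z t) (tree_value z t))"
      by (intro coupling_joint_weight tree_value_bounds b)
    from bit_cost_member[OF pivotal_tree_leaves(2) b b this, where u=i] show ?thesis
      using i pivotal_tree_leaves(1) by simp
  qed
  finally show ?thesis .
qed

text \<open>Boundary coins such as \<theta> = 0 can pass a zero coordinate up, but the marginal
  shows that it is picked only on a null set. The composed algorithm relies on this: an empty
  position of the tree need not decode to an element.\<close>

lemma tree_output_AE_pos:
  assumes z: "z \<in> Delta d k"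
  shows "AE w in tree_space t. \<forall>i\<in>tree_output t (fst w) (snd w) z. z i > 0"
proof -
  have "AE w in tree_space t. i \<in> tree_output t (fst w) (snd w) z \<longrightarrow> z i > 0" if i: "i \<in> {1..d}" for i
  proof (cases "z i > 0")
    case False
    then have 0: "z i = 0" using Delta_bounds[OF z i] by simp
    have m: "{w \<in> space (tree_space t). i \<in> tree_output t (fst w) (snd w) z} \<in> sets (tree_space t)"
      by (rule predE, rule pred_tree_output) auto
    have "AE w in tree_space t. i \<notin> tree_output t (fst w) (snd w) z"
      using m tree_output_marginal[OF z i] 0 by (intro AE_I[OF _ _ m]) auto
    then show ?thesis by eventually_elim simp
  qed simp
  then have "AE w in tree_space t. \<forall>i\<in>{1..d}. i \<in> tree_output t (fst w) (snd w) z \<longrightarrow> z i > 0"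
    by (intro AE_finite_allI) auto
  then show ?thesis
    by eventually_elim (use tree_output_subset[of t] pivotal_tree_leaves(1) in blast)
qed

text \<open>The size differs from the sum by the rounding error at the root, which is less than 1 in
  modulus if 0 < \<theta>root < 1. The uniform measure has the whole real line as its space, so
  other values must be excluded almost surely.\<close>

lemma tree_output_AE_card:
  assumes z: "z \<in> Delta d k"
  shows "AE w in tree_space t. int (card (tree_output t (fst w) (snd w) z)) \<in> {\<lfloor>l1norm d z\<rfloor>, \<lceil>l1norm d z\<rceil>}"
proof -
  interpret P: prob_space "tree_coins t" by (rule prob_space_tree_randomness)
  interpret Q: pair_sigma_finite unif01 "tree_coins t" ..
  have b: "tree_value z t \<in> {0..1}"
    using Delta_bounds[OF z] pivotal_tree_leaves by (auto intro!: tree_value_bounds simp del: atLeastAtMost_iff) auto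
  have "AE w in tree_space t. 0 < fst w \<and> fst w < 1"
    unfolding tree_space_def
  proof (rule Q.AE_pair_measure)
    show "{w \<in> space (unif01 \<Otimes>\<^sub>M (tree_coins t)). 0 < fst w \<and> fst w < 1} \<in>
        sets (unif01 \<Otimes>\<^sub>M (tree_coins t))"
      by measurable
    show "AE x in unif01. AE y in (tree_coins t). 0 < fst (x, y) \<and> fst (x, y) < 1"
      using AE_unif01_bounds by eventually_elim simp
  qed
  then show ?thesis
  proof eventually_elim
    fix w :: "real \<times> (bool list \<Rightarrow> real)" assume w: "0 < fst w \<and> fst w < 1"
    have "real (card (tree_output t (fst w) (snd w) z)) =
        l1norm d z - tree_value z t + of_bool (fst w < tree_value z t)"
      unfolding tree_output_eq_out_bits card_out_bits[OF pivotal_tree_leaves(2)] pivotal_tree_leaves(1) l1norm_Delta[OF z] by simp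
    then show "int (card (tree_output t (fst w) (snd w) z)) \<in> {\<lfloor>l1norm d z\<rfloor>, \<lceil>l1norm d z\<rceil>}"
      using w b by (intro floor_or_ceiling) auto
  qed
qed

definition tree_stretch :: real where "tree_stretch = 1 + 4 * real (depth t)"

lemma tree_output_lipschitz:
  assumes "x \<in> Delta d k" "y \<in> Delta d k"
  shows "(\<integral>\<^sup>+w. set_dist (tree_output t (fst w) (snd w) x) (tree_output t (fst w) (snd w) y) \<partial>tree_space t)
    \<le> ennreal (tree_stretch * l1norm d (\<lambda>i. x i - y i))"
proof (rule lipschitz_from_steps[where D="\<lambda>x y. \<integral>\<^sup>+w. set_dist (tree_output t (fst w) (snd w) x) (tree_output t (fst w) (snd w) y) \<partial>tree_space t"])
  let ?T = "\<lambda>w x. tree_output t (fst w) (snd w) x"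
  have sub: "?T w x \<subseteq> {1..d}" for w x unfolding pivotal_tree_leaves(1)[symmetric] by (rule tree_output_subset)
  have fin: "finite (?T w x)" for w x by (rule finite_subset[OF sub]) simp
  have pred: "Measurable.pred (tree_space t) (\<lambda>w. i \<in> ?T w x)" for i x
    by (rule pred_tree_output) auto
  have m: "(\<lambda>w. real (card (sym_diff (?T w x) (?T w y)))) \<in> borel_measurable (tree_space t)" for x y
    by (rule borel_measurable_card_sym_diff[where A="{1..d}"]) (use sub pred in auto)
  fix x y z :: "nat \<Rightarrow> real"
  show "(\<integral>\<^sup>+w. set_dist (?T w x) (?T w x) \<partial>tree_space t) = 0" by simp
  show "(\<integral>\<^sup>+w. set_dist (?T w x) (?T w y) \<partial>tree_space t)
      = (\<integral>\<^sup>+w. set_dist (?T w y) (?T w x) \<partial>tree_space t)" by (simp add: Un_commute)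
  have "(\<integral>\<^sup>+w. set_dist (?T w x) (?T w z) \<partial>tree_space t)
      \<le> (\<integral>\<^sup>+w. set_dist (?T w x) (?T w y) + set_dist (?T w y) (?T w z) \<partial>tree_space t)"
  proof (rule nn_integral_mono)
    fix w
    have "card (sym_diff (?T w x) (?T w z)) \<le> card (sym_diff (?T w x) (?T w y)) + card (sym_diff (?T w y) (?T w z))"
      by (intro sym_diff_triangle fin)
    then show "set_dist (?T w x) (?T w z) \<le>
      set_dist (?T w x) (?T w y) + set_dist (?T w y) (?T w z)"
      by (subst ennreal_plus[symmetric]) (auto intro!: ennreal_leI simp flip: of_nat_add)
  qed
  also have "\<dots> = (\<integral>\<^sup>+w. set_dist (?T w x) (?T w y) \<partial>tree_space t) + (\<integral>\<^sup>+w. set_dist (?T w y) (?T w z) \<partial>tree_space t)"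
    using m by (intro nn_integral_add) auto
  finally show "(\<integral>\<^sup>+w. set_dist (?T w x) (?T w z) \<partial>tree_space t) \<le> \<dots>" .
next
  let ?T = "\<lambda>w x. tree_output t (fst w) (snd w) x"
  have sub: "?T w x \<subseteq> {1..d}" for w x unfolding pivotal_tree_leaves(1)[symmetric] by (rule tree_output_subset)
  fix x :: "nat \<Rightarrow> real" and u v assume x: "x \<in> Delta d k" and u: "u \<in> {1..d}" and v: "x u \<le> v" and y: "x(u := v) \<in> Delta d k"
  define y where "y = x(u := v)"
  have b: "x j \<in> {0..1}" "y j \<in> {0..1}" if "j \<in> set (leaves t)" for j
    using Delta_bounds[OF x] Delta_bounds[OF y] that pivotal_tree_leaves by (auto simp: y_def)
  define \<epsilon> where "\<epsilon> = v - x u"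
  have y': "y = x(u := x u + \<epsilon>)" "0 \<le> \<epsilon>" "x u + \<epsilon> \<le> 1" using v b(2)[of u] u pivotal_tree_leaves by (auto simp: y_def \<epsilon>_def)
  have u': "u \<in> set (leaves t)" using u pivotal_tree_leaves by simp
  have tv: "tree_value x t \<in> {0..1}" "tree_value y t \<in> {0..1}" by (intro tree_value_bounds b; simp)+
  have "tree_value y t = tree_value x t + \<epsilon> \<or> tree_value y t = tree_value x t + \<epsilon> - 1"
    by (rule tree_value_step[OF u' pivotal_tree_leaves(2) b(1) y'])
  \<comment> \<open>A shared \<theta>root couples the root bits monotonically: of the two events
    \<theta>root < c and \<theta>root < c', the one with the larger value contains the
    other.\<close>
  then have sc: "step_coupling \<epsilon> (tree_value x t) (tree_value y t) (joint_weight (tree_value x t) (tree_value y t))"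
    using coupling_joint_weight[OF tv] y'(2) by (auto simp: step_coupling_def joint_weight_def)
  have "(\<integral>\<^sup>+w. set_dist (?T w x) (?T w y) \<partial>tree_space t) =
     (\<integral>\<^sup>+w. (\<Sum>i\<in>set (leaves t). ennreal (bit_diff i (i \<in> ?T w x) (i \<in> ?T w y))) \<partial>tree_space t)"
    unfolding bit_diff_def ennreal_card_sym_diff[OF sub sub finite_atLeastAtMost] pivotal_tree_leaves ..
  also have "\<dots> = ennreal (\<Sum>B\<in>UNIV. \<Sum>B'\<in>UNIV. joint_weight (tree_value x t) (tree_value y t) B B' * bit_cost bit_diff t x y B B')"
    by (intro nn_integral_tree_output pivotal_tree_leaves b) (auto simp: bit_diff_def)
  also have "\<dots> \<le> ennreal ((1 + 4 * real (depth t)) * \<epsilon>)"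
    by (intro ennreal_leI bit_diff_step[OF u' pivotal_tree_leaves(2) b(1) y' sc])
  finally show "(\<integral>\<^sup>+w. set_dist (?T w x) (?T w (x(u := v))) \<partial>tree_space t) \<le> ennreal (tree_stretch * (v - x u))"
    by (simp add: y_def \<epsilon>_def tree_stretch_def)
qed (use assms in \<open>auto simp: tree_stretch_def\<close>)

lemma has_stretch_tree_pivotal: "has_stretch d k (tree_pivotal t d k) tree_stretch"
proof -
  have "has_stretch d k (distr (tree_space t) (map_space d k) (\<lambda>w. \<lambda>z\<in>Delta d k. tree_output t (fst w) (snd w) z)) tree_stretch"
  proof (rule has_stretch_distrI[OF prob_space_tree_space])
    show "Measurable.pred (tree_space t) (\<lambda>w. i \<in> tree_output t (fst w) (snd w) x)" for i x
      by (rule pred_tree_output) auto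
    show "tree_output t (fst w) (snd w) x \<subseteq> {1..d}" for w x
      unfolding pivotal_tree_leaves(1)[symmetric] by (rule tree_output_subset)
  qed (auto simp: tree_stretch_def tree_output_AE_card tree_output_marginal tree_output_lipschitz[unfolded tree_stretch_def]
         simp del: insert_iff)
  then show ?thesis by (simp add: tree_pivotal_def case_prod_beta')
qed

lemma tree_stretch_le: "tree_stretch \<le> 5 + 4 * log 2 (real d)"
proof -
  have "real_of_int (int (depth t)) = real_of_int \<lceil>log 2 (real d)\<rceil>" using t by (simp add: pivotal_tree_def)
  also have "\<dots> \<le> log 2 (real d) + 1" by linarith
  finally show ?thesis by (simp add: tree_stretch_def)
qed

end

section \<open>Exponential clocks\<close>

abbreviation exp1 :: "real measure" where "exp1 \<equiv> density lborel (exponential_density 1)"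

lemma prob_space_exp1: "prob_space exp1"
  by (rule prob_space_exponential_density) simp

interpretation exp1: prob_space exp1 by (rule prob_space_exp1)

lemma prob_space_clock_space: "prob_space (clock_space n)"
  unfolding clock_space_def by (intro prob_space_PiM prob_space_exp1)

lemma emeasure_exp1_atLeast:
  assumes "0 \<le> c" shows "emeasure exp1 {c..} = ennreal (exp (- c))"
proof -
  have "emeasure exp1 {c..} = (\<integral>\<^sup>+x. ennreal (exponential_density 1 x) * indicator {c..} x \<partial>lborel)"
    by (rule emeasure_density) auto
  also have "\<dots> = (\<integral>\<^sup>+x. ennreal (exp (- x)) * indicator {c..} x \<partial>lborel)"
    using assms by (intro nn_integral_cong) (auto simp: exponential_density_def indicator_def)
  also have "\<dots> = ennreal (0 - (- exp (- c)))"
  proof (rule nn_integral_FTC_atLeast)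
    show "((\<lambda>x::real. - exp (- x)) \<longlongrightarrow> 0) at_top"
      using tendsto_minus[OF filterlim_compose[OF exp_at_bot filterlim_uminus_at_bot_at_top]] by simp
  qed (auto intro!: derivative_eq_intros)
  finally show ?thesis by simp
qed

lemma AE_exp1_nonneg: "AE x in exp1. 0 \<le> x"
  by (subst AE_density) (auto simp: exponential_density_def)

lemma mem_clock_output_iff:
  "i \<in> clock_output n E p \<longleftrightarrow> i \<in> {1..n} \<and> 0 < p i \<and> (\<forall>j\<in>{1..n}. 0 < p j \<longrightarrow> E i / p i \<le> E j / p j)"
  by (auto simp: clock_output_def is_arg_min_def not_less)

text \<open>Lets the weights stay unnormalised. Divided by the bucket sum, all of them would change
  when a single coordinate moves.\<close>

lemma clock_output_scale:
  assumes "0 < c" shows "clock_output n E (\<lambda>i. p i / c) = clock_output n E p"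
proof -
  have eq: "E j / (p j / c) = c * (E j / p j)" for j by simp
  show ?thesis
    unfolding set_eq_iff mem_clock_output_iff eq mult_le_cancel_left_pos[OF assms]
    using assms by (simp add: zero_less_divide_iff)
qed

lemma clock_output_subset: "clock_output n E p \<subseteq> {1..n}"
  by (auto simp: mem_clock_output_iff)

lemma pred_clock_output:
  assumes E: "\<And>j. j \<in> {1..n} \<Longrightarrow> (\<lambda>w. E w j) \<in> borel_measurable M"
    and p: "\<And>j. j \<in> {1..n} \<Longrightarrow> (\<lambda>w. p w j) \<in> borel_measurable M"
  shows "Measurable.pred M (\<lambda>w. i \<in> clock_output n (E w) (p w))"
proof (cases "i \<in> {1..n}")
  case True
  note [measurable] = E[OF True] p[OF True]
  have [measurable]: "Measurable.pred M (\<lambda>w. \<forall>j\<in>{1..n}. 0 < p w j \<longrightarrow> E w i / p w i \<le> E w j / p w j)"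
  proof (rule pred_intros_finite)
    fix j assume "j \<in> {1..n}"
    note [measurable] = E[OF this] p[OF this]
    show "Measurable.pred M (\<lambda>w. 0 < p w j \<longrightarrow> E w i / p w i \<le> E w j / p w j)" by measurable
  qed simp
  have "(\<lambda>w. i \<in> clock_output n (E w) (p w)) =
      (\<lambda>w. 0 < p w i \<and> (\<forall>j\<in>{1..n}. 0 < p w j \<longrightarrow> E w i / p w i \<le> E w j / p w j))"
    unfolding mem_clock_output_iff using True by blast
  then show ?thesis by (simp only:) measurable
next
  case False
  then have "(\<lambda>w. i \<in> clock_output n (E w) (p w)) = (\<lambda>w. False)"
    unfolding mem_clock_output_iff by blast
  then show ?thesis by simp
qed

lemma clock_space_component: "j \<in> {1..n} \<Longrightarrow> (\<lambda>E. E j) \<in> borel_measurable (clock_space n)"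
  using measurable_component_singleton[of j "{1..n}" "\<lambda>_. exp1"] unfolding clock_space_def by simp

lemma sets_clock_output: "{E \<in> space (clock_space n). i \<in> clock_output n E p} \<in> sets (clock_space n)"
  by (rule predE, rule pred_clock_output) (auto intro: clock_space_component)

text \<open>Given E i = x \<ge> 0, item i wins iff every other clock j is at least x p j / p i,
  which has probability exp (- x (S - p i) / p i) for S the total weight. Integrating this against
  exp (- x) gives p i / S.\<close>

lemma clock_output_marginal:
  assumes i: "i \<in> {1..n}" and p: "\<And>j. j \<in> {1..n} \<Longrightarrow> 0 \<le> p j" and pi: "0 < p i"
  shows "emeasure (clock_space n) {E \<in> space (clock_space n). i \<in> clock_output n E p} = ennreal (p i / (\<Sum>j=1..n. p j))"
proof -
  interpret product_sigma_finite "\<lambda>_::nat. exp1" by unfold_locales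
  let ?I = "{1..n} - {i}" and ?f = "\<lambda>E. indicator {E \<in> space (clock_space n). i \<in> clock_output n E p} E :: ennreal"
  have ins: "{1..n} = insert i ?I" using i by auto
  define S where "S = (\<Sum>j=1..n. p j)"
  have S: "S = p i + (\<Sum>j\<in>?I. p j)" unfolding S_def using i by (subst ins, subst sum.insert) auto
  have Spos: "0 < S" unfolding S using p pi by (intro add_pos_nonneg sum_nonneg) auto
  have m: "?f \<in> borel_measurable (\<Pi>\<^sub>M j\<in>insert i ?I. exp1)"
    using sets_clock_output[of n i p] ins unfolding clock_space_def by simp
  have "emeasure (clock_space n) {E \<in> space (clock_space n). i \<in> clock_output n E p} = (\<integral>\<^sup>+E. ?f E \<partial>(\<Pi>\<^sub>M j\<in>insert i ?I. exp1))"
    using sets_clock_output[of n i p] ins unfolding clock_space_def by simp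
  also have "\<dots> = (\<integral>\<^sup>+x. \<integral>\<^sup>+E. ?f (E(i := x)) \<partial>(\<Pi>\<^sub>M j\<in>?I. exp1) \<partial>exp1)"
    by (rule product_nn_integral_insert_rev[OF _ _ m]) auto
  also have "\<dots> = (\<integral>\<^sup>+x. \<integral>\<^sup>+E. (\<Prod>j\<in>?I. indicator {y. 0 < p j \<longrightarrow> x / p i * p j \<le> y} (E j)) \<partial>(\<Pi>\<^sub>M j\<in>?I. exp1) \<partial>exp1)"
  proof (intro nn_integral_cong)
    fix x E assume E: "E \<in> space (\<Pi>\<^sub>M j\<in>?I. exp1)"
    have sp: "E(i := x) \<in> space (clock_space n)"
      using E i by (auto simp: clock_space_def space_PiM PiE_def extensional_def)
    have iff: "i \<in> clock_output n (E(i := x)) p \<longleftrightarrow> (\<forall>j\<in>?I. 0 < p j \<longrightarrow> x / p i * p j \<le> E j)"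
      using i pi by (auto simp: mem_clock_output_iff pos_le_divide_eq)
    show "?f (E(i := x)) = (\<Prod>j\<in>?I. indicator {y. 0 < p j \<longrightarrow> x / p i * p j \<le> y} (E j))"
    proof (cases "\<forall>j\<in>?I. 0 < p j \<longrightarrow> x / p i * p j \<le> E j")
      case True
      then show ?thesis using sp iff by (subst prod.neutral) auto
    next
      case False
      then obtain j where "j \<in> ?I" "0 < p j \<and> \<not> x / p i * p j \<le> E j" by blast
      then have "(\<Prod>j\<in>?I. indicator {y. 0 < p j \<longrightarrow> x / p i * p j \<le> y} (E j) :: ennreal) = 0"
        by (intro prod_zero) (auto intro!: bexI[of _ j])
      then show ?thesis using False iff by simp
    qed
  qed
  also have "\<dots> = (\<integral>\<^sup>+x. (\<Prod>j\<in>?I. \<integral>\<^sup>+y. indicator {y. 0 < p j \<longrightarrow> x / p i * p j \<le> y} y \<partial>exp1) \<partial>exp1)"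
    by (intro nn_integral_cong product_nn_integral_prod) auto
  also have "\<dots> = (\<integral>\<^sup>+x. ennreal (exp (- (x / p i * (\<Sum>j\<in>?I. p j)))) \<partial>exp1)"
  proof (rule nn_integral_cong_AE, use AE_exp1_nonneg in eventually_elim)
    fix x :: real assume x: "0 \<le> x"
    have "(\<integral>\<^sup>+y. indicator {y. 0 < p j \<longrightarrow> x / p i * p j \<le> y} y \<partial>exp1) = ennreal (exp (- (x / p i * p j)))"
      if j: "j \<in> ?I" for j
    proof (cases "0 < p j")
      case True
      then have "{y. 0 < p j \<longrightarrow> x / p i * p j \<le> y} = {x / p i * p j..}" by auto
      then show ?thesis using emeasure_exp1_atLeast[of "x / p i * p j"] x pi True by simp
    next
      case False
      then have "p j = 0" using p[of j] j by simp
      then show ?thesis using exp1.emeasure_space_1 by simp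
    qed
    then have "(\<Prod>j\<in>?I. \<integral>\<^sup>+y. indicator {y. 0 < p j \<longrightarrow> x / p i * p j \<le> y} y \<partial>exp1) = (\<Prod>j\<in>?I. ennreal (exp (- (x / p i * p j))))"
      by (intro prod.cong) auto
    also have "\<dots> = ennreal (exp (\<Sum>j\<in>?I. - (x / p i * p j)))" by (simp add: prod_ennreal exp_sum)
    finally show "(\<Prod>j\<in>?I. \<integral>\<^sup>+y. indicator {y. 0 < p j \<longrightarrow> x / p i * p j \<le> y} y \<partial>exp1) = ennreal (exp (- (x / p i * (\<Sum>j\<in>?I. p j))))"
      by (simp add: sum_negf sum_distrib_left)
  qed
  also have "\<dots> = (\<integral>\<^sup>+x. ennreal (exponential_density 1 x) * ennreal (exp (- (x / p i * (\<Sum>j\<in>?I. p j)))) \<partial>lborel)"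
    by (rule nn_integral_density) auto
  \<comment> \<open>The exponents add up to rate S / p i, so the integrand is a rescaled exponential
    density.\<close>
  also have "\<dots> = (\<integral>\<^sup>+x. ennreal (p i / S) * ennreal (exponential_density (S / p i) x) \<partial>lborel)"
  proof (intro nn_integral_cong)
    fix x :: real
    have "exp (- x) * exp (- (x / p i * (\<Sum>j\<in>?I. p j))) = exp (- x * (S / p i))"
      unfolding exp_add[symmetric] using pi by (intro arg_cong[where f=exp]) (simp add: S field_simps)
    then show "ennreal (exponential_density 1 x) * ennreal (exp (- (x / p i * (\<Sum>j\<in>?I. p j)))) =
       ennreal (p i / S) * ennreal (exponential_density (S / p i) x)"
      using pi Spos by (auto simp: exponential_density_def ennreal_mult[symmetric])
  qed
  also have "\<dots> = ennreal (p i / S) * (\<integral>\<^sup>+x. ennreal (exponential_density (S / p i) x) \<partial>lborel)"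
    by (rule nn_integral_cmult) auto
  also have "(\<integral>\<^sup>+x. ennreal (exponential_density (S / p i) x) \<partial>lborel) = 1"
  proof -
    interpret prob_space "density lborel (exponential_density (S / p i))"
      using Spos pi by (intro prob_space_exponential_density) auto
    show ?thesis using emeasure_space_1 by (simp add: emeasure_density)
  qed
  finally show ?thesis by (simp add: S_def)
qed

lemma clock_output_nonempty:
  assumes "i \<in> {1..n}" "0 < p i" shows "clock_output n E p \<noteq> {}"
proof -
  let ?B = "{i \<in> {1..n}. 0 < p i}"
  have "finite ((\<lambda>i. E i / p i) ` ?B)" "(\<lambda>i. E i / p i) ` ?B \<noteq> {}" using assms by auto
  from Min_in[OF this] obtain j where "j \<in> ?B" "E j / p j = Min ((\<lambda>i. E i / p i) ` ?B)" by auto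
  then have "j \<in> clock_output n E p" by (auto simp: mem_clock_output_iff)
  then show ?thesis by auto
qed

text \<open>Ties are excluded without computing their probability: the set of minimisers has at
  least one element, while its expected size is the sum of the marginals p j / S, which is
  1.\<close>

lemma AE_clock_output_singleton:
  assumes p: "\<And>j. j \<in> {1..n} \<Longrightarrow> 0 \<le> p j" and i: "i \<in> {1..n}" "0 < p i"
  shows "AE E in clock_space n. card (clock_output n E p) = 1"
proof -
  interpret prob_space "clock_space n" by (rule prob_space_clock_space)
  define S where "S = (\<Sum>j=1..n. p j)"
  have S: "0 < S" unfolding S_def using p i by (intro sum_pos2[of _ i]) auto
  let ?c = "\<lambda>E. card (clock_output n E p)"
  have ind: "ennreal (real (?c E)) = (\<Sum>j=1..n. indicator {E \<in> space (clock_space n). j \<in> clock_output n E p} E)"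
    if "E \<in> space (clock_space n)" for E
  proof -
    have "ennreal (real (?c E)) = (\<Sum>j=1..n. ennreal (of_bool (j \<in> clock_output n E p)))"
      unfolding card_eq_sum_of_bool[OF clock_output_subset finite_atLeastAtMost] by (simp add: sum_ennreal)
    also have "\<dots> = (\<Sum>j=1..n. indicator {E \<in> space (clock_space n). j \<in> clock_output n E p} E)"
      using that by (intro sum.cong) (auto simp: indicator_def)
    finally show ?thesis .
  qed
  have mc: "(\<lambda>E. ennreal (real (?c E))) \<in> borel_measurable (clock_space n)"
    by (rule measurable_cong[THEN iffD2, OF ind]) (auto intro!: borel_measurable_sum borel_measurable_indicator sets_clock_output)
  have ge1: "1 \<le> ?c E" for E
    using clock_output_nonempty[of i n p E, OF i] finite_subset[OF clock_output_subset, of n E p]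
    by (simp add: Suc_le_eq card_gt_0_iff)
  have marg: "emeasure (clock_space n) {E \<in> space (clock_space n). j \<in> clock_output n E p} = ennreal (p j / S)" if "j \<in> {1..n}" for j
  proof (cases "0 < p j")
    case True then show ?thesis using clock_output_marginal[of _ n p, OF that p] by (simp add: S_def)
  next
    case False
    then show ?thesis using p[OF that] by (simp add: mem_clock_output_iff)
  qed
  have "(\<integral>\<^sup>+E. ennreal (real (?c E)) \<partial>clock_space n) =
     (\<integral>\<^sup>+E. (\<Sum>j=1..n. indicator {E \<in> space (clock_space n). j \<in> clock_output n E p} E) \<partial>clock_space n)"
    by (rule nn_integral_cong) (rule ind)
  also have "\<dots> = (\<Sum>j=1..n. ennreal (p j / S))"
    by (subst nn_integral_sum) (use sets_clock_output marg in auto)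
  also have "\<dots> = ennreal (\<Sum>j=1..n. p j / S)" using p S by (intro sum_ennreal) auto
  also have "(\<Sum>j=1..n. p j / S) = 1" unfolding sum_divide_distrib[symmetric] S_def[symmetric] using S by simp
  finally have int: "(\<integral>\<^sup>+E. ennreal (real (?c E)) \<partial>clock_space n) = 1" by simp
  have "(\<integral>\<^sup>+E. ennreal (real (?c E)) - 1 \<partial>clock_space n) = (\<integral>\<^sup>+E. ennreal (real (?c E)) \<partial>clock_space n) - (\<integral>\<^sup>+E. 1 \<partial>clock_space n)"
  proof (rule nn_integral_diff)
    show "AE E in clock_space n. 1 \<le> ennreal (real (?c E))"
      using ge1 by (intro AE_I2) simp
  qed (use mc emeasure_space_1 in auto)
  also have "\<dots> = 0" using int emeasure_space_1 by simp
  finally have "AE E in clock_space n. ennreal (real (?c E)) - 1 = 0"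
    using mc by (subst (asm) nn_integral_0_iff_AE) auto
  then show ?thesis
  proof eventually_elim
    fix E assume "ennreal (real (?c E)) - 1 = 0"
    then have "ennreal (real (?c E)) \<le> 1" by (simp add: diff_eq_0_iff_ennreal)
    then show "?c E = 1" using ge1[of E] by simp
  qed
qed

lemma sets_clock_output_neq:
  "{E \<in> space (clock_space n). clock_output n E p \<noteq> clock_output n E p'} \<in> sets (clock_space n)"
proof -
  have eq: "{E \<in> space (clock_space n). clock_output n E p \<noteq> clock_output n E p'} =
      {E \<in> space (clock_space n). \<exists>i\<in>{1..n}. (i \<in> clock_output n E p) \<noteq> (i \<in> clock_output n E p')}"
    using clock_output_subset by blast
  have "Measurable.pred (clock_space n) (\<lambda>E. \<exists>i\<in>{1..n}. (i \<in> clock_output n E p) \<noteq> (i \<in> clock_output n E p'))"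
  proof (rule pred_intros_finite)
    fix i
    have [measurable]: "Measurable.pred (clock_space n) (\<lambda>E. i \<in> clock_output n E q)" for q
      by (rule pred_clock_output) (auto intro: clock_space_component)
    show "Measurable.pred (clock_space n) (\<lambda>E. (i \<in> clock_output n E p) \<noteq> (i \<in> clock_output n E p'))" by measurable
  qed simp
  then show ?thesis unfolding eq by (rule predE)
qed

text \<open>Raising the weight of \<open>u\<close> speeds up only its clock, so the winner can change only to \<open>u\<close>.\<close>

lemma clock_output_stable:
  assumes p: "\<And>j. j \<in> {1..n} \<Longrightarrow> 0 \<le> p j" and S: "0 < (\<Sum>j=1..n. p j)"
    and u: "u \<in> {1..n}" and v: "p u \<le> v" and p': "p' = p(u := v)"
  shows "ennreal (\<Sum>j=1..n. p j) * emeasure (clock_space n) {E \<in> space (clock_space n). clock_output n E p \<noteq> clock_output n E p'}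
    \<le> ennreal (v - p u)"
proof (cases "v = p u")
  case True
  then show ?thesis using p' by (simp add: fun_upd_idem)
next
  case False
  then have vp: "0 < v" using v p[OF u] by simp
  interpret prob_space "clock_space n" by (rule prob_space_clock_space)
  let ?S = "\<Sum>j=1..n. p j" and ?o = "\<lambda>E. clock_output n E p" and ?o' = "\<lambda>E. clock_output n E p'"
  let ?D = "{E \<in> space (clock_space n). ?o E \<noteq> ?o' E}" and ?A = "{E \<in> space (clock_space n). u \<in> ?o E}" and ?A' = "{E \<in> space (clock_space n). u \<in> ?o' E}"
  have S': "(\<Sum>j=1..n. p' j) = ?S + (v - p u)"
    using u unfolding p' by (simp add: sum.remove[of _ u])
  have p'0: "0 \<le> p' j" if "j \<in> {1..n}" for j using p[OF that] v vp by (auto simp: p')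
  obtain i where i: "i \<in> {1..n}" "0 < p i"
    using S by (metis not_less sum_nonpos)
  have D: "?D \<in> sets (clock_space n)" by (rule sets_clock_output_neq)
  have A: "?A \<in> sets (clock_space n)" "?A' \<in> sets (clock_space n)" by (rule sets_clock_output)+
  have eA: "emeasure (clock_space n) ?A = ennreal (p u / ?S)"
  proof (cases "0 < p u")
    case True then show ?thesis using clock_output_marginal[of u n p, OF u p] by simp
  next
    case False then show ?thesis using p[OF u] by (simp add: mem_clock_output_iff)
  qed
  have eA': "emeasure (clock_space n) ?A' = ennreal (v / (?S + (v - p u)))"
  proof -
    have pu: "p' u = v" by (simp add: p')
    show ?thesis using clock_output_marginal[of u n p', OF u p'0] vp unfolding S' pu by simp
  qed
  have "AE E in exp1. 0 \<le> E" by (rule AE_exp1_nonneg)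
  then have nn: "AE E in clock_space n. 0 \<le> E u"
    unfolding clock_space_def by (rule AE_PiM_component[OF prob_space_exp1 u])
  have s1: "AE E in clock_space n. card (?o E) = 1" by (rule AE_clock_output_singleton[of n p i]) (use p i in auto)
  have s2: "AE E in clock_space n. card (?o' E) = 1"
    by (rule AE_clock_output_singleton[of n p' u]) (use p'0 u vp in \<open>auto simp: p'\<close>)
  \<comment> \<open>A changed winner means that u wins after the step but not before, and a winning
    u keeps winning. Hence P(D) \<le> v / S' - p u / S, with S' the new total, and this is at most
    (v - p u) / S.\<close>
  have "AE E in clock_space n. indicator ?D E + indicator ?A E \<le> (indicator ?A' E :: ennreal)"
    using s1 s2 nn
  proof eventually_elim
    case (elim E)
    have "0 < p' u" using vp by (simp add: p')
    then obtain a where a: "?o' E = {a}" using elim by (auto simp: card_1_singleton_iff)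
    obtain b where b: "?o E = {b}" using elim by (auto simp: card_1_singleton_iff)
    have eu: "E u / v \<le> E u / p u" if "0 < p u" using that v elim by (intro divide_left_mono) auto
    have 1: "?o E = ?o' E" if "u \<notin> ?o' E"
    proof -
      have au: "a \<noteq> u" "a \<in> ?o' E" using that a by auto
      have "a \<in> ?o E" unfolding mem_clock_output_iff
      proof (intro conjI ballI impI)
        show "a \<in> {1..n}" "0 < p a" using au by (auto simp: mem_clock_output_iff p')
        fix j assume j: "j \<in> {1..n}" "0 < p j"
        have "0 < p' j" using j v vp by (simp add: p')
        then have "E a / p' a \<le> E j / p' j" using au(2) j(1) unfolding mem_clock_output_iff by blast
        then show "E a / p a \<le> E j / p j" using eu au(1) j by (cases "j = u") (auto simp: p')
      qed
      then show ?thesis using a b by simp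
    qed
    have 2: "u \<in> ?o' E" if "u \<in> ?o E"
      unfolding mem_clock_output_iff
    proof (intro conjI ballI impI)
      show "u \<in> {1..n}" "0 < p' u" by (fact u) fact
      fix j assume j: "j \<in> {1..n}" "0 < p' j"
      have up: "0 < p u" using that by (simp add: mem_clock_output_iff)
      show "E u / p' u \<le> E j / p' j"
      proof (cases "j = u")
        case False
        then have "0 < p j" using j by (simp add: p')
        then have "E u / p u \<le> E j / p j" using that j(1) unfolding mem_clock_output_iff by blast
        then show ?thesis using eu[OF up] False by (simp add: p')
      qed simp
    qed
    have 3: "?o E = ?o' E" if "u \<in> ?o E"
    proof -
      have "u = a" "u = b" using that 2[OF that] unfolding a b by simp_all
      then show ?thesis using a b by simp
    qed
    show ?case
    proof (cases "E \<in> space (clock_space n) \<and> ?o E \<noteq> ?o' E")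
      case True
      then have "u \<notin> ?o E" "u \<in> ?o' E" using 1 3 by blast+
      then show ?thesis using True by (simp add: indicator_def)
    next
      case False
      then have "indicator ?D E = (0 :: ennreal)" by simp
      moreover have "indicator ?A E \<le> (indicator ?A' E :: ennreal)" using 2 by (simp add: indicator_def)
      ultimately show ?thesis by simp
    qed
  qed
  then have "(\<integral>\<^sup>+E. indicator ?D E + indicator ?A E \<partial>clock_space n) \<le> (\<integral>\<^sup>+E. indicator ?A' E \<partial>clock_space n)"
    by (rule nn_integral_mono_AE)
  then have le: "emeasure (clock_space n) ?D + ennreal (p u / ?S) \<le> ennreal (v / (?S + (v - p u)))"
    using D A eA eA' by (simp add: nn_integral_add)
  define \<delta> where "\<delta> = measure (clock_space n) ?D"
  have eD: "emeasure (clock_space n) ?D = ennreal \<delta>" by (simp add: \<delta>_def emeasure_eq_measure)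
  have \<delta>: "0 \<le> \<delta>" by (simp add: \<delta>_def)
  have "ennreal (\<delta> + p u / ?S) \<le> ennreal (v / (?S + (v - p u)))"
    using le eD \<delta> p[OF u] S by simp
  then have "\<delta> + p u / ?S \<le> v / (?S + (v - p u))"
    using v S vp by (subst (asm) ennreal_le_iff) auto
  also have "\<dots> \<le> v / ?S" using v S vp by (intro divide_left_mono) auto
  finally have "?S * (\<delta> + p u / ?S) \<le> ?S * (v / ?S)" using S by (intro mult_left_mono) auto
  then have "?S * \<delta> \<le> v - p u" using S by (simp add: distrib_left)
  then show ?thesis unfolding eD using S \<delta> by (simp add: ennreal_mult[symmetric] ennreal_leI)
qed

section \<open>The composed algorithm for fixed coins\<close>

text \<open>Moves the last factor outermost, so that one can condition on the coins R, C, \<beta>,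
  \<sigma>, \<tau>, which stand last in the product.\<close>

lemma nn_integral_rotate4:
  assumes "prob_space M1" "prob_space M2" "prob_space M3" "prob_space M4"
    and F [measurable]: "F \<in> borel_measurable (M1 \<Otimes>\<^sub>M M2 \<Otimes>\<^sub>M M3 \<Otimes>\<^sub>M M4)"
  shows "(\<integral>\<^sup>+w. F w \<partial>(M1 \<Otimes>\<^sub>M M2 \<Otimes>\<^sub>M M3 \<Otimes>\<^sub>M M4)) =
      (\<integral>\<^sup>+w. \<integral>\<^sup>+f. \<integral>\<^sup>+E. \<integral>\<^sup>+\<theta>. F (f, E, \<theta>, w) \<partial>M3 \<partial>M2 \<partial>M1 \<partial>M4)"
    and "(\<lambda>w. \<integral>\<^sup>+f. \<integral>\<^sup>+E. \<integral>\<^sup>+\<theta>. F (f, E, \<theta>, w) \<partial>M3 \<partial>M2 \<partial>M1) \<in> borel_measurable M4"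
proof -
  interpret M1: prob_space M1 by fact
  interpret M2: prob_space M2 by fact
  interpret M3: prob_space M3 by fact
  interpret M4: prob_space M4 by fact
  interpret M34: pair_prob_space M3 M4 ..
  interpret M234: pair_prob_space M2 "M3 \<Otimes>\<^sub>M M4" ..
  interpret M1234: pair_prob_space M1 "M2 \<Otimes>\<^sub>M M3 \<Otimes>\<^sub>M M4" ..
  interpret M24: pair_prob_space M2 M4 ..
  interpret M14: pair_prob_space M1 M4 ..
  show "(\<lambda>w. \<integral>\<^sup>+f. \<integral>\<^sup>+E. \<integral>\<^sup>+\<theta>. F (f, E, \<theta>, w) \<partial>M3 \<partial>M2 \<partial>M1) \<in> borel_measurable M4"
    by measurable
  have "(\<integral>\<^sup>+w. F w \<partial>(M1 \<Otimes>\<^sub>M M2 \<Otimes>\<^sub>M M3 \<Otimes>\<^sub>M M4)) = (\<integral>\<^sup>+f. \<integral>\<^sup>+v. F (f, v) \<partial>(M2 \<Otimes>\<^sub>M M3 \<Otimes>\<^sub>M M4) \<partial>M1)"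
    by (rule M234.P.nn_integral_fst[symmetric]) measurable
  also have "\<dots> = (\<integral>\<^sup>+f. \<integral>\<^sup>+E. \<integral>\<^sup>+v. F (f, E, v) \<partial>(M3 \<Otimes>\<^sub>M M4) \<partial>M2 \<partial>M1)"
    by (intro nn_integral_cong M34.P.nn_integral_fst[symmetric]) measurable
  also have "\<dots> = (\<integral>\<^sup>+f. \<integral>\<^sup>+E. \<integral>\<^sup>+\<theta>. \<integral>\<^sup>+w. F (f, E, \<theta>, w) \<partial>M4 \<partial>M3 \<partial>M2 \<partial>M1)"
    by (intro nn_integral_cong M4.nn_integral_fst[symmetric]) measurable
  also have "\<dots> = (\<integral>\<^sup>+f. \<integral>\<^sup>+E. \<integral>\<^sup>+w. \<integral>\<^sup>+\<theta>. F (f, E, \<theta>, w) \<partial>M3 \<partial>M4 \<partial>M2 \<partial>M1)"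
    by (intro nn_integral_cong M34.Fubini'[symmetric]) measurable
  also have "\<dots> = (\<integral>\<^sup>+f. \<integral>\<^sup>+w. \<integral>\<^sup>+E. \<integral>\<^sup>+\<theta>. F (f, E, \<theta>, w) \<partial>M3 \<partial>M2 \<partial>M4 \<partial>M1)"
    by (intro nn_integral_cong M24.Fubini'[symmetric]) measurable
  also have "\<dots> = (\<integral>\<^sup>+w. \<integral>\<^sup>+f. \<integral>\<^sup>+E. \<integral>\<^sup>+\<theta>. F (f, E, \<theta>, w) \<partial>M3 \<partial>M2 \<partial>M1 \<partial>M4)"
    by (intro M14.Fubini'[symmetric]) measurable
  finally show "(\<integral>\<^sup>+w. F w \<partial>(M1 \<Otimes>\<^sub>M M2 \<Otimes>\<^sub>M M3 \<Otimes>\<^sub>M M4)) = \<dots>" .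
qed

lemma nn_integral_iterate5:
  assumes "prob_space M1" "prob_space M2" "prob_space M3" "prob_space M4" "prob_space M5"
    and F [measurable]: "F \<in> borel_measurable (M1 \<Otimes>\<^sub>M M2 \<Otimes>\<^sub>M M3 \<Otimes>\<^sub>M M4 \<Otimes>\<^sub>M M5)"
  shows "(\<integral>\<^sup>+w. F w \<partial>(M1 \<Otimes>\<^sub>M M2 \<Otimes>\<^sub>M M3 \<Otimes>\<^sub>M M4 \<Otimes>\<^sub>M M5)) =
      (\<integral>\<^sup>+a. \<integral>\<^sup>+b. \<integral>\<^sup>+c. \<integral>\<^sup>+d. \<integral>\<^sup>+e. F (a, b, c, d, e) \<partial>M5 \<partial>M4 \<partial>M3 \<partial>M2 \<partial>M1)"
proof -
  interpret M5: prob_space M5 by fact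
  interpret M45: prob_space "M4 \<Otimes>\<^sub>M M5" by (intro prob_space_pair assms)
  interpret M345: prob_space "M3 \<Otimes>\<^sub>M M4 \<Otimes>\<^sub>M M5" by (intro prob_space_pair assms)
  interpret M2345: prob_space "M2 \<Otimes>\<^sub>M M3 \<Otimes>\<^sub>M M4 \<Otimes>\<^sub>M M5" by (intro prob_space_pair assms)
  have "(\<integral>\<^sup>+w. F w \<partial>(M1 \<Otimes>\<^sub>M M2 \<Otimes>\<^sub>M M3 \<Otimes>\<^sub>M M4 \<Otimes>\<^sub>M M5)) = (\<integral>\<^sup>+a. \<integral>\<^sup>+v. F (a, v) \<partial>(M2 \<Otimes>\<^sub>M M3 \<Otimes>\<^sub>M M4 \<Otimes>\<^sub>M M5) \<partial>M1)"
    by (rule M2345.nn_integral_fst[symmetric]) measurable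
  also have "\<dots> = (\<integral>\<^sup>+a. \<integral>\<^sup>+b. \<integral>\<^sup>+v. F (a, b, v) \<partial>(M3 \<Otimes>\<^sub>M M4 \<Otimes>\<^sub>M M5) \<partial>M2 \<partial>M1)"
    by (intro nn_integral_cong M345.nn_integral_fst[symmetric]) measurable
  also have "\<dots> = (\<integral>\<^sup>+a. \<integral>\<^sup>+b. \<integral>\<^sup>+c. \<integral>\<^sup>+v. F (a, b, c, v) \<partial>(M4 \<Otimes>\<^sub>M M5) \<partial>M3 \<partial>M2 \<partial>M1)"
    by (intro nn_integral_cong M45.nn_integral_fst[symmetric]) measurable
  also have "\<dots> = (\<integral>\<^sup>+a. \<integral>\<^sup>+b. \<integral>\<^sup>+c. \<integral>\<^sup>+d. \<integral>\<^sup>+e. F (a, b, c, d, e) \<partial>M5 \<partial>M4 \<partial>M3 \<partial>M2 \<partial>M1)"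
    by (intro nn_integral_cong M5.nn_integral_fst[symmetric]) measurable
  finally show ?thesis .
qed

section \<open>The composed algorithm as a union over tree positions\<close>

definition small_part :: "real \<Rightarrow> (nat \<Rightarrow> real) \<Rightarrow> nat \<Rightarrow> real" where
  "small_part \<sigma> x i = (if 0 < x i \<and> x i \<le> 1/10 + \<sigma> then x i else 0)"

definition large_part :: "real \<Rightarrow> (nat \<Rightarrow> real) \<Rightarrow> nat \<Rightarrow> real" where
  "large_part \<sigma> x i = (if 1/10 + \<sigma> < x i then x i else 0)"

text \<open>Unnormalised weights on all indices, 0 off the bucket: sums then run over a fixed set,
  and the dependence on \<sigma> and \<beta> is visibly measurable.\<close>

definition bucket_weight :: "real \<Rightarrow> (nat \<Rightarrow> nat) \<Rightarrow> (nat \<Rightarrow> real) \<Rightarrow> nat \<Rightarrow> nat \<Rightarrow> real" where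
  "bucket_weight \<sigma> \<beta> x b i = (if \<beta> i = b then small_part \<sigma> x i else 0)"

lemma bucket_sum_eq: "bucket_sum n \<sigma> \<beta> x b = (\<Sum>i=1..n. bucket_weight \<sigma> \<beta> x b i)"
proof -
  have "small_bucket n \<sigma> \<beta> x b = {i \<in> {1..n}. 0 < x i \<and> x i \<le> 1/10 + \<sigma> \<and> \<beta> i = b}"
    by (auto simp: small_bucket_def small_def)
  then have "bucket_sum n \<sigma> \<beta> x b = (\<Sum>i=1..n. if 0 < x i \<and> x i \<le> 1/10 + \<sigma> \<and> \<beta> i = b then x i else 0)"
    unfolding bucket_sum_def by (simp only:) (rule sum.inter_filter, simp)
  also have "\<dots> = (\<Sum>i=1..n. bucket_weight \<sigma> \<beta> x b i)"
    by (intro sum.cong) (auto simp: bucket_weight_def small_part_def)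
  finally show ?thesis .
qed

lemma bucket_weight_nonneg: "0 \<le> bucket_weight \<sigma> \<beta> x b i"
  by (auto simp: bucket_weight_def small_part_def)

lemma bucket_sum_nonneg: "0 \<le> bucket_sum n \<sigma> \<beta> x b"
  unfolding bucket_sum_eq by (intro sum_nonneg bucket_weight_nonneg)

lemma hat_eq:
  assumes "j \<in> {1..d}"
  shows "hat n m d R C \<beta> \<sigma> x j =
    (\<Sum>b=1..m. if R b = j then bucket_sum n \<sigma> \<beta> x b else 0) + (\<Sum>i=1..n. if C i = j then large_part \<sigma> x i else 0)"
proof -
  have "(\<Sum>b | b \<in> {1..m} \<and> R b = j. bucket_sum n \<sigma> \<beta> x b) = (\<Sum>b=1..m. if R b = j then bucket_sum n \<sigma> \<beta> x b else 0)"
    by (rule sum.inter_filter) simp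
  moreover have "{i. i \<in> large n \<sigma> x \<and> C i = j} = {i \<in> {1..n}. 1/10 + \<sigma> < x i \<and> C i = j}"
    by (auto simp: large_def)
  then have "(\<Sum>i | i \<in> large n \<sigma> x \<and> C i = j. x i) = (\<Sum>i=1..n. if 1/10 + \<sigma> < x i \<and> C i = j then x i else 0)"
    by (simp only:) (rule sum.inter_filter, simp)
  moreover have "\<dots> = (\<Sum>i=1..n. if C i = j then large_part \<sigma> x i else 0)"
    by (intro sum.cong) (auto simp: large_part_def)
  ultimately show ?thesis using assms by (simp add: hat_def)
qed

lemma rep_eq:
  assumes "0 < bucket_sum n \<sigma> \<beta> x b"
  shows "rep n \<sigma> \<beta> E x b = clock_output n E (bucket_weight \<sigma> \<beta> x b)"
proof -
  have "rep n \<sigma> \<beta> E x b = clock_output n E (\<lambda>i. (if i \<in> small_bucket n \<sigma> \<beta> x b then x i else 0) / bucket_sum n \<sigma> \<beta> x b)"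
    unfolding rep_def by (intro arg_cong[where f="clock_output n E"]) auto
  also have "\<dots> = clock_output n E (\<lambda>i. if i \<in> small_bucket n \<sigma> \<beta> x b then x i else 0)"
    by (rule clock_output_scale[OF assms])
  also have "\<dots> = clock_output n E (bucket_weight \<sigma> \<beta> x b)"
    unfolding set_eq_iff mem_clock_output_iff
    by (auto simp: small_bucket_def small_def bucket_weight_def small_part_def)
  finally show ?thesis .
qed

definition falls_back :: "nat \<Rightarrow> nat \<Rightarrow> (nat \<Rightarrow> nat) \<Rightarrow> (nat \<Rightarrow> nat) \<Rightarrow> (nat \<Rightarrow> nat) \<Rightarrow> real \<Rightarrow> real \<Rightarrow> (nat \<Rightarrow> real) \<Rightarrow> bool" where
  "falls_back n m R C \<beta> \<sigma> \<tau> x \<longleftrightarrow>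
     collision m (large n \<sigma> x) R C \<or> (\<exists>b\<in>{1..m}. 1 - \<tau> < bucket_sum n \<sigma> \<beta> x b)"

text \<open>What position j of the tree stands for. Two inputs share the tree, so reading the output
  position by position makes them comparable.\<close>

definition decode :: "nat \<Rightarrow> nat \<Rightarrow> (nat \<Rightarrow> nat) \<Rightarrow> (nat \<Rightarrow> nat) \<Rightarrow> (nat \<Rightarrow> nat) \<Rightarrow> real \<Rightarrow> (nat \<Rightarrow> real) \<Rightarrow> (nat \<Rightarrow> real) \<Rightarrow> nat \<Rightarrow> nat set" where
  "decode n m R C \<beta> \<sigma> E x j = {i \<in> large n \<sigma> x. C i = j} \<union>
     (\<Union>b\<in>{b \<in> {1..m}. 0 < bucket_sum n \<sigma> \<beta> x b \<and> R b = j}. clock_output n E (bucket_weight \<sigma> \<beta> x b))"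

lemma composed_output_eq:
  "composed_output n m d t f E \<theta> R C \<beta> \<sigma> \<tau> x =
    (if falls_back n m R C \<beta> \<sigma> \<tau> x then f x
     else \<Union>j\<in>tree_output t (fst \<theta>) (snd \<theta>) (hat n m d R C \<beta> \<sigma> x). decode n m R C \<beta> \<sigma> E x j)"
proof (cases "falls_back n m R C \<beta> \<sigma> \<tau> x")
  case True then show ?thesis by (auto simp: composed_output_def falls_back_def)
next
  case False
  let ?T = "tree_output t (fst \<theta>) (snd \<theta>) (hat n m d R C \<beta> \<sigma> x)"
  have "(\<Union>b\<in>{b \<in> {1..m}. 0 < bucket_sum n \<sigma> \<beta> x b \<and> R b \<in> ?T}. rep n \<sigma> \<beta> E x b) =
    (\<Union>b\<in>{b \<in> {1..m}. 0 < bucket_sum n \<sigma> \<beta> x b \<and> R b \<in> ?T}. clock_output n E (bucket_weight \<sigma> \<beta> x b))"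
    by (intro SUP_cong) (simp_all add: rep_eq)
  moreover have "(\<Union>j\<in>?T. decode n m R C \<beta> \<sigma> E x j) = {i \<in> large n \<sigma> x. C i \<in> ?T} \<union> \<dots>"
    unfolding decode_def by blast
  ultimately show ?thesis using False by (simp add: composed_output_def falls_back_def Let_def)
qed

lemma decode_subset: "decode n m R C \<beta> \<sigma> E x j \<subseteq> {1..n}"
  using clock_output_subset by (fastforce simp: decode_def large_def)

text \<open>All coins vary here, so membership is rewritten as a finite Boolean combination of
  measurable conditions.\<close>

lemma pred_composed_output:
  assumes f: "Measurable.pred M (\<lambda>w. i \<in> f w x)"
    and E: "\<And>j. j \<in> {1..n} \<Longrightarrow> (\<lambda>w. E w j) \<in> borel_measurable M"
    and \<theta>: "\<theta> \<in> M \<rightarrow>\<^sub>M tree_space t"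
    and R: "\<And>b. b \<in> {1..m} \<Longrightarrow> (\<lambda>w. R w b) \<in> M \<rightarrow>\<^sub>M count_space UNIV"
    and C: "\<And>i. i \<in> {1..n} \<Longrightarrow> (\<lambda>w. C w i) \<in> M \<rightarrow>\<^sub>M count_space UNIV"
    and \<beta>: "\<And>i. i \<in> {1..n} \<Longrightarrow> (\<lambda>w. \<beta> w i) \<in> M \<rightarrow>\<^sub>M count_space UNIV"
    and [measurable]: "\<sigma> \<in> borel_measurable M" "\<tau> \<in> borel_measurable M"
    and t: "set (leaves t) = {1..d}" and i: "i \<in> {1..n}"
  shows "Measurable.pred M (\<lambda>w. i \<in> composed_output n m d t (f w) (E w) (\<theta> w) (R w) (C w) (\<beta> w) (\<sigma> w) (\<tau> w) x)"
proof -
  note [measurable] = f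
  have bw [measurable]: "(\<lambda>w. bucket_weight (\<sigma> w) (\<beta> w) x b i) \<in> borel_measurable M" if "i \<in> {1..n}" for i b
  proof -
    note [measurable] = \<beta>[OF that]
    show ?thesis unfolding bucket_weight_def small_part_def by measurable
  qed
  then have bs [measurable]: "(\<lambda>w. bucket_sum n (\<sigma> w) (\<beta> w) x b) \<in> borel_measurable M" for b
    unfolding bucket_sum_eq by (intro borel_measurable_sum)
  have lg: "Measurable.pred M (\<lambda>w. i \<in> large n (\<sigma> w) x)" for i
    unfolding large_def by measurable
  have eq: "Measurable.pred M (\<lambda>w. g w = h w)"
    if [measurable]: "g \<in> M \<rightarrow>\<^sub>M count_space UNIV" "h \<in> M \<rightarrow>\<^sub>M count_space UNIV" for g h :: "_ \<Rightarrow> nat"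
  proof -
    have "Measurable.pred M (\<lambda>w. \<exists>j. g w = j \<and> h w = j)" by measurable
    then show ?thesis by (simp add: eq_commute)
  qed
  have coll [measurable]: "Measurable.pred M (\<lambda>w. collision m (large n (\<sigma> w) x) (R w) (C w))"
  proof -
    have "(\<lambda>w. collision m (large n (\<sigma> w) x) (R w) (C w)) = (\<lambda>w.
      (\<exists>i\<in>{1..n}. \<exists>i'\<in>{1..n}. i \<in> large n (\<sigma> w) x \<and> i' \<in> large n (\<sigma> w) x \<and> i \<noteq> i' \<and> C w i = C w i') \<or>
      (\<exists>b\<in>{1..m}. \<exists>b'\<in>{1..m}. b \<noteq> b' \<and> R w b = R w b') \<or>
      (\<exists>i\<in>{1..n}. \<exists>b\<in>{1..m}. i \<in> large n (\<sigma> w) x \<and> C w i = R w b))"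
      unfolding collision_def large_def by (intro ext) blast
    moreover have "Measurable.pred M \<dots>"
      by (intro pred_intros_logic pred_intros_finite finite_atLeastAtMost lg eq R C) auto
    ultimately show ?thesis by simp
  qed
  have fb [measurable]: "Measurable.pred M (\<lambda>w. falls_back n m (R w) (C w) (\<beta> w) (\<sigma> w) (\<tau> w) x)"
    unfolding falls_back_def by (intro pred_intros_logic pred_intros_finite coll) measurable
  have h: "(\<lambda>w. hat n m d (R w) (C w) (\<beta> w) (\<sigma> w) x j) \<in> borel_measurable M" if "j \<in> {1..d}" for j
  proof -
    have "(\<lambda>w. if R w b = j then bucket_sum n (\<sigma> w) (\<beta> w) x b else 0) \<in> borel_measurable M" if "b \<in> {1..m}" for b
    proof -
      have [measurable]: "Measurable.pred M (\<lambda>w. R w b = j)" using R[OF that] by measurable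
      show ?thesis by measurable
    qed
    moreover have "(\<lambda>w. if C w i = j then large_part (\<sigma> w) x i else 0) \<in> borel_measurable M" if "i \<in> {1..n}" for i
    proof -
      have [measurable]: "Measurable.pred M (\<lambda>w. C w i = j)" using C[OF that] by measurable
      show ?thesis unfolding large_part_def by measurable
    qed
    ultimately show ?thesis unfolding hat_eq[OF that] by (intro borel_measurable_add borel_measurable_sum)
  qed
  have T [measurable]: "Measurable.pred M (\<lambda>w. j \<in> tree_output t (fst (\<theta> w)) (snd (\<theta> w)) (hat n m d (R w) (C w) (\<beta> w) (\<sigma> w) x))" for j
    by (rule pred_tree_output[OF h \<theta>]) (simp add: t)
  have cl [measurable]: "Measurable.pred M (\<lambda>w. i \<in> clock_output n (E w) (bucket_weight (\<sigma> w) (\<beta> w) x b))" for b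
    by (rule pred_clock_output[OF E bw])
  have dec [measurable]: "Measurable.pred M (\<lambda>w. i \<in> decode n m (R w) (C w) (\<beta> w) (\<sigma> w) (E w) x j)" for j
  proof -
    have "(\<lambda>w. i \<in> decode n m (R w) (C w) (\<beta> w) (\<sigma> w) (E w) x j) = (\<lambda>w. i \<in> large n (\<sigma> w) x \<and> C w i = j \<or>
      (\<exists>b\<in>{1..m}. 0 < bucket_sum n (\<sigma> w) (\<beta> w) x b \<and> R w b = j \<and> i \<in> clock_output n (E w) (bucket_weight (\<sigma> w) (\<beta> w) x b)))"
      by (auto simp: decode_def)
    moreover have "Measurable.pred M \<dots>"
      by (intro pred_intros_logic pred_intros_finite finite_atLeastAtMost lg eq R C i cl) auto
    ultimately show ?thesis by simp
  qed
  have "(\<lambda>w. i \<in> composed_output n m d t (f w) (E w) (\<theta> w) (R w) (C w) (\<beta> w) (\<sigma> w) (\<tau> w) x) =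
    (\<lambda>w. if falls_back n m (R w) (C w) (\<beta> w) (\<sigma> w) (\<tau> w) x then i \<in> f w x
       else \<exists>j\<in>{1..d}. j \<in> tree_output t (fst (\<theta> w)) (snd (\<theta> w)) (hat n m d (R w) (C w) (\<beta> w) (\<sigma> w) x) \<and>
         i \<in> decode n m (R w) (C w) (\<beta> w) (\<sigma> w) (E w) x j)"
    unfolding composed_output_eq using tree_output_subset[of t] t by fastforce
  moreover have "Measurable.pred M \<dots>" by measurable
  ultimately show ?thesis by simp
qed

text \<open>A position chosen only once accounts for at most one element; a position chosen twice
  but decoded differently accounts for at most two.\<close>

lemma card_sym_diff_UN:
  assumes fin: "finite T" "finite T'" and r: "\<And>j. j \<in> T \<Longrightarrow> finite (r j) \<and> card (r j) \<le> 1"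
    and r': "\<And>j. j \<in> T' \<Longrightarrow> finite (r' j) \<and> card (r' j) \<le> 1"
  shows "card (sym_diff (\<Union>j\<in>T. r j) (\<Union>j\<in>T'. r' j)) \<le> card (sym_diff T T') + 2 * card {j \<in> T \<inter> T'. r j \<noteq> r' j}"
proof -
  let ?N = "{j \<in> T \<inter> T'. r j \<noteq> r' j}"
  have fN: "finite ?N" using fin by auto
  have one: "card (\<Union>j\<in>J. q j) \<le> card J" if "finite J" "\<And>j. j \<in> J \<Longrightarrow> card (q j) \<le> 1" for J and q :: "'a \<Rightarrow> 'b set"
  proof -
    have "card (\<Union>j\<in>J. q j) \<le> (\<Sum>j\<in>J. card (q j))" by (rule card_UN_le[OF that(1)])
    also have "\<dots> \<le> (\<Sum>j\<in>J. 1)" using that(2) by (rule sum_mono)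
    finally show ?thesis by simp
  qed
  have half: "(\<Union>j\<in>S. p j) - (\<Union>j\<in>S'. p' j) \<subseteq> (\<Union>j\<in>S-S'. p j) \<union> (\<Union>j\<in>{j \<in> S \<inter> S'. p j \<noteq> p' j}. p j)"
    for S S' :: "'a set" and p p' :: "'a \<Rightarrow> 'b set"
  proof
    fix x assume "x \<in> (\<Union>j\<in>S. p j) - (\<Union>j\<in>S'. p' j)"
    then obtain j where j: "j \<in> S" "x \<in> p j" "j \<in> S' \<Longrightarrow> x \<notin> p' j" by blast
    show "x \<in> (\<Union>j\<in>S-S'. p j) \<union> (\<Union>j\<in>{j \<in> S \<inter> S'. p j \<noteq> p' j}. p j)"
    proof (cases "j \<in> S'")
      case True
      then have "p j \<noteq> p' j" using j by blast
      with True j show ?thesis by blast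
    qed (use j in blast)
  qed
  have N': "{j \<in> T' \<inter> T. r' j \<noteq> r j} = ?N" by auto
  have sub: "sym_diff (\<Union>j\<in>T. r j) (\<Union>j\<in>T'. r' j) \<subseteq>
     ((\<Union>j\<in>T-T'. r j) \<union> (\<Union>j\<in>T'-T. r' j)) \<union> ((\<Union>j\<in>?N. r j) \<union> (\<Union>j\<in>?N. r' j))"
    using Un_mono[OF half[of r T r' T'] half[of r' T' r T, unfolded N']] by (simp only: Un_ac)
  have "card (sym_diff (\<Union>j\<in>T. r j) (\<Union>j\<in>T'. r' j)) \<le>
     card (((\<Union>j\<in>T-T'. r j) \<union> (\<Union>j\<in>T'-T. r' j)) \<union> ((\<Union>j\<in>?N. r j) \<union> (\<Union>j\<in>?N. r' j)))"
    by (rule card_mono[OF _ sub]) (use fin r r' in auto)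
  also have "\<dots> \<le> card ((\<Union>j\<in>T-T'. r j) \<union> (\<Union>j\<in>T'-T. r' j)) + card ((\<Union>j\<in>?N. r j) \<union> (\<Union>j\<in>?N. r' j))"
    by (rule card_Un_le)
  also have "\<dots> \<le> (card (\<Union>j\<in>T-T'. r j) + card (\<Union>j\<in>T'-T. r' j)) + (card (\<Union>j\<in>?N. r j) + card (\<Union>j\<in>?N. r' j))"
    by (intro add_mono card_Un_le)
  also have "\<dots> \<le> (card (T-T') + card (T'-T)) + (card ?N + card ?N)"
    by (intro add_mono one) (use fin fN r r' in auto)
  also have "card (T-T') + card (T'-T) = card (sym_diff T T')"
    using fin by (intro card_Un_disjoint[symmetric]) auto
  finally show ?thesis by simp
qed

lemma sum_indexed:
  fixes a :: "'a \<Rightarrow> real"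
  assumes "finite I" "finite J" "\<And>i. i \<in> I \<Longrightarrow> g i \<in> J"
  shows "(\<Sum>j\<in>J. \<Sum>i\<in>I. if g i = j then a i else 0) = (\<Sum>i\<in>I. a i)"
proof -
  have "(\<Sum>j\<in>J. \<Sum>i\<in>I. if g i = j then a i else 0) = (\<Sum>i\<in>I. \<Sum>j\<in>J. if g i = j then a i else 0)"
    by (rule sum.swap)
  also have "\<dots> = (\<Sum>i\<in>I. a i)" using assms by (intro sum.cong) auto
  finally show ?thesis .
qed

text \<open>Conditions on the coins that decide the fallback and the layout of the tree; f, E and
  \<theta> remain random.\<close>

locale fixed_coins =
  fixes n k m d :: nat and R C \<beta> :: "nat \<Rightarrow> nat" and \<sigma> \<tau> :: real and t :: btree and A :: sampler and \<alpha> :: real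
  assumes A: "has_stretch n k A \<alpha>" and t: "pivotal_tree d t"
    and R: "b \<in> {1..m} \<Longrightarrow> R b \<in> {1..d}" and C: "i \<in> {1..n} \<Longrightarrow> C i \<in> {1..d}" and \<beta>: "i \<in> {1..n} \<Longrightarrow> \<beta> i \<in> {1..m}"
    and \<sigma>: "0 \<le> \<sigma>" and \<tau>: "0 \<le> \<tau>"
begin

abbreviation "fb x \<equiv> falls_back n m R C \<beta> \<sigma> \<tau> x"
abbreviation "ht x \<equiv> hat n m d R C \<beta> \<sigma> x"
abbreviation "bs x b \<equiv> bucket_sum n \<sigma> \<beta> x b"
abbreviation "bw x b \<equiv> bucket_weight \<sigma> \<beta> x b"
abbreviation "T \<theta> x \<equiv> tree_output t (fst \<theta>) (snd \<theta>) (ht x)"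
abbreviation "dec E x j \<equiv> decode n m R C \<beta> \<sigma> E x j"
abbreviation "out f E \<theta> x \<equiv> composed_output n m d t f E \<theta> R C \<beta> \<sigma> \<tau> x"

lemma small_large_part: "x \<in> Delta n k \<Longrightarrow> i \<in> {1..n} \<Longrightarrow> small_part \<sigma> x i + large_part \<sigma> x i = x i"
  using Delta_bounds[of x n k i] by (auto simp: small_part_def large_part_def)

text \<open>Mass is conserved even under collisions, where contributions to a position add up. Hence
  the sizes allowed for the output of the tree are those allowed for x.\<close>

lemma sum_hat:
  assumes x: "x \<in> Delta n k" shows "(\<Sum>j=1..d. ht x j) = (\<Sum>i=1..n. x i)"
proof -
  have "(\<Sum>j=1..d. ht x j) = (\<Sum>j=1..d. (\<Sum>b=1..m. if R b = j then bs x b else 0)) + (\<Sum>j=1..d. \<Sum>i=1..n. if C i = j then large_part \<sigma> x i else 0)"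
    by (simp add: hat_eq sum.distrib)
  also have "\<dots> = (\<Sum>b=1..m. bs x b) + (\<Sum>i=1..n. large_part \<sigma> x i)"
    by (intro arg_cong2[where f="(+)"] sum_indexed) (use R C in auto)
  also have "(\<Sum>b=1..m. bs x b) = (\<Sum>i=1..n. small_part \<sigma> x i)"
    unfolding bucket_sum_eq bucket_weight_def by (rule sum_indexed) (use \<beta> in auto)
  also have "\<dots> + (\<Sum>i=1..n. large_part \<sigma> x i) = (\<Sum>i=1..n. x i)"
    unfolding sum.distrib[symmetric] using small_large_part[OF x] by (intro sum.cong) auto
  finally show ?thesis .
qed

text \<open>Items are merely added up, first in buckets and then in positions, which cannot increase
  the l1 distance. Only a change of class can, and the right-hand side still shows it.\<close>

lemma l1norm_hat_diff:
  "l1norm d (\<lambda>j. ht x j - ht y j) \<le>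
    (\<Sum>i=1..n. \<bar>small_part \<sigma> x i - small_part \<sigma> y i\<bar> + \<bar>large_part \<sigma> x i - large_part \<sigma> y i\<bar>)"
proof -
  let ?a = "\<lambda>b. \<Sum>i=1..n. if \<beta> i = b then \<bar>small_part \<sigma> x i - small_part \<sigma> y i\<bar> else 0"
  let ?c = "\<lambda>i. \<bar>large_part \<sigma> x i - large_part \<sigma> y i\<bar>"
  have bd: "\<bar>bs x b - bs y b\<bar> \<le> ?a b" for b
    unfolding bucket_sum_eq sum_subtractf[symmetric] bucket_weight_def
    by (rule order_trans[OF sum_abs sum_mono]) auto
  have "\<bar>ht x j - ht y j\<bar> \<le> (\<Sum>b=1..m. if R b = j then ?a b else 0) + (\<Sum>i=1..n. if C i = j then ?c i else 0)"
    if j: "j \<in> {1..d}" for j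
  proof -
    have eq: "ht x j - ht y j = (\<Sum>b=1..m. if R b = j then bs x b - bs y b else 0) +
        (\<Sum>i=1..n. if C i = j then large_part \<sigma> x i - large_part \<sigma> y i else 0)"
      unfolding hat_eq[OF j] add_diff_add sum_subtractf[symmetric]
      by (intro arg_cong2[where f="(+)"] sum.cong) auto
    have "\<bar>ht x j - ht y j\<bar> \<le> \<bar>\<Sum>b=1..m. if R b = j then bs x b - bs y b else 0\<bar> + \<bar>\<Sum>i=1..n. if C i = j then large_part \<sigma> x i - large_part \<sigma> y i else 0\<bar>"
      unfolding eq by (rule abs_triangle_ineq)
    also have "\<dots> \<le> (\<Sum>b=1..m. if R b = j then ?a b else 0) + (\<Sum>i=1..n. if C i = j then ?c i else 0)"
    proof (rule add_mono)
      show "\<bar>\<Sum>b=1..m. if R b = j then bs x b - bs y b else 0\<bar> \<le> (\<Sum>b=1..m. if R b = j then ?a b else 0)"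
      proof (rule order_trans[OF sum_abs], rule sum_mono)
        fix b
        show "\<bar>if R b = j then bs x b - bs y b else 0\<bar> \<le> (if R b = j then ?a b else 0)"
          using bd[of b] by (cases "R b = j") (simp_all only: if_P if_not_P abs_zero order_refl simp_thms)
      qed
      show "\<bar>\<Sum>i=1..n. if C i = j then large_part \<sigma> x i - large_part \<sigma> y i else 0\<bar> \<le> (\<Sum>i=1..n. if C i = j then ?c i else 0)"
        by (rule order_trans[OF sum_abs], rule sum_mono) simp
    qed
    finally show ?thesis .
  qed
  then have "l1norm d (\<lambda>j. ht x j - ht y j) \<le>
      (\<Sum>j=1..d. (\<Sum>b=1..m. if R b = j then ?a b else 0) + (\<Sum>i=1..n. if C i = j then ?c i else 0))"
    unfolding l1norm_def by (rule sum_mono)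
  also have "\<dots> = (\<Sum>b=1..m. ?a b) + (\<Sum>i=1..n. ?c i)"
    unfolding sum.distrib by (intro arg_cong2[where f="(+)"] sum_indexed) (use R C in auto)
  also have "(\<Sum>b=1..m. ?a b) = (\<Sum>i=1..n. \<bar>small_part \<sigma> x i - small_part \<sigma> y i\<bar>)"
    by (rule sum_indexed) (use \<beta> in auto)
  finally show ?thesis by (simp add: sum.distrib)
qed

lemma no_collision:
  assumes "\<not> fb x"
  shows "i \<in> large n \<sigma> x \<Longrightarrow> i' \<in> large n \<sigma> x \<Longrightarrow> C i = C i' \<Longrightarrow> i = i'"
    and "b \<in> {1..m} \<Longrightarrow> b' \<in> {1..m} \<Longrightarrow> R b = R b' \<Longrightarrow> b = b'"
    and "i \<in> large n \<sigma> x \<Longrightarrow> b \<in> {1..m} \<Longrightarrow> C i \<noteq> R b"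
  using assms unfolding falls_back_def collision_def by blast+

lemma large_part_eq_0: "i \<in> {1..n} \<Longrightarrow> i \<notin> large n \<sigma> x \<Longrightarrow> large_part \<sigma> x i = 0"
  by (auto simp: large_part_def large_def)

lemma hat_R:
  assumes nf: "\<not> fb x" and b: "b \<in> {1..m}" shows "ht x (R b) = bs x b"
proof -
  have "(\<Sum>b'=1..m. if R b' = R b then bs x b' else 0) = (\<Sum>b'=1..m. if b' = b then bs x b' else 0)"
    using no_collision(2)[OF nf _ b] by (intro sum.cong) auto
  moreover have "(\<Sum>i=1..n. if C i = R b then large_part \<sigma> x i else 0) = 0"
  proof (intro sum.neutral ballI)
    fix i assume "i \<in> {1..n}"
    then show "(if C i = R b then large_part \<sigma> x i else 0) = 0"
      using no_collision(3)[OF nf _ b, of i] large_part_eq_0[of i x] by (cases "i \<in> large n \<sigma> x") simp_all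
  qed
  ultimately show ?thesis unfolding hat_eq[OF R[OF b]] using b by simp
qed

lemma hat_C:
  assumes nf: "\<not> fb x" and i: "i \<in> large n \<sigma> x" shows "ht x (C i) = x i"
proof -
  have i': "i \<in> {1..n}" using i by (simp add: large_def)
  have "(\<Sum>b=1..m. if R b = C i then bs x b else 0) = 0"
    by (rule sum.neutral) (use no_collision(3)[OF nf i] in fastforce)
  moreover have "(\<Sum>i'=1..n. if C i' = C i then large_part \<sigma> x i' else 0) = (\<Sum>i'=1..n. if i' = i then x i' else 0)"
  proof (rule sum.cong)
    fix l assume "l \<in> {1..n}"
    then show "(if C l = C i then large_part \<sigma> x l else 0) = (if l = i then x l else 0)"
      using no_collision(1)[OF nf _ i, of l] large_part_eq_0[of l x] i by (auto simp: large_part_def large_def)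
  qed simp
  ultimately show ?thesis unfolding hat_eq[OF C[OF i']] using i' by simp
qed

lemma hat_0:
  assumes j: "j \<in> {1..d}" and "\<And>b. b \<in> {1..m} \<Longrightarrow> R b \<noteq> j" "\<And>i. i \<in> large n \<sigma> x \<Longrightarrow> C i \<noteq> j"
  shows "ht x j = 0"
proof -
  have "(\<Sum>b=1..m. if R b = j then bs x b else 0) = 0" using assms by (intro sum.neutral) auto
  moreover have "(\<Sum>i=1..n. if C i = j then large_part \<sigma> x i else 0) = 0"
  proof (intro sum.neutral ballI)
    fix i assume "i \<in> {1..n}"
    then show "(if C i = j then large_part \<sigma> x i else 0) = 0"
      using assms(3)[of i] large_part_eq_0[of i x] by (cases "i \<in> large n \<sigma> x") simp_all
  qed
  ultimately show ?thesis unfolding hat_eq[OF j] by simp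
qed

text \<open>This is what the fallback is for: a collision or a heavy bucket could push an entry
  above 1.\<close>

lemma hat_Delta:
  assumes nf: "\<not> fb x" and x: "x \<in> Delta n k" shows "ht x \<in> Delta d k"
proof -
  have b: "ht x j \<in> {0..1}" if j: "j \<in> {1..d}" for j
  proof -
    consider b where "b \<in> {1..m}" "R b = j" | i where "i \<in> large n \<sigma> x" "C i = j"
      | "\<And>b. b \<in> {1..m} \<Longrightarrow> R b \<noteq> j" "\<And>i. i \<in> large n \<sigma> x \<Longrightarrow> C i \<noteq> j" by blast
    then show ?thesis
    proof cases
      case 1
      then have "bs x b \<le> 1 - \<tau>" using nf by (auto simp: falls_back_def not_less)
      then show ?thesis using hat_R[OF nf 1(1)] 1(2) \<tau> bucket_sum_nonneg[of n \<sigma> \<beta> x b] by simp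
    next
      case 2
      then show ?thesis using hat_C[OF nf 2(1)] Delta_bounds[OF x, of i] by (auto simp: large_def)
    next
      case 3
      then show ?thesis using hat_0[OF j] by simp
    qed
  qed
  have "l1norm d (ht x) = (\<Sum>j=1..d. ht x j)" unfolding l1norm_def using b by (intro sum.cong) auto
  also have "\<dots> \<le> k" using sum_hat[OF x] sum_Delta[OF x] by simp
  finally have l: "l1norm d (ht x) \<le> k" .
  have "ht x \<in> {1..d} \<rightarrow>\<^sub>E {0..1}" using b by (intro PiE_I) (auto simp: hat_def)
  then show ?thesis using l by (simp add: Delta_def)
qed

lemma l1norm_hat:
  assumes nf: "\<not> fb x" and x: "x \<in> Delta n k" shows "l1norm d (ht x) = l1norm n x"
  using sum_hat[OF x] l1norm_Delta[OF hat_Delta[OF nf x]] l1norm_Delta[OF x] by simp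

definition good_clocks :: "(nat \<Rightarrow> real) \<Rightarrow> (nat \<Rightarrow> real) \<Rightarrow> bool" where
  "good_clocks E x \<longleftrightarrow> (\<forall>b\<in>{1..m}. 0 < bs x b \<longrightarrow> card (clock_output n E (bw x b)) = 1)"

lemma AE_good_clocks: "AE E in clock_space n. good_clocks E x"
  unfolding good_clocks_def
proof (rule AE_finite_allI)
  fix b assume "b \<in> {1..m}"
  show "AE E in clock_space n. 0 < bs x b \<longrightarrow> card (clock_output n E (bw x b)) = 1"
  proof (cases "0 < bs x b")
    case True
    then obtain i where "i \<in> {1..n}" "0 < bw x b i"
      unfolding bucket_sum_eq by (metis not_less sum_nonpos)
    then have "AE E in clock_space n. card (clock_output n E (bw x b)) = 1"
      by (intro AE_clock_output_singleton bucket_weight_nonneg)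
    then show ?thesis by eventually_elim simp
  qed simp
qed simp

lemma mem_clock_bw: "i \<in> clock_output n E (bw x b) \<Longrightarrow> i \<in> {1..n} \<and> \<beta> i = b \<and> i \<notin> large n \<sigma> x"
  by (auto simp: mem_clock_output_iff bucket_weight_def small_part_def large_def split: if_splits)

text \<open>An element can come from one position only: C i if it is large, the position of its
  bucket otherwise.\<close>

lemma mem_dec_iff:
  assumes i: "i \<in> {1..n}"
  shows "i \<in> dec E x j \<longleftrightarrow> (if i \<in> large n \<sigma> x then C i = j
     else R (\<beta> i) = j \<and> 0 < bs x (\<beta> i) \<and> i \<in> clock_output n E (bw x (\<beta> i)))"
proof (cases "i \<in> large n \<sigma> x")
  case True
  then have "i \<notin> clock_output n E (bw x b)" for b using mem_clock_bw[of i E x b] by blast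
  with True show ?thesis by (simp add: decode_def)
next
  case False
  have "\<beta> i = b" if "i \<in> clock_output n E (bw x b)" for b using mem_clock_bw[OF that] by blast
  then have "i \<in> dec E x j \<longleftrightarrow> R (\<beta> i) = j \<and> 0 < bs x (\<beta> i) \<and> i \<in> clock_output n E (bw x (\<beta> i))"
    using False \<beta>[OF i] unfolding decode_def by blast
  with False show ?thesis by simp
qed

lemma dec_R:
  assumes "\<not> fb x" "b \<in> {1..m}"
  shows "dec E x (R b) = (if 0 < bs x b then clock_output n E (bw x b) else {})"
  using no_collision[OF assms(1)] assms(2) by (auto simp: decode_def)

lemma dec_C:
  assumes "\<not> fb x" "i \<in> large n \<sigma> x" shows "dec E x (C i) = {i}"
  using no_collision[OF assms(1)] assms(2) unfolding decode_def by (auto; metis)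

lemma dec_other:
  assumes "\<And>b. b \<in> {1..m} \<Longrightarrow> R b \<noteq> j" "\<And>i. i \<in> large n \<sigma> x \<Longrightarrow> C i \<noteq> j" shows "dec E x j = {}"
  using assms by (auto simp: decode_def)

lemma finite_dec: "finite (dec E x j)"
  by (rule finite_subset[OF decode_subset]) simp

lemma card_dec:
  assumes nf: "\<not> fb x" and g: "good_clocks E x"
  shows "card (dec E x j) \<le> 1" and "j \<in> {1..d} \<Longrightarrow> 0 < ht x j \<Longrightarrow> card (dec E x j) = 1"
proof -
  consider b where "b \<in> {1..m}" "R b = j" | i where "i \<in> large n \<sigma> x" "C i = j"
    | "\<And>b. b \<in> {1..m} \<Longrightarrow> R b \<noteq> j" "\<And>i. i \<in> large n \<sigma> x \<Longrightarrow> C i \<noteq> j" by blast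
  then have "card (dec E x j) \<le> 1 \<and> (j \<in> {1..d} \<longrightarrow> 0 < ht x j \<longrightarrow> card (dec E x j) = 1)"
  proof cases
    case 1 then show ?thesis using dec_R[OF nf 1(1), of E] g hat_R[OF nf 1(1)] by (auto simp: good_clocks_def)
  next
    case 2 then show ?thesis using dec_C[OF nf 2(1), of E] by auto
  next
    case 3
    have "dec E x j = {}" by (rule dec_other) (use 3 in auto)
    moreover have "ht x j = 0" if "j \<in> {1..d}" by (rule hat_0[OF that]) (use 3 in auto)
    ultimately show ?thesis by simp
  qed
  then show "card (dec E x j) \<le> 1" "j \<in> {1..d} \<Longrightarrow> 0 < ht x j \<Longrightarrow> card (dec E x j) = 1" by auto
qed

lemma tree_subset: "T \<theta> x \<subseteq> {1..d}"
  unfolding pivotal_tree_leaves(1)[OF t, symmetric] by (rule tree_output_subset)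

lemma finite_tree: "finite (T \<theta> x)"
  by (rule finite_subset[OF tree_subset]) simp

text \<open>A chosen position has positive mass and so decodes to exactly one element, and the
  element determines the position it comes from.\<close>

lemma card_out:
  assumes nf: "\<not> fb x" and g: "good_clocks E x" and pos: "\<forall>j\<in>T \<theta> x. 0 < ht x j"
  shows "card (out f E \<theta> x) = card (T \<theta> x)"
proof -
  have "card (out f E \<theta> x) = (\<Sum>j\<in>T \<theta> x. card (dec E x j))"
    unfolding composed_output_eq using nf
  proof (simp, intro card_UN_disjoint ballI impI finite_tree finite_dec)
    fix j j' :: nat assume "j \<noteq> j'"
    have "l = (if i \<in> large n \<sigma> x then C i else R (\<beta> i))" if "i \<in> dec E x l" for i l
      using that mem_dec_iff[OF subsetD[OF decode_subset that]] by (simp split: if_splits)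
    with \<open>j \<noteq> j'\<close> show "dec E x j \<inter> dec E x j' = {}" by blast
  qed
  also have "\<dots> = (\<Sum>j\<in>T \<theta> x. 1)"
    using card_dec(2)[OF nf g] pos tree_subset by (intro sum.cong) blast+
  finally show ?thesis by simp
qed

lemma AE_card_out:
  assumes x: "x \<in> Delta n k"
  shows "AE f in A. AE E in clock_space n. AE \<theta> in tree_space t.
    int (card (out f E \<theta> x)) \<in> {\<lfloor>l1norm n x\<rfloor>, \<lceil>l1norm n x\<rceil>}"
proof (cases "fb x")
  case True
  show ?thesis using has_stretch_AE_card[OF A x]
  proof eventually_elim
    case (elim f)
    then show ?case using True by (intro AE_I2) (simp add: composed_output_eq)
  qed
next
  case False
  have "AE E in clock_space n. AE \<theta> in tree_space t. int (card (out f E \<theta> x)) \<in> {\<lfloor>l1norm n x\<rfloor>, \<lceil>l1norm n x\<rceil>}" for f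
    using AE_good_clocks[of x]
  proof eventually_elim
    case (elim E)
    show ?case using tree_output_AE_pos[OF t hat_Delta[OF False x]] tree_output_AE_card[OF t hat_Delta[OF False x]]
    proof eventually_elim
      case (elim \<theta>)
      then show ?case using card_out[OF False \<open>good_clocks E x\<close>] l1norm_hat[OF False x] by simp
    qed
  qed
  then show ?thesis by simp
qed

end

lemma nn_integral_of_bool:
  assumes "Measurable.pred M P"
  shows "(\<integral>\<^sup>+w. of_bool (P w) \<partial>M) = emeasure M {w \<in> space M. P w}"
proof -
  have "(\<integral>\<^sup>+w. of_bool (P w) \<partial>M) = (\<integral>\<^sup>+w. indicator {w \<in> space M. P w} w \<partial>M)"
    by (intro nn_integral_cong) (simp add: indicator_def)
  also have "\<dots> = emeasure M {w \<in> space M. P w}" using assms by (intro nn_integral_indicator) (rule predE)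
  finally show ?thesis .
qed

lemma ennreal_of_nat_le_add: "a \<le> b + c \<Longrightarrow> ennreal (real a) \<le> ennreal (real b) + ennreal (real c)"
  by (subst ennreal_plus[symmetric]) (auto intro!: ennreal_leI simp flip: of_nat_add)

lemma nn_integral_le_const_AE:
  assumes "prob_space M" "AE w in M. f w \<le> c" shows "(\<integral>\<^sup>+w. f w \<partial>M) \<le> c"
proof -
  have "(\<integral>\<^sup>+w. f w \<partial>M) \<le> (\<integral>\<^sup>+w. c \<partial>M)" by (rule nn_integral_mono_AE[OF assms(2)])
  then show ?thesis using prob_space.emeasure_space_1[OF assms(1)] by simp
qed

lemma nn_integral_const_prob: "prob_space M \<Longrightarrow> (\<integral>\<^sup>+w. c \<partial>M) = c"
  by (simp add: prob_space.emeasure_space_1)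

section \<open>Expectations for fixed coins\<close>

context fixed_coins
begin

lemma prob_A: "prob_space A" by (rule has_stretch_prob_space[OF A])

lemmas const_prob = nn_integral_const_prob[OF prob_A] nn_integral_const_prob[OF prob_space_clock_space]
  nn_integral_const_prob[OF prob_space_tree_space]

lemma pred_tree: "Measurable.pred (tree_space t) (\<lambda>\<theta>. j \<in> T \<theta> x)"
  by (rule pred_tree_output) auto

lemma mem_out_iff:
  assumes nf: "\<not> fb x" and i: "i \<in> {1..n}"
  shows "i \<in> out f E \<theta> x \<longleftrightarrow> (if i \<in> large n \<sigma> x then C i \<in> T \<theta> x
     else R (\<beta> i) \<in> T \<theta> x \<and> 0 < bs x (\<beta> i) \<and> i \<in> clock_output n E (bw x (\<beta> i)))"
  using nf by (simp add: composed_output_eq mem_dec_iff[OF i])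

lemma emeasure_tree:
  assumes nf: "\<not> fb x" and x: "x \<in> Delta n k" and j: "j \<in> {1..d}"
  shows "(\<integral>\<^sup>+\<theta>. of_bool (j \<in> T \<theta> x) \<partial>tree_space t) = ennreal (ht x j)"
  using nn_integral_of_bool[OF pred_tree] tree_output_marginal[OF t hat_Delta[OF nf x] j] by simp

text \<open>A small item needs its bucket to be chosen and its clock to win. These events are
  independent, with probabilities s and x i / s for s the sum of its bucket.\<close>

lemma out_marginal:
  assumes x: "x \<in> Delta n k" and i: "i \<in> {1..n}"
  shows "(\<integral>\<^sup>+f. \<integral>\<^sup>+E. \<integral>\<^sup>+\<theta>. of_bool (i \<in> out f E \<theta> x) \<partial>tree_space t \<partial>clock_space n \<partial>A) = ennreal (x i)"
proof (cases "fb x")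
  case True
  then show ?thesis
    using nn_integral_of_bool[OF has_stretch_pred[OF A x]] has_stretch_emeasure[OF A x i]
    by (simp only: composed_output_eq if_True const_prob)
next
  case nf: False
  show ?thesis
  proof (cases "i \<in> large n \<sigma> x")
    case True
    then show ?thesis using emeasure_tree[OF nf x C[OF i]] hat_C[OF nf True]
      by (simp only: mem_out_iff[OF nf i] if_True const_prob)
  next
    case nl: False
    let ?b = "\<beta> i"
    have xi: "x i = bw x ?b i"
      using Delta_bounds[OF x i] nl i by (auto simp: bucket_weight_def small_part_def large_def)
    show ?thesis
    proof (cases "0 < bs x ?b")
      case True
      have p: "Measurable.pred (clock_space n) (\<lambda>E. i \<in> clock_output n E (bw x ?b))"
        by (rule pred_clock_output) (auto intro: clock_space_component)
      have m: "emeasure (clock_space n) {E \<in> space (clock_space n). i \<in> clock_output n E (bw x ?b)} = ennreal (bw x ?b i / bs x ?b)"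
      proof (cases "0 < bw x ?b i")
        case True
        then show ?thesis unfolding bucket_sum_eq by (intro clock_output_marginal i bucket_weight_nonneg)
      next
        case False
        then show ?thesis using bucket_weight_nonneg[of \<sigma> \<beta> x ?b i] by (simp add: mem_clock_output_iff)
      qed
      have "(\<integral>\<^sup>+f. \<integral>\<^sup>+E. \<integral>\<^sup>+\<theta>. of_bool (i \<in> out f E \<theta> x) \<partial>tree_space t \<partial>clock_space n \<partial>A) =
         (\<integral>\<^sup>+f. \<integral>\<^sup>+E. \<integral>\<^sup>+\<theta>. of_bool (i \<in> clock_output n E (bw x ?b)) * of_bool (R ?b \<in> T \<theta> x) \<partial>tree_space t \<partial>clock_space n \<partial>A)"
        using nl True by (intro nn_integral_cong) (auto simp: mem_out_iff[OF nf i])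
      also have "\<dots> = (\<integral>\<^sup>+f. \<integral>\<^sup>+E. of_bool (i \<in> clock_output n E (bw x ?b)) * ennreal (bs x ?b) \<partial>clock_space n \<partial>A)"
      proof (intro nn_integral_cong)
        fix E
        have "(\<lambda>\<theta>. of_bool (R ?b \<in> T \<theta> x) :: ennreal) \<in> borel_measurable (tree_space t)"
          using pred_tree[of "R ?b" x] by measurable
        then show "(\<integral>\<^sup>+\<theta>. of_bool (i \<in> clock_output n E (bw x ?b)) * of_bool (R ?b \<in> T \<theta> x) \<partial>tree_space t) =
            of_bool (i \<in> clock_output n E (bw x ?b)) * ennreal (bs x ?b)"
          using emeasure_tree[OF nf x R[OF \<beta>[OF i]]] hat_R[OF nf \<beta>[OF i]] by (simp add: nn_integral_cmult)
      qed
      also have "\<dots> = ennreal (bw x ?b i / bs x ?b) * ennreal (bs x ?b)"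
        using p nn_integral_of_bool[OF p] m by (simp add: nn_integral_multc prob_space.emeasure_space_1[OF prob_A])
      also have "\<dots> = ennreal (x i)"
        using True xi bucket_weight_nonneg[of \<sigma> \<beta> x ?b i] by (simp add: ennreal_mult[symmetric])
      finally show ?thesis .
    next
      case False
      have "bw x ?b i \<le> bs x ?b" unfolding bucket_sum_eq
        by (rule member_le_sum) (use i bucket_weight_nonneg in auto)
      then have "x i = 0" using False xi bucket_weight_nonneg[of \<sigma> \<beta> x ?b i] by simp
      then show ?thesis using nl False by (simp add: mem_out_iff[OF nf i])
    qed
  qed
qed

lemma out_subset:
  assumes "x \<in> Delta n k" "f \<in> space A" shows "out f E \<theta> x \<subseteq> {1..n}"
proof (cases "fb x")
  case True then show ?thesis using has_stretch_subset[OF A assms] by (simp add: composed_output_eq)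
next
  case False then show ?thesis using UN_least[OF decode_subset] by (simp only: composed_output_eq if_False)
qed

text \<open>Crude, but it covers the case that only one of the inputs falls back, where the outputs
  need have nothing in common.\<close>

lemma diff_le_2k:
  assumes x: "x \<in> Delta n k" and y: "y \<in> Delta n k"
  shows "(\<integral>\<^sup>+f. \<integral>\<^sup>+E. \<integral>\<^sup>+\<theta>. set_dist (out f E \<theta> x) (out f E \<theta> y) \<partial>tree_space t \<partial>clock_space n \<partial>A) \<le> ennreal (2 * real k)"
proof -
  have le: "card X \<le> k" if "int (card X) \<in> {\<lfloor>l1norm n z\<rfloor>, \<lceil>l1norm n z\<rceil>}" "z \<in> Delta n k" for X :: "nat set" and z
  proof -
    have "l1norm n z \<le> real k" using that(2) by (simp add: Delta_def)
    then have "\<lceil>l1norm n z\<rceil> \<le> int k" by (simp add: ceiling_le_iff)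
    moreover from this have "\<lfloor>l1norm n z\<rfloor> \<le> int k" using floor_le_ceiling order_trans by blast
    ultimately have "int (card X) \<le> int k" using that(1) by (elim insertE) simp_all
    then show ?thesis by simp
  qed
  have "AE f in A. AE E in clock_space n. AE \<theta> in tree_space t.
      set_dist (out f E \<theta> x) (out f E \<theta> y) \<le> ennreal (2 * real k)"
    using AE_card_out[OF x] AE_card_out[OF y] AE_space
  proof eventually_elim
    case (elim f)
    have fin: "finite (out f E \<theta> x)" "finite (out f E \<theta> y)" for E \<theta>
      by (rule finite_subset[OF out_subset[OF _ elim(3)]], (rule x y), simp)+
    from elim(1,2) show ?case
    proof eventually_elim
      case (elim E)
      from elim(1,2) show ?case
      proof eventually_elim
        case (elim \<theta>)
        have "card (sym_diff (out f E \<theta> x) (out f E \<theta> y)) \<le> card (out f E \<theta> x - out f E \<theta> y) + card (out f E \<theta> y - out f E \<theta> x)"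
          by (rule card_Un_le)
        also have "\<dots> \<le> card (out f E \<theta> x) + card (out f E \<theta> y)"
          using fin by (intro add_mono card_mono Diff_subset)
        also have "\<dots> \<le> 2 * k" using le[OF elim(1) x] le[OF elim(2) y] by simp
        finally show ?case by (intro ennreal_leI) simp
      qed
    qed
  qed
  then show ?thesis
    by (intro nn_integral_le_const_AE prob_A, elim eventually_mono,
        intro nn_integral_le_const_AE prob_space_clock_space, elim eventually_mono,
        intro nn_integral_le_const_AE prob_space_tree_space)
qed

lemma card_diff_out:
  assumes nf: "\<not> fb x" "\<not> fb y" and g: "good_clocks E x" "good_clocks E y"
  shows "card (sym_diff (out f E \<theta> x) (out f E \<theta> y)) \<le>
    card (sym_diff (T \<theta> x) (T \<theta> y)) + 2 * card {j \<in> T \<theta> x \<inter> T \<theta> y. dec E x j \<noteq> dec E y j}"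
proof -
  have "out f E \<theta> x = (\<Union>j\<in>T \<theta> x. dec E x j)" "out f E \<theta> y = (\<Union>j\<in>T \<theta> y. dec E y j)"
    using nf by (simp_all add: composed_output_eq)
  then show ?thesis
    by (simp only:) (intro card_sym_diff_UN finite_tree conjI finite_dec card_dec(1)[OF nf(1) g(1)] card_dec(1)[OF nf(2) g(2)])
qed

end

section \<open>Changing one coordinate for fixed coins\<close>

locale coordinate_step = fixed_coins +
  fixes x :: "nat \<Rightarrow> real" and u :: nat and v :: real and y :: "nat \<Rightarrow> real"
  assumes x: "x \<in> Delta n k" and y: "y \<in> Delta n k" and u: "u \<in> {1..n}" and v: "x u \<le> v" and y_def: "y = x(u := v)"
begin

definition "crossing \<longleftrightarrow> x u \<le> 1/10 + \<sigma> \<and> 1/10 + \<sigma> < v"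

lemma x_bounds: "0 \<le> x u" "v \<le> 1"
  using Delta_bounds[OF x u] Delta_bounds[OF y u] by (auto simp: y_def)

text \<open>A crossing removes the old mass of u from its bucket's position and puts the new one at
  C u, hence the constant 2.\<close>

lemma hat_step: "l1norm d (\<lambda>j. ht x j - ht y j) \<le> (if crossing then 2 else v - x u)"
proof -
  have "(\<Sum>i=1..n. \<bar>small_part \<sigma> x i - small_part \<sigma> y i\<bar> + \<bar>large_part \<sigma> x i - large_part \<sigma> y i\<bar>) =
    (\<Sum>i=1..n. if i = u then \<bar>small_part \<sigma> x u - small_part \<sigma> y u\<bar> + \<bar>large_part \<sigma> x u - large_part \<sigma> y u\<bar> else 0)"
    by (intro sum.cong) (auto simp: y_def small_part_def large_part_def)
  also have "\<dots> = \<bar>small_part \<sigma> x u - small_part \<sigma> y u\<bar> + \<bar>large_part \<sigma> x u - large_part \<sigma> y u\<bar>"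
    using u by simp
  also have "\<dots> \<le> (if crossing then 2 else v - x u)"
    using x_bounds v by (auto simp: y_def small_part_def large_part_def crossing_def)
  finally show ?thesis using l1norm_hat_diff[of x y] by linarith
qed

lemma tree_step:
  assumes "\<not> fb x" "\<not> fb y"
  shows "(\<integral>\<^sup>+\<theta>. set_dist (T \<theta> x) (T \<theta> y) \<partial>tree_space t) \<le>
    ennreal (tree_stretch t * (if crossing then 2 else v - x u))"
  using tree_output_lipschitz[OF t hat_Delta[OF assms(1) x] hat_Delta[OF assms(2) y]]
  by (rule order_trans) (intro ennreal_leI mult_left_mono hat_step, simp add: tree_stretch_def[OF t])

lemma bw_other: "b \<noteq> \<beta> u \<Longrightarrow> bw y b = bw x b"
  by (auto simp: fun_eq_iff bucket_weight_def small_part_def y_def)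

lemma large_other: "i \<noteq> u \<Longrightarrow> i \<in> large n \<sigma> y \<longleftrightarrow> i \<in> large n \<sigma> x"
  by (auto simp: large_def y_def)

lemma large_same: "\<not> crossing \<Longrightarrow> large n \<sigma> y = large n \<sigma> x"
  using v by (auto simp: large_def y_def crossing_def split: if_splits)

lemma bs_other: "b \<noteq> \<beta> u \<Longrightarrow> bs y b = bs x b"
  by (simp add: bucket_sum_eq bw_other)

text \<open>The item u occurs only in its bucket and, when large, at C u.\<close>

lemma dec_other_step:
  assumes "j \<noteq> R (\<beta> u)" "crossing \<Longrightarrow> j \<noteq> C u" shows "dec E y j = dec E x j"
proof -
  have "{i \<in> large n \<sigma> y. C i = j} = {i \<in> large n \<sigma> x. C i = j}"
  proof (cases crossing)
    case True
    have "i \<in> large n \<sigma> y \<and> C i = j \<longleftrightarrow> i \<in> large n \<sigma> x \<and> C i = j" for i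
      using assms(2)[OF True] large_other[of i] by (cases "i = u") auto
    then show ?thesis by simp
  next
    case False then show ?thesis using large_same by simp
  qed
  moreover have "(\<Union>b\<in>{b \<in> {1..m}. 0 < bs y b \<and> R b = j}. clock_output n E (bw y b)) =
     (\<Union>b\<in>{b \<in> {1..m}. 0 < bs x b \<and> R b = j}. clock_output n E (bw x b))"
  proof (rule SUP_cong)
    have "0 < bs y b \<and> R b = j \<longleftrightarrow> 0 < bs x b \<and> R b = j" for b
      using assms(1) bs_other[of b] by (cases "b = \<beta> u") auto
    then show "{b \<in> {1..m}. 0 < bs y b \<and> R b = j} = {b \<in> {1..m}. 0 < bs x b \<and> R b = j}" by simp
    fix b assume "b \<in> {b \<in> {1..m}. 0 < bs x b \<and> R b = j}"
    then have "b \<noteq> \<beta> u" using assms(1) by auto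
    then show "clock_output n E (bw y b) = clock_output n E (bw x b)" by (simp add: bw_other)
  qed
  ultimately show ?thesis by (simp add: decode_def)
qed

text \<open>A bound that does not shrink with v - x u is enough here, because a crossing has
  probability at most 10 (v - x u) over \<sigma>.\<close>

lemma diff_crossing:
  assumes nf: "\<not> fb x" "\<not> fb y" and c: crossing
  shows "(\<integral>\<^sup>+f. \<integral>\<^sup>+E. \<integral>\<^sup>+\<theta>. set_dist (out f E \<theta> x) (out f E \<theta> y) \<partial>tree_space t \<partial>clock_space n \<partial>A)
    \<le> ennreal (2 * tree_stretch t + 4)"
proof -
  have "(\<integral>\<^sup>+\<theta>. set_dist (out f E \<theta> x) (out f E \<theta> y) \<partial>tree_space t) \<le> ennreal (2 * tree_stretch t + 4)"
    if g: "good_clocks E x" "good_clocks E y" for f E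
  proof -
    have "(\<integral>\<^sup>+\<theta>. set_dist (out f E \<theta> x) (out f E \<theta> y) \<partial>tree_space t) \<le>
       (\<integral>\<^sup>+\<theta>. set_dist (T \<theta> x) (T \<theta> y) + ennreal (real 4) \<partial>tree_space t)"
    proof (rule nn_integral_mono)
      fix \<theta>
      \<comment> \<open>At most two common positions decode differently, at a cost of 2 each; this
        is the summand 4.\<close>
      have "{j \<in> T \<theta> x \<inter> T \<theta> y. dec E x j \<noteq> dec E y j} \<subseteq> {R (\<beta> u), C u}"
        using dec_other_step[of _ E] by fastforce
      from card_mono[OF _ this] have "card {j \<in> T \<theta> x \<inter> T \<theta> y. dec E x j \<noteq> dec E y j} \<le> 2"
        by (simp add: card_insert_if split: if_splits)
      then have "card (sym_diff (out f E \<theta> x) (out f E \<theta> y)) \<le> card (sym_diff (T \<theta> x) (T \<theta> y)) + 4"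
        using card_diff_out[OF nf g, of f \<theta>] by linarith
      then show "set_dist (out f E \<theta> x) (out f E \<theta> y) \<le> set_dist (T \<theta> x) (T \<theta> y) + ennreal (real 4)"
        by (rule ennreal_of_nat_le_add)
    qed
    also have "\<dots> = (\<integral>\<^sup>+\<theta>. set_dist (T \<theta> x) (T \<theta> y) \<partial>tree_space t) + ennreal (real 4)"
    proof (subst nn_integral_add)
      show "(\<lambda>\<theta>. set_dist (T \<theta> x) (T \<theta> y)) \<in> borel_measurable (tree_space t)"
        by (intro measurable_compose[OF _ measurable_ennreal] borel_measurable_card_sym_diff[where A="{1..d}"]) (use tree_subset pred_tree in auto)
    qed (simp_all add: prob_space.emeasure_space_1[OF prob_space_tree_space])
    also have "\<dots> \<le> ennreal (tree_stretch t * 2) + ennreal (real 4)"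
      using tree_step[OF nf] c by (intro add_right_mono) simp
    also have "\<dots> = ennreal (2 * tree_stretch t + 4)"
      by (subst ennreal_plus[symmetric]) (auto simp: tree_stretch_def[OF t] mult.commute)
    finally show ?thesis .
  qed
  note inner = this
  have "(\<integral>\<^sup>+E. \<integral>\<^sup>+\<theta>. set_dist (out f E \<theta> x) (out f E \<theta> y) \<partial>tree_space t \<partial>clock_space n)
    \<le> ennreal (2 * tree_stretch t + 4)" for f
  proof (rule nn_integral_le_const_AE[OF prob_space_clock_space])
    show "AE E in clock_space n. (\<integral>\<^sup>+\<theta>. set_dist (out f E \<theta> x) (out f E \<theta> y) \<partial>tree_space t)
        \<le> ennreal (2 * tree_stretch t + 4)"
      using AE_good_clocks[of x] AE_good_clocks[of y] by eventually_elim (rule inner)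
  qed
  then show ?thesis by (intro nn_integral_le_const_AE[OF prob_A] AE_I2)
qed

lemma bw_small_step:
  assumes "v \<le> 1/10 + \<sigma>"
  shows "bw y (\<beta> u) = (bw x (\<beta> u))(u := v)" "bw x (\<beta> u) u = x u" "bs y (\<beta> u) = bs x (\<beta> u) + (v - x u)"
proof -
  show 1: "bw y (\<beta> u) = (bw x (\<beta> u))(u := v)" and 2: "bw x (\<beta> u) u = x u"
    using assms x_bounds v by (auto simp: fun_eq_iff bucket_weight_def small_part_def y_def)
  show "bs y (\<beta> u) = bs x (\<beta> u) + (v - x u)"
    unfolding bucket_sum_eq 1 using u 2 by (simp add: sum.remove[of _ u])
qed

lemma bw_large:
  assumes "1/10 + \<sigma> < x u" shows "bw y b = bw x b"
  using assms v by (auto simp: fun_eq_iff bucket_weight_def small_part_def y_def)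

lemma dec_not_crossing:
  assumes nc: "\<not> crossing" and "1/10 + \<sigma> < x u \<or> clock_output n E (bw x (\<beta> u)) = clock_output n E (bw y (\<beta> u)) \<and> 0 < bs x (\<beta> u)"
  shows "dec E y j = dec E x j"
proof -
  have bs: "0 < bs y b \<longleftrightarrow> 0 < bs x b" and cl: "clock_output n E (bw y b) = clock_output n E (bw x b)" for b
  proof -
    have "(0 < bs y b \<longleftrightarrow> 0 < bs x b) \<and> clock_output n E (bw y b) = clock_output n E (bw x b)"
    proof (cases "1/10 + \<sigma> < x u")
      case True then show ?thesis by (simp add: bucket_sum_eq bw_large)
    next
      case False
      then have "v \<le> 1/10 + \<sigma>" using nc by (auto simp: crossing_def)
      then show ?thesis using assms(2) False bs_other[of b] bw_other[of b] bw_small_step(3) v by (cases "b = \<beta> u") auto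
    qed
    then show "0 < bs y b \<longleftrightarrow> 0 < bs x b" "clock_output n E (bw y b) = clock_output n E (bw x b)" by auto
  qed
  show ?thesis unfolding decode_def by (simp only: large_same[OF nc] bs cl)
qed

text \<open>The tree contributes its own stretch. The summand 2 pays for the representative of the
  bucket of u: a changed winner costs 2 and matters only if the bucket is chosen, with probability
  \<open>bs x (\<beta> u)\<close>, and \<open>clock_output_stable\<close> is scaled by just this
  factor.\<close>

lemma diff_not_crossing:
  assumes nf: "\<not> fb x" "\<not> fb y" and nc: "\<not> crossing"
  shows "(\<integral>\<^sup>+f. \<integral>\<^sup>+E. \<integral>\<^sup>+\<theta>. set_dist (out f E \<theta> x) (out f E \<theta> y) \<partial>tree_space t \<partial>clock_space n \<partial>A)
    \<le> ennreal ((tree_stretch t + 2) * (v - x u))"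
proof -
  let ?b = "\<beta> u" and ?D = "{E \<in> space (clock_space n). clock_output n E (bw x (\<beta> u)) \<noteq> clock_output n E (bw y (\<beta> u))}"
  \<comment> \<open>For a large u no bucket changes, so the clocks contribute 0.\<close>
  let ?S = "if 1/10 + \<sigma> < x u then 0 else bs x ?b"
  have b: "?b \<in> {1..m}" using \<beta> u by simp
  have Tm: "(\<lambda>\<theta>. set_dist (T \<theta> x) (T \<theta> y)) \<in> borel_measurable (tree_space t)"
    by (intro measurable_compose[OF _ measurable_ennreal] borel_measurable_card_sym_diff[where A="{1..d}"]) (use tree_subset pred_tree in auto)
  have inner: "(\<integral>\<^sup>+\<theta>. set_dist (out f E \<theta> x) (out f E \<theta> y) \<partial>tree_space t) \<le>
      ennreal (tree_stretch t * (v - x u)) + ennreal (2 * ?S) * indicator ?D E"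
    if g: "good_clocks E x" "good_clocks E y" and E: "E \<in> space (clock_space n)" for f E
  proof (cases "\<forall>\<theta>. \<forall>j. dec E y j = dec E x j")
    case True
    have "(\<integral>\<^sup>+\<theta>. set_dist (out f E \<theta> x) (out f E \<theta> y) \<partial>tree_space t) \<le>
       (\<integral>\<^sup>+\<theta>. set_dist (T \<theta> x) (T \<theta> y) \<partial>tree_space t)"
      using card_diff_out[OF nf g, of f] True by (intro nn_integral_mono ennreal_leI) simp
    also have "\<dots> \<le> ennreal (tree_stretch t * (v - x u))" using tree_step[OF nf] nc by simp
    finally show ?thesis by (rule order_trans) simp
  next
    case False
    then have sm: "\<not> 1/10 + \<sigma> < x u" and neq: "clock_output n E (bw x ?b) \<noteq> clock_output n E (bw y ?b) \<or> \<not> 0 < bs x ?b"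
      using dec_not_crossing[OF nc, of E] by blast+
    have hR: "ht x (R ?b) = bs x ?b" by (rule hat_R[OF nf(1) b])
    show ?thesis
    proof (cases "0 < bs x ?b")
      case True
      have "(\<integral>\<^sup>+\<theta>. set_dist (out f E \<theta> x) (out f E \<theta> y) \<partial>tree_space t) \<le>
         (\<integral>\<^sup>+\<theta>. set_dist (T \<theta> x) (T \<theta> y) + 2 * of_bool (R ?b \<in> T \<theta> x) \<partial>tree_space t)"
      proof (rule nn_integral_mono)
        fix \<theta>
        let ?N = "{j \<in> T \<theta> x \<inter> T \<theta> y. dec E x j \<noteq> dec E y j}"
        have "j = R ?b \<and> R ?b \<in> T \<theta> x" if "j \<in> ?N" for j
          using that dec_other_step[of j E] nc by auto
        then have "?N \<subseteq> (if R ?b \<in> T \<theta> x then {R ?b} else {})" by auto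
        from card_mono[OF _ this] have "card ?N \<le> card (if R ?b \<in> T \<theta> x then {R ?b} else {})" by simp
        then have "card ?N \<le> of_bool (R ?b \<in> T \<theta> x)" by (simp split: if_splits)
        then have "card (sym_diff (out f E \<theta> x) (out f E \<theta> y)) \<le> card (sym_diff (T \<theta> x) (T \<theta> y)) + 2 * of_bool (R ?b \<in> T \<theta> x)"
          using card_diff_out[OF nf g, of f \<theta>] by linarith
        from ennreal_of_nat_le_add[OF this]
        show "set_dist (out f E \<theta> x) (out f E \<theta> y) \<le>
            set_dist (T \<theta> x) (T \<theta> y) + 2 * of_bool (R ?b \<in> T \<theta> x)"
          by (cases "R ?b \<in> T \<theta> x") simp_all
      qed
      also have "\<dots> = (\<integral>\<^sup>+\<theta>. set_dist (T \<theta> x) (T \<theta> y) \<partial>tree_space t) +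
          2 * (\<integral>\<^sup>+\<theta>. of_bool (R ?b \<in> T \<theta> x) \<partial>tree_space t)"
      proof -
        have "(\<lambda>\<theta>. of_bool (R ?b \<in> T \<theta> x) :: ennreal) \<in> borel_measurable (tree_space t)"
          using pred_tree[of "R ?b" x] by measurable
        then show ?thesis by (subst nn_integral_add[OF Tm]) (simp_all add: nn_integral_cmult)
      qed
      also have "\<dots> \<le> ennreal (tree_stretch t * (v - x u)) + 2 * ennreal (bs x ?b)"
        using tree_step[OF nf] nc emeasure_tree[OF nf(1) x R[OF b]] hR by (intro add_mono) simp_all
      also have "\<dots> = ennreal (tree_stretch t * (v - x u)) + ennreal (2 * ?S) * indicator ?D E"
        using sm neq True E bucket_sum_nonneg[of n \<sigma> \<beta> x ?b] by (simp add: ennreal_mult)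
      finally show ?thesis .
    next
      \<comment> \<open>The bucket is empty in x, so its position is almost surely not chosen for x;
        hence no common position decodes differently.\<close>
      case S0: False
      have "ht x (R ?b) = 0" using S0 hR bucket_sum_nonneg[of n \<sigma> \<beta> x ?b] by simp
      then have "AE \<theta> in tree_space t. R ?b \<notin> T \<theta> x"
        using tree_output_AE_pos[OF t hat_Delta[OF nf(1) x]] by (elim eventually_mono) auto
      then have "(\<integral>\<^sup>+\<theta>. set_dist (out f E \<theta> x) (out f E \<theta> y) \<partial>tree_space t) \<le>
         (\<integral>\<^sup>+\<theta>. set_dist (T \<theta> x) (T \<theta> y) \<partial>tree_space t)"
      proof (intro nn_integral_mono_AE, elim eventually_mono)
        fix \<theta> :: "real \<times> (bool list \<Rightarrow> real)" assume "R ?b \<notin> T \<theta> x"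
        then have "dec E y j = dec E x j" if "j \<in> T \<theta> x" for j
          using that by (intro dec_other_step) (auto simp: nc)
        then have emp: "{j \<in> T \<theta> x \<inter> T \<theta> y. dec E x j \<noteq> dec E y j} = {}" by force
        show "set_dist (out f E \<theta> x) (out f E \<theta> y) \<le> set_dist (T \<theta> x) (T \<theta> y)"
          using card_diff_out[OF nf g, of f \<theta>] unfolding emp by (intro ennreal_leI) simp
      qed
      also have "\<dots> \<le> ennreal (tree_stretch t * (v - x u))" using tree_step[OF nf] nc by simp
      finally show ?thesis by (rule order_trans) simp
    qed
  qed
  have D: "?D \<in> sets (clock_space n)" by (rule sets_clock_output_neq)
  have ts: "0 \<le> tree_stretch t" by (simp add: tree_stretch_def[OF t])
  have stable: "ennreal ?S * emeasure (clock_space n) ?D \<le> ennreal (v - x u)"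
  proof (cases "1/10 + \<sigma> < x u \<or> \<not> 0 < bs x ?b")
    case True then show ?thesis using bucket_sum_nonneg[of n \<sigma> \<beta> x ?b] by auto
  next
    case False
    then have "v \<le> 1/10 + \<sigma>" using nc by (auto simp: crossing_def)
    note st = bw_small_step[OF this]
    have "ennreal (\<Sum>j=1..n. bw x ?b j) * emeasure (clock_space n) ?D \<le> ennreal (v - bw x ?b u)"
    proof (rule clock_output_stable)
      show "0 < (\<Sum>j=1..n. bw x ?b j)" using False unfolding bucket_sum_eq by blast
    qed (use u v st bucket_weight_nonneg in auto)
    then have "ennreal (bs x ?b) * emeasure (clock_space n) ?D \<le> ennreal (v - x u)"
      unfolding bucket_sum_eq[symmetric] st(2) .
    then show ?thesis using False by simp
  qed
  have "(\<integral>\<^sup>+E. \<integral>\<^sup>+\<theta>. set_dist (out f E \<theta> x) (out f E \<theta> y) \<partial>tree_space t \<partial>clock_space n) \<le>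
     ennreal ((tree_stretch t + 2) * (v - x u))" for f
  proof -
    have "AE E in clock_space n. good_clocks E x \<and> good_clocks E y"
      using AE_good_clocks by (simp add: AE_conj_iff)
    then have "(\<integral>\<^sup>+E. \<integral>\<^sup>+\<theta>. set_dist (out f E \<theta> x) (out f E \<theta> y) \<partial>tree_space t \<partial>clock_space n) \<le>
      (\<integral>\<^sup>+E. ennreal (tree_stretch t * (v - x u)) + ennreal (2 * ?S) * indicator ?D E \<partial>clock_space n)"
      by (intro nn_integral_mono_AE, elim AE_mp, intro AE_I2 impI) (blast intro: inner)
    also have "\<dots> = ennreal (tree_stretch t * (v - x u)) + ennreal (2 * ?S) * emeasure (clock_space n) ?D"
    proof (subst nn_integral_add)
      show "(\<lambda>E. ennreal (2 * ?S) * indicator ?D E) \<in> borel_measurable (clock_space n)"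
        using D by (intro borel_measurable_times_ennreal borel_measurable_const borel_measurable_indicator)
    qed (simp_all only: const_prob nn_integral_cmult_indicator[OF D] borel_measurable_const)
    also have "ennreal (2 * ?S) = 2 * ennreal ?S" using bucket_sum_nonneg[of n \<sigma> \<beta> x ?b] by (simp add: ennreal_mult)
    also have "ennreal (tree_stretch t * (v - x u)) + 2 * ennreal ?S * emeasure (clock_space n) ?D \<le>
        ennreal (tree_stretch t * (v - x u)) + 2 * ennreal (v - x u)"
      unfolding mult.assoc using stable by (intro add_left_mono mult_left_mono) auto
    also have "\<dots> = ennreal ((tree_stretch t + 2) * (v - x u))"
    proof -
      have e2: "2 * ennreal (v - x u) = ennreal (2 * (v - x u))" using v by (subst ennreal_mult) auto
      show ?thesis unfolding e2 distrib_right using v ts by (intro ennreal_plus[symmetric]) auto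
    qed
    finally show ?thesis .
  qed
  then show ?thesis by (intro nn_integral_le_const_AE[OF prob_A] AE_I2)
qed

lemma diff_fallback:
  assumes "fb x" "fb y"
  shows "(\<integral>\<^sup>+f. \<integral>\<^sup>+E. \<integral>\<^sup>+\<theta>. set_dist (out f E \<theta> x) (out f E \<theta> y) \<partial>tree_space t \<partial>clock_space n \<partial>A)
    \<le> ennreal (\<alpha> * (v - x u))"
proof -
  have "l1norm n (\<lambda>i. x i - y i) = (\<Sum>i=1..n. if i = u then v - x u else 0)"
    unfolding l1norm_def using v by (intro sum.cong) (auto simp: y_def)
  then have "l1norm n (\<lambda>i. x i - y i) = v - x u" using u by simp
  then show ?thesis using has_stretch_nn_integral[OF A x y] assms
    by (simp only: composed_output_eq if_True const_prob)
qed

end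

section \<open>Bad coins are unlikely\<close>

definition uniform_map :: "nat \<Rightarrow> nat \<Rightarrow> (nat \<Rightarrow> nat) measure" where
  "uniform_map l D = (\<Pi>\<^sub>M i\<in>{1..l}. uniform_count_measure {1..D})"

lemma prob_space_uniform_range: "1 \<le> D \<Longrightarrow> prob_space (uniform_count_measure {1..D::nat})"
  by (rule prob_space_uniform_count_measure) auto

lemma prob_space_uniform_map: "1 \<le> D \<Longrightarrow> prob_space (uniform_map l D)"
  unfolding uniform_map_def by (intro prob_space_PiM prob_space_uniform_range)

lemma sets_uniform_map: "sets (uniform_map l D) = Pow ({1..l} \<rightarrow>\<^sub>E {1..D})"
proof -
  have "sets (uniform_map l D) = sets (\<Pi>\<^sub>M i\<in>{1..l}. count_space {1..D})"
    unfolding uniform_map_def by (rule sets_PiM_cong) (simp_all add: sets_uniform_count_measure)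
  also have "(\<Pi>\<^sub>M i\<in>{1..l}. count_space {1..D}) = count_space ({1..l} \<rightarrow>\<^sub>E {1..D})"
    by (rule count_space_PiM_finite) auto
  finally show ?thesis by simp
qed

lemma space_uniform_map: "space (uniform_map l D) = {1..l} \<rightarrow>\<^sub>E {1..D}"
  by (simp add: uniform_map_def space_PiM space_uniform_count_measure)

text \<open>The space is finite and every subset is measurable; this settles measurability in R, C
  and \<beta> in the estimates below.\<close>

lemma measurable_uniform_map: "(f :: _ \<Rightarrow> ennreal) \<in> borel_measurable (uniform_map l D)"
proof (rule measurableI)
  show "f -` S \<inter> space (uniform_map l D) \<in> sets (uniform_map l D)" for S
    unfolding sets_uniform_map space_uniform_map by blast
qed simp

text \<open>Given all values except the one at i, the target is fixed and w i is uniform; the target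
  may lie outside the range, hence only an inequality. With h reading another index this bounds
  collisions, with h constant it bounds hits of a given position.\<close>

lemma uniform_map_value:
  assumes D: "1 \<le> D" and i: "i \<in> {1..l}" and h: "\<And>w c. h (w(i := c)) = h w"
  shows "(\<integral>\<^sup>+w. of_bool (w i = h w) \<partial>uniform_map l D) \<le> ennreal (1 / real D)"
proof -
  interpret U: prob_space "uniform_count_measure {1..D}" by (rule prob_space_uniform_range[OF D])
  interpret product_sigma_finite "\<lambda>_::nat. uniform_count_measure {1..D}" by unfold_locales
  let ?I = "{1..l} - {i}"
  have ins: "{1..l} = insert i ?I" using i by auto
  have m: "(\<lambda>w. of_bool (w i = h w) :: ennreal) \<in> borel_measurable (\<Pi>\<^sub>M i\<in>insert i ?I. uniform_count_measure {1..D})"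
    using measurable_uniform_map[of "\<lambda>w. of_bool (w i = h w)" l D] ins by (simp add: uniform_map_def)
  have "(\<integral>\<^sup>+w. of_bool (w i = h w) \<partial>uniform_map l D) =
     (\<integral>\<^sup>+w. of_bool (w i = h w) \<partial>(\<Pi>\<^sub>M i\<in>insert i ?I. uniform_count_measure {1..D}))" using ins by (simp add: uniform_map_def)
  also have "\<dots> = (\<integral>\<^sup>+w. \<integral>\<^sup>+c. of_bool ((w(i := c)) i = h (w(i := c))) \<partial>uniform_count_measure {1..D} \<partial>(\<Pi>\<^sub>M i\<in>?I. uniform_count_measure {1..D}))"
    by (rule product_nn_integral_insert[OF _ _ m]) auto
  also have "\<dots> \<le> ennreal (1 / real D)"
  proof (rule nn_integral_le_const_AE[OF prob_space_PiM AE_I2])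
    show "prob_space (uniform_count_measure {1..D})" by (rule prob_space_uniform_range[OF D])
    fix w
    have "(\<integral>\<^sup>+c. of_bool ((w(i := c)) i = h (w(i := c))) \<partial>uniform_count_measure {1..D}) =
       emeasure (uniform_count_measure {1..D}) {c \<in> {1..D}. c = h w}"
      by (subst nn_integral_of_bool) (auto simp: h space_uniform_count_measure sets_uniform_count_measure pred_def)
    also have "\<dots> = ennreal (real (card {c \<in> {1..D}. c = h w}) / real D)"
      by (subst emeasure_uniform_count_measure) auto
    also have "\<dots> \<le> ennreal (1 / real D)"
    proof -
      have "card {c \<in> {1..D}. c = h w} \<le> card {h w}" by (rule card_mono) auto
      then show ?thesis by (intro ennreal_leI divide_right_mono) auto
    qed
    finally show "(\<integral>\<^sup>+c. of_bool ((w(i := c)) i = h (w(i := c))) \<partial>uniform_count_measure {1..D}) \<le> ennreal (1 / real D)" .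
  qed
  finally show ?thesis .
qed

text \<open>1/5 and 9/10 are the extreme values of 1/10 + \<sigma> and 1 - \<tau>, so that the event
  depends on neither \<sigma> nor \<tau> and can be integrated over \<beta> alone.\<close>

definition overfull :: "nat \<Rightarrow> nat \<Rightarrow> (nat \<Rightarrow> nat) \<Rightarrow> (nat \<Rightarrow> real) \<Rightarrow> bool" where
  "overfull n m \<beta> x \<longleftrightarrow> (\<exists>b\<in>{1..m}. 9/10 < (\<Sum>i\<in>{i \<in> {1..n}. \<beta> i = b \<and> x i \<le> 1/5}. x i))"

text \<open>Second moment method: items of size at most \<open>1/5\<close> can only overfill a bucket in colliding pairs.\<close>

lemma overfull_pairs:
  assumes x: "\<And>i. i \<in> {1..n} \<Longrightarrow> 0 \<le> x i" and o: "overfull n m \<beta> x"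
  shows "1 \<le> (\<Sum>i=1..n. \<Sum>i'\<in>{1..n}-{i}. 2 * x i * x i' * of_bool (\<beta> i = \<beta> i'))"
proof -
  obtain b where b: "9/10 < (\<Sum>i\<in>{i \<in> {1..n}. \<beta> i = b \<and> x i \<le> 1/5}. x i)" using o by (auto simp: overfull_def)
  define B where "B = {i \<in> {1..n}. \<beta> i = b \<and> x i \<le> 1/5}"
  define s where "s = (\<Sum>i\<in>B. x i)"
  have fB: "finite B" "B \<subseteq> {1..n}" by (auto simp: B_def)
  have s: "9/10 < s" using b by (simp add: s_def B_def)
  have "s * s = (\<Sum>i\<in>B. x i * s)" by (simp add: s_def sum_distrib_right)
  also have "\<dots> = (\<Sum>i\<in>B. x i * x i + (\<Sum>i'\<in>B-{i}. x i * x i'))"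
    unfolding s_def using fB by (intro sum.cong) (simp_all add: sum.remove distrib_left sum_distrib_left)
  also have "\<dots> = (\<Sum>i\<in>B. x i * x i) + (\<Sum>i\<in>B. \<Sum>i'\<in>B-{i}. x i * x i')" by (rule sum.distrib)
  also have "(\<Sum>i\<in>B. x i * x i) \<le> (\<Sum>i\<in>B. x i * (1/5))"
    using x by (intro sum_mono mult_left_mono) (auto simp: B_def)
  also have "\<dots> = s / 5" by (simp add: s_def sum_distrib_right[symmetric] sum_divide_distrib)
  finally have "s * s - s / 5 \<le> (\<Sum>i\<in>B. \<Sum>i'\<in>B-{i}. x i * x i')" by simp
  \<comment> \<open>The squares of items of size at most 1/5 cannot account for s^2: what the pairs
    must supply is s (s - 1/5) \<ge> 9/10 * 7/10.\<close>
  moreover have "1/2 \<le> s * s - s / 5"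
  proof -
    have "9/10 * (7/10) \<le> s * (s - 1/5)" using s by (intro mult_mono) auto
    then show ?thesis by (simp add: algebra_simps)
  qed
  ultimately have "1 \<le> 2 * (\<Sum>i\<in>B. \<Sum>i'\<in>B-{i}. x i * x i')" by simp
  also have "\<dots> = (\<Sum>i\<in>B. \<Sum>i'\<in>B-{i}. 2 * x i * x i' * of_bool (\<beta> i = \<beta> i'))"
    unfolding sum_distrib_left by (intro sum.cong) (auto simp: B_def)
  also have "\<dots> \<le> (\<Sum>i=1..n. \<Sum>i'\<in>B-{i}. 2 * x i * x i' * of_bool (\<beta> i = \<beta> i'))"
    using fB x by (intro sum_mono2 sum_nonneg mult_nonneg_nonneg) auto
  also have "\<dots> \<le> (\<Sum>i=1..n. \<Sum>i'\<in>{1..n}-{i}. 2 * x i * x i' * of_bool (\<beta> i = \<beta> i'))"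
    using fB x by (intro sum_mono sum_mono2 mult_nonneg_nonneg) auto
  finally show ?thesis .
qed

text \<open>First moment of the sum over pairs: two given indices share a bucket with probability at
  most 1 / m, and the products x i * x i' sum to at most k^2.\<close>

lemma overfull_probability:
  assumes x: "x \<in> Delta n k" and m: "1 \<le> m"
  shows "(\<integral>\<^sup>+\<beta>. of_bool (overfull n m \<beta> x) \<partial>uniform_map n m) \<le> ennreal (2 * real k ^ 2 / real m)"
proof -
  have x0: "0 \<le> x i" if "i \<in> {1..n}" for i using Delta_bounds[OF x that] by simp
  have "(\<integral>\<^sup>+\<beta>. of_bool (overfull n m \<beta> x) \<partial>uniform_map n m) \<le>
    (\<integral>\<^sup>+\<beta>. (\<Sum>i=1..n. \<Sum>i'\<in>{1..n}-{i}. ennreal (2 * x i * x i') * of_bool (\<beta> i = \<beta> i')) \<partial>uniform_map n m)"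
  proof (rule nn_integral_mono)
    fix \<beta> :: "nat \<Rightarrow> nat"
    have "(\<Sum>i=1..n. \<Sum>i'\<in>{1..n}-{i}. ennreal (2 * x i * x i') * of_bool (\<beta> i = \<beta> i')) =
      (\<Sum>i=1..n. \<Sum>i'\<in>{1..n}-{i}. ennreal (2 * x i * x i' * of_bool (\<beta> i = \<beta> i')))"
      by (intro sum.cong) (auto simp: of_bool_def)
    also have "\<dots> = (\<Sum>i=1..n. ennreal (\<Sum>i'\<in>{1..n}-{i}. 2 * x i * x i' * of_bool (\<beta> i = \<beta> i')))"
      using x0 by (intro sum.cong sum_ennreal mult_nonneg_nonneg) auto
    also have "\<dots> = ennreal (\<Sum>i=1..n. \<Sum>i'\<in>{1..n}-{i}. 2 * x i * x i' * of_bool (\<beta> i = \<beta> i'))"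
      using x0 by (intro sum_ennreal sum_nonneg mult_nonneg_nonneg) auto
    finally show "of_bool (overfull n m \<beta> x) \<le> (\<Sum>i=1..n. \<Sum>i'\<in>{1..n}-{i}. ennreal (2 * x i * x i') * of_bool (\<beta> i = \<beta> i'))"
      using overfull_pairs[of n x m \<beta>, OF x0] by (auto simp: of_bool_def)
  qed
  also have "\<dots> = (\<Sum>i=1..n. \<Sum>i'\<in>{1..n}-{i}. ennreal (2 * x i * x i') * (\<integral>\<^sup>+\<beta>. of_bool (\<beta> i = \<beta> i') \<partial>uniform_map n m))"
    by (simp only: nn_integral_sum[OF measurable_uniform_map] nn_integral_cmult[OF measurable_uniform_map])
  also have "\<dots> \<le> (\<Sum>i=1..n. \<Sum>i'\<in>{1..n}-{i}. ennreal (2 * x i * x i') * ennreal (1 / real m))"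
    using m by (intro sum_mono mult_left_mono uniform_map_value) auto
  also have "\<dots> = (\<Sum>i=1..n. \<Sum>i'\<in>{1..n}-{i}. ennreal (2 * x i * x i' / real m))"
    using x0 by (intro sum.cong refl) (simp add: ennreal_mult[symmetric])
  also have "\<dots> = (\<Sum>i=1..n. ennreal (\<Sum>i'\<in>{1..n}-{i}. 2 * x i * x i' / real m))"
    using x0 by (intro sum.cong sum_ennreal) auto
  also have "\<dots> = ennreal (\<Sum>i=1..n. \<Sum>i'\<in>{1..n}-{i}. 2 * x i * x i' / real m)"
    using x0 by (intro sum_ennreal sum_nonneg) auto
  also have "\<dots> \<le> ennreal (2 * real k ^ 2 / real m)"
  proof (rule ennreal_leI)
    have "(\<Sum>i=1..n. \<Sum>i'\<in>{1..n}-{i}. 2 * x i * x i' / real m) \<le> (\<Sum>i=1..n. \<Sum>i'=1..n. 2 * x i * x i' / real m)"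
      using x0 by (intro sum_mono sum_mono2) auto
    also have "\<dots> = 2 * (\<Sum>i=1..n. x i)\<^sup>2 / real m"
    proof -
      have "(\<Sum>i=1..n. \<Sum>i'=1..n. 2 * x i * x i' / real m) = (\<Sum>i=1..n. \<Sum>i'=1..n. 2 / real m * (x i * x i'))"
        by (intro sum.cong) simp_all
      also have "\<dots> = 2 / real m * ((\<Sum>i=1..n. x i) * (\<Sum>i=1..n. x i))"
        by (subst sum_product) (simp only: sum_distrib_left)
      finally show ?thesis by (simp add: power2_eq_square)
    qed
    also have "\<dots> \<le> 2 * real k ^ 2 / real m"
      using sum_Delta[OF x] x0 by (intro divide_right_mono mult_left_mono power_mono sum_nonneg) auto
    finally show "(\<Sum>i=1..n. \<Sum>i'\<in>{1..n}-{i}. 2 * x i * x i' / real m) \<le> 2 * real k ^ 2 / real m" .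
  qed
  finally show ?thesis .
qed

text \<open>Union bound over ordered pairs. For the mixed pairs R is fixed first, so that C has to
  hit a given position.\<close>

lemma collision_probability:
  assumes L: "L \<subseteq> {1..n}" and d: "1 \<le> d"
  shows "(\<integral>\<^sup>+R. \<integral>\<^sup>+C. of_bool (collision m L R C) \<partial>uniform_map n d \<partial>uniform_map m d) \<le>
    ennreal ((real (card L) ^ 2 + real m ^ 2 + real (card L) * real m) / real d)"
proof -
  have fL: "finite L" using L finite_subset by blast
  let ?cc = "\<lambda>C. \<Sum>i\<in>L. \<Sum>i'\<in>L-{i}. of_bool (C i = C i') :: ennreal"
  let ?rr = "\<lambda>R. \<Sum>b=1..m. \<Sum>b'\<in>{1..m}-{b}. of_bool (R b = R b') :: ennreal"
  let ?cr = "\<lambda>R C. \<Sum>i\<in>L. \<Sum>b=1..m. of_bool (C i = R b) :: ennreal"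
  have pair: "(1::ennreal) \<le> (\<Sum>i\<in>I. \<Sum>j\<in>J i. of_bool (P i j))"
    if "finite I" "\<And>i. finite (J i)" "i \<in> I" "j \<in> J i" "P i j" for I :: "nat set" and J :: "nat \<Rightarrow> nat set" and P i j
  proof -
    have "(1::ennreal) = of_bool (P i j)" using that by simp
    also have "\<dots> \<le> (\<Sum>j\<in>J i. of_bool (P i j))" using that by (intro member_le_sum) auto
    also have "\<dots> \<le> (\<Sum>i\<in>I. \<Sum>j\<in>J i. of_bool (P i j))"
      using that by (intro member_le_sum[of i I "\<lambda>i. \<Sum>j\<in>J i. of_bool (P i j)"]) auto
    finally show ?thesis .
  qed
  have "of_bool (collision m L R C) \<le> ?cc C + ?rr R + ?cr R C" for R C
  proof (cases "collision m L R C")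
    case True
    then consider i i' where "i \<in> L" "i' \<in> L - {i}" "C i = C i'" | b b' where "b \<in> {1..m}" "b' \<in> {1..m} - {b}" "R b = R b'"
      | i b where "i \<in> L" "b \<in> {1..m}" "C i = R b" unfolding collision_def by blast
    then show ?thesis
    proof cases
      case 1 then have "1 \<le> ?cc C" using fL by (intro pair[of L "\<lambda>i. L - {i}" i i' "\<lambda>i i'. C i = C i'"]) auto
      then show ?thesis using True by (simp add: add_increasing2)
    next
      case 2 then have "1 \<le> ?rr R" by (intro pair[of "{1..m}" "\<lambda>b. {1..m} - {b}" b b' "\<lambda>b b'. R b = R b'"]) auto
      then show ?thesis using True by (simp add: add_increasing2 add_increasing)
    next
      case 3 then have "1 \<le> ?cr R C" using fL by (intro pair[of L "\<lambda>_. {1..m}" i b "\<lambda>i b. C i = R b"]) auto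
      then show ?thesis using True by (simp add: add_increasing)
    qed
  qed simp
  then have "(\<integral>\<^sup>+R. \<integral>\<^sup>+C. of_bool (collision m L R C) \<partial>uniform_map n d \<partial>uniform_map m d) \<le>
    (\<integral>\<^sup>+R. \<integral>\<^sup>+C. ?cc C + ?rr R + ?cr R C \<partial>uniform_map n d \<partial>uniform_map m d)"
    by (intro nn_integral_mono)
  also have "\<dots> = (\<integral>\<^sup>+R. (\<integral>\<^sup>+C. ?cc C \<partial>uniform_map n d) + ?rr R + (\<integral>\<^sup>+C. ?cr R C \<partial>uniform_map n d) \<partial>uniform_map m d)"
    by (intro nn_integral_cong)
      (simp only: nn_integral_add[OF measurable_uniform_map measurable_uniform_map] nn_integral_const_prob[OF prob_space_uniform_map[OF d]])
  also have "\<dots> \<le> (\<integral>\<^sup>+R. ennreal (real (card L) ^ 2 / real d) + ?rr R + ennreal (real (card L) * real m / real d) \<partial>uniform_map m d)"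
  proof (intro nn_integral_mono add_mono order_refl)
    have "(\<integral>\<^sup>+C. ?cc C \<partial>uniform_map n d) = (\<Sum>i\<in>L. \<Sum>i'\<in>L-{i}. \<integral>\<^sup>+C. of_bool (C i = C i') \<partial>uniform_map n d)"
      by (simp only: nn_integral_sum[OF measurable_uniform_map])
    also have "\<dots> \<le> (\<Sum>i\<in>L. \<Sum>i'\<in>L-{i}. ennreal (1 / real d))"
      using L by (intro sum_mono uniform_map_value d) auto
    also have "\<dots> \<le> (\<Sum>i\<in>L. \<Sum>i'\<in>L. ennreal (1 / real d))" using fL by (intro sum_mono sum_mono2) auto
    also have "\<dots> = ennreal (real (card L) ^ 2 / real d)"
      by (simp add: ennreal_of_nat_eq_real_of_nat ennreal_mult[symmetric] power2_eq_square mult.assoc)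
    finally show "(\<integral>\<^sup>+C. ?cc C \<partial>uniform_map n d) \<le> ennreal (real (card L) ^ 2 / real d)" .
    fix R
    have "(\<integral>\<^sup>+C. ?cr R C \<partial>uniform_map n d) = (\<Sum>i\<in>L. \<Sum>b=1..m. \<integral>\<^sup>+C. of_bool (C i = R b) \<partial>uniform_map n d)"
      by (simp only: nn_integral_sum[OF measurable_uniform_map])
    also have "\<dots> \<le> (\<Sum>i\<in>L. \<Sum>b=1..m. ennreal (1 / real d))"
      using L by (intro sum_mono uniform_map_value d) auto
    also have "\<dots> = ennreal (real (card L) * real m / real d)"
      by (simp add: ennreal_of_nat_eq_real_of_nat ennreal_mult[symmetric] mult.assoc)
    finally show "(\<integral>\<^sup>+C. ?cr R C \<partial>uniform_map n d) \<le> ennreal (real (card L) * real m / real d)" .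
  qed
  also have "\<dots> = ennreal (real (card L) ^ 2 / real d) + (\<integral>\<^sup>+R. ?rr R \<partial>uniform_map m d) + ennreal (real (card L) * real m / real d)"
    by (simp only: nn_integral_add[OF measurable_uniform_map measurable_uniform_map] nn_integral_const_prob[OF prob_space_uniform_map[OF d]])
  also have "\<dots> \<le> ennreal (real (card L) ^ 2 / real d) + ennreal (real m ^ 2 / real d) + ennreal (real (card L) * real m / real d)"
  proof (intro add_mono order_refl)
    have "(\<integral>\<^sup>+R. ?rr R \<partial>uniform_map m d) = (\<Sum>b=1..m. \<Sum>b'\<in>{1..m}-{b}. \<integral>\<^sup>+R. of_bool (R b = R b') \<partial>uniform_map m d)"
      by (simp only: nn_integral_sum[OF measurable_uniform_map])
    also have "\<dots> \<le> (\<Sum>b=1..m. \<Sum>b'\<in>{1..m}-{b}. ennreal (1 / real d))"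
      by (intro sum_mono uniform_map_value d) auto
    also have "\<dots> \<le> (\<Sum>b=1..m. \<Sum>b'=1..m. ennreal (1 / real d))" by (intro sum_mono sum_mono2) auto
    also have "\<dots> = ennreal (real m ^ 2 / real d)"
      by (simp add: ennreal_of_nat_eq_real_of_nat ennreal_mult[symmetric] power2_eq_square mult.assoc)
    finally show "(\<integral>\<^sup>+R. ?rr R \<partial>uniform_map m d) \<le> ennreal (real m ^ 2 / real d)" .
  qed
  also have "\<dots> = ennreal ((real (card L) ^ 2 + real m ^ 2 + real (card L) * real m) / real d)"
    by (simp add: ennreal_plus[symmetric] add_divide_distrib del: ennreal_plus)
  finally show ?thesis .
qed

abbreviation unif10 :: "real measure" where "unif10 \<equiv> uniform_measure lborel {0..1/10}"

lemma prob_space_unif10: "prob_space unif10"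
  by (rule prob_space_uniform_measure) auto

lemma AE_unif10_bounds: "AE s in unif10. 0 \<le> s \<and> s \<le> 1/10"
  by (rule AE_uniform_measureI) auto

text \<open>The density on an interval of length 1/10 is 10, the source of the factors 10
  below.\<close>

lemma unif10_interval:
  assumes "a \<le> b" "J \<in> {{a..<b}, {a<..b}}"
  shows "(\<integral>\<^sup>+s. of_bool (s \<in> J) \<partial>unif10) \<le> ennreal (10 * (b - a))"
proof -
  have J: "J \<in> sets borel" "emeasure lborel J = ennreal (b - a)" using assms by auto
  have "(\<integral>\<^sup>+s. of_bool (s \<in> J) \<partial>unif10) = emeasure unif10 J"
    using J by (subst nn_integral_of_bool) (auto simp: pred_def)
  also have "\<dots> = emeasure lborel ({0..1/10} \<inter> J) / ennreal (1/10)"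
    using J by (subst emeasure_uniform_measure) auto
  also have "\<dots> \<le> ennreal (b - a) / ennreal (1/10)"
    unfolding J(2)[symmetric] by (intro divide_right_mono_ennreal emeasure_mono) (use J in auto)
  also have "\<dots> = ennreal (10 * (b - a))" using assms by (simp add: divide_ennreal)
  finally show ?thesis .
qed

section \<open>Cost of a step in terms of the coins\<close>

context coordinate_step
begin

text \<open>This bounds the fallback events of both inputs for all values of \<open>\<sigma>\<close> and \<open>\<tau>\<close> at once.\<close>

definition "bad_coins \<longleftrightarrow> collision m {i \<in> {1..n}. 1/10 < y i} R C \<or> overfull n m \<beta> x \<or> overfull n m \<beta> y"

text \<open>The \<tau> for which the bucket of u is over the limit in y but not in x, when u stays
  small: the sum s in x satisfies s \<le> 1 - \<tau> < s + (v - x u).\<close>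

definition "window = {1 - bs x (\<beta> u) - (v - x u)<..1 - bs x (\<beta> u)}"

lemma crossing_iff: "crossing \<longleftrightarrow> \<sigma> \<in> {x u - 1/10..<v - 1/10}"
  by (auto simp: crossing_def)

lemma collision_mono: "L \<subseteq> L' \<Longrightarrow> collision m L R C \<Longrightarrow> collision m L' R C"
  unfolding collision_def by blast

text \<open>Items in a bucket are at most 1/10 + \<sigma> \<le> 1/5, and the limit 1 - \<tau> is at
  least 9/10.\<close>

lemma overfull_of_bucket_sum:
  assumes z: "z \<in> Delta n k" and b: "b \<in> {1..m}" "1 - \<tau> < bs z b" and "\<sigma> \<le> 1/10" "\<tau> \<le> 1/10"
  shows "overfull n m \<beta> z"
proof -
  have "bs z b \<le> (\<Sum>i\<in>{i \<in> {1..n}. \<beta> i = b \<and> z i \<le> 1/5}. z i)"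
    unfolding bucket_sum_def
    by (rule sum_mono2) (use assms Delta_bounds[OF z] in \<open>auto simp: small_bucket_def small_def\<close>)
  then show ?thesis using assms by (auto simp: overfull_def intro!: bexI[of _ b])
qed

lemma bad_coins:
  assumes s: "\<sigma> \<le> 1/10" "\<tau> \<le> 1/10" and "fb x \<or> fb y" shows bad_coins
proof -
  have "large n \<sigma> x \<subseteq> {i \<in> {1..n}. 1/10 < y i}" "large n \<sigma> y \<subseteq> {i \<in> {1..n}. 1/10 < y i}"
    using \<sigma> v by (auto simp: large_def y_def)
  then show ?thesis using assms(3) collision_mono overfull_of_bucket_sum[OF x _ _ s] overfull_of_bucket_sum[OF y _ _ s]
    unfolding falls_back_def bad_coins_def by blast
qed

text \<open>Without a crossing both inputs have the same large items, so their collisions agree, and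
  only the bucket of u can decide differently.\<close>

lemma fallback_window:
  assumes nc: "\<not> crossing" and ne: "fb x \<noteq> fb y" shows "\<tau> \<in> window"
proof -
  have L: "large n \<sigma> y = large n \<sigma> x" by (rule large_same[OF nc])
  have neq: "bs y (\<beta> u) \<noteq> bs x (\<beta> u)"
  proof
    assume "bs y (\<beta> u) = bs x (\<beta> u)"
    then have "bs y b = bs x b" for b using bs_other by (cases "b = \<beta> u") auto
    then show False using ne L by (simp add: falls_back_def)
  qed
  then have "\<not> 1/10 + \<sigma> < x u" using bw_large by (auto simp: bucket_sum_eq)
  then have "v \<le> 1/10 + \<sigma>" using nc by (auto simp: crossing_def)
  then have bs: "bs y (\<beta> u) = bs x (\<beta> u) + (v - x u)" by (rule bw_small_step)
  have le: "bs x b \<le> bs y b" for b using bs_other[of b] bs v by (cases "b = \<beta> u") auto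
  \<comment> \<open>The step can only raise bucket sums, so it is y that falls back.\<close>
  have "\<not> fb x \<and> fb y" using ne le L unfolding falls_back_def by (metis order_less_le_trans)
  then obtain b where b: "b \<in> {1..m}" "1 - \<tau> < bs y b" "\<not> 1 - \<tau> < bs x b"
    using L unfolding falls_back_def by metis
  then have "b = \<beta> u" using bs_other[of b] by auto
  then show ?thesis using b bs by (auto simp: window_def)
qed

text \<open>A sum of products of indicators, made so that \<tau>, \<sigma> and the remaining coins
  can be integrated out in turn. If only one input falls back, the cost is up to 2 k, but this takes
  bad coins together with \<sigma> or \<tau> in a window of length v - x u.\<close>

lemma step_bound:
  assumes s: "\<sigma> \<le> 1/10" "\<tau> \<le> 1/10" and \<alpha>: "0 \<le> \<alpha>"
  shows "(\<integral>\<^sup>+f. \<integral>\<^sup>+E. \<integral>\<^sup>+\<theta>. set_dist (out f E \<theta> x) (out f E \<theta> y) \<partial>tree_space t \<partial>clock_space n \<partial>A)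
    \<le> (ennreal (\<alpha> * (v - x u)) * of_bool bad_coins + ennreal ((tree_stretch t + 2) * (v - x u))
       + (ennreal (2 * real k) * of_bool bad_coins + ennreal (2 * tree_stretch t + 4)) * of_bool (\<sigma> \<in> {x u - 1/10..<v - 1/10}))
      + ennreal (2 * real k) * of_bool bad_coins * of_bool (\<tau> \<in> window)" (is "?I \<le> _")
proof -
  consider "fb x" "fb y" | "\<not> fb x" "\<not> fb y" "crossing" | "\<not> fb x" "\<not> fb y" "\<not> crossing" | "fb x \<noteq> fb y" "crossing" | "fb x \<noteq> fb y" "\<not> crossing"
    by blast
  then show ?thesis
  proof cases
    case 1
    then have "?I \<le> ennreal (\<alpha> * (v - x u)) * of_bool bad_coins" using diff_fallback bad_coins[OF s] by simp
    then show ?thesis by (simp add: add_increasing2)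
  next
    case 2
    then have "?I \<le> ennreal (2 * tree_stretch t + 4) * of_bool (\<sigma> \<in> {x u - 1/10..<v - 1/10})"
      using diff_crossing crossing_iff by simp
    then show ?thesis by (simp add: add_increasing2 add_increasing distrib_right)
  next
    case 3
    then have "?I \<le> ennreal ((tree_stretch t + 2) * (v - x u))" using diff_not_crossing by simp
    then show ?thesis by (simp add: add_increasing2 add_increasing)
  next
    case 4
    then have "?I \<le> ennreal (2 * real k) * of_bool bad_coins * of_bool (\<sigma> \<in> {x u - 1/10..<v - 1/10})"
      using diff_le_2k[OF x y] bad_coins[OF s] crossing_iff by auto
    then show ?thesis by (simp add: add_increasing2 add_increasing distrib_right)
  next
    case 5
    then have "?I \<le> ennreal (2 * real k) * of_bool bad_coins * of_bool (\<tau> \<in> window)"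
      using diff_le_2k[OF x y] bad_coins[OF s] fallback_window by auto
    then show ?thesis by (simp add: add_increasing)
  qed
qed

end

lemma nn_integral_affine_le:
  fixes s :: "'a \<Rightarrow> ennreal"
  assumes "prob_space M" "s \<in> borel_measurable M" "(\<integral>\<^sup>+w. s w \<partial>M) \<le> r"
  shows "(\<integral>\<^sup>+w. p + q * s w \<partial>M) \<le> p + q * r"
proof -
  have "(\<integral>\<^sup>+w. p + q * s w \<partial>M) = p + q * (\<integral>\<^sup>+w. s w \<partial>M)"
    using assms by (simp add: nn_integral_add nn_integral_cmult prob_space.emeasure_space_1)
  also have "\<dots> \<le> p + q * r" by (intro add_left_mono mult_left_mono assms) simp
  finally show ?thesis .
qed

lemma nn_integral_uniform_affine:
  assumes "1 \<le> D"
  shows "(\<integral>\<^sup>+w. p + q * s w \<partial>uniform_map l D) = p + q * (\<integral>\<^sup>+w. s w \<partial>uniform_map l D)"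
  using prob_space.emeasure_space_1[OF prob_space_uniform_map[OF assms]]
  by (simp add: nn_integral_add nn_integral_cmult measurable_uniform_map)

section \<open>Stretch of the composed algorithm\<close>

text \<open>m enters through a lower bound, since the number of buckets is rounded up.\<close>

locale composition =
  fixes n k m d :: nat and t :: btree and A :: sampler and \<alpha> :: real
  assumes A: "has_stretch n k A \<alpha>" and \<alpha>: "1 \<le> \<alpha>" and t: "pivotal_tree d t"
    and m: "32 * real k ^ 5 * \<alpha> ^ 5 \<le> real m" and d: "d = m ^ 3" and k: "1 \<le> k"
begin

lemma m_bounds: "32 * real k \<le> real m" "1 \<le> m" "1 \<le> d" "0 < real m"
proof -
  have "real k ^ 1 * 1 \<le> real k ^ 5 * \<alpha> ^ 5"
    using k \<alpha> by (intro mult_mono power_increasing one_le_power) auto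
  then show 1: "32 * real k \<le> real m" using m by simp
  then show "1 \<le> m" using k by (cases m) auto
  then show "1 \<le> d" "0 < real m" by (simp_all add: d)
qed

abbreviation "coins \<equiv> uniform_map m d \<Otimes>\<^sub>M uniform_map n d \<Otimes>\<^sub>M uniform_map n m \<Otimes>\<^sub>M unif10 \<Otimes>\<^sub>M unif10"
abbreviation "full \<equiv> A \<Otimes>\<^sub>M clock_space n \<Otimes>\<^sub>M tree_space t \<Otimes>\<^sub>M coins"

lemmas prob_spaces = has_stretch_prob_space[OF A] prob_space_clock_space prob_space_tree_space
  prob_space_uniform_map[OF m_bounds(2)] prob_space_uniform_map[OF m_bounds(3)] prob_space_unif10

lemma nn_integral_full:
  assumes F: "F \<in> borel_measurable full"
  shows "(\<integral>\<^sup>+w. F w \<partial>full) = (\<integral>\<^sup>+R. \<integral>\<^sup>+C. \<integral>\<^sup>+\<beta>. \<integral>\<^sup>+\<sigma>. \<integral>\<^sup>+\<tau>. \<integral>\<^sup>+f. \<integral>\<^sup>+E. \<integral>\<^sup>+\<theta>.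
     F (f, E, \<theta>, R, C, \<beta>, \<sigma>, \<tau>) \<partial>tree_space t \<partial>clock_space n \<partial>A \<partial>unif10 \<partial>unif10 \<partial>uniform_map n m \<partial>uniform_map n d \<partial>uniform_map m d)"
proof -
  have p: "prob_space coins" by (intro prob_space_pair prob_spaces)
  note r = nn_integral_rotate4[OF prob_spaces(1,2,3) p F]
  show ?thesis unfolding r(1) by (rule nn_integral_iterate5[OF prob_spaces(5,5,4,6,6) r(2)])
qed

text \<open>Reduces an expectation over all randomness to fixed coins. The ranges demanded by
  \<open>fixed_coins\<close> hold everywhere for R, C, \<beta>, but only almost surely for \<sigma>
  and \<tau>.\<close>

lemma nn_integral_full_mono:
  assumes F: "F \<in> borel_measurable full"
    and le: "\<And>R C \<beta> \<sigma> \<tau>. fixed_coins n k m d R C \<beta> \<sigma> \<tau> t A \<alpha> \<Longrightarrow> \<sigma> \<le> 1/10 \<Longrightarrow> \<tau> \<le> 1/10 \<Longrightarrow>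
      (\<integral>\<^sup>+f. \<integral>\<^sup>+E. \<integral>\<^sup>+\<theta>. F (f, E, \<theta>, R, C, \<beta>, \<sigma>, \<tau>) \<partial>tree_space t \<partial>clock_space n \<partial>A) \<le> G R C \<beta> \<sigma> \<tau>"
  shows "(\<integral>\<^sup>+w. F w \<partial>full) \<le> (\<integral>\<^sup>+R. \<integral>\<^sup>+C. \<integral>\<^sup>+\<beta>. \<integral>\<^sup>+\<sigma>. \<integral>\<^sup>+\<tau>. G R C \<beta> \<sigma> \<tau> \<partial>unif10 \<partial>unif10 \<partial>uniform_map n m \<partial>uniform_map n d \<partial>uniform_map m d)"
  unfolding nn_integral_full[OF F]
proof (rule nn_integral_mono, rule nn_integral_mono, rule nn_integral_mono)
  fix R C \<beta>
  assume R: "R \<in> space (uniform_map m d)" and C: "C \<in> space (uniform_map n d)" and \<beta>: "\<beta> \<in> space (uniform_map n m)"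
  show "(\<integral>\<^sup>+\<sigma>. \<integral>\<^sup>+\<tau>. \<integral>\<^sup>+f. \<integral>\<^sup>+E. \<integral>\<^sup>+\<theta>. F (f, E, \<theta>, R, C, \<beta>, \<sigma>, \<tau>) \<partial>tree_space t \<partial>clock_space n \<partial>A \<partial>unif10 \<partial>unif10) \<le>
      (\<integral>\<^sup>+\<sigma>. \<integral>\<^sup>+\<tau>. G R C \<beta> \<sigma> \<tau> \<partial>unif10 \<partial>unif10)"
  proof (rule nn_integral_mono_AE, rule eventually_mono[OF AE_unif10_bounds], rule nn_integral_mono_AE, rule eventually_mono[OF AE_unif10_bounds])
    fix \<sigma> \<tau> :: real assume "0 \<le> \<sigma> \<and> \<sigma> \<le> 1/10" "0 \<le> \<tau> \<and> \<tau> \<le> 1/10"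
    moreover from this have "fixed_coins n k m d R C \<beta> \<sigma> \<tau> t A \<alpha>"
      using R C \<beta> A t by (auto simp: fixed_coins_def space_uniform_map PiE_def Pi_def)
    ultimately show "(\<integral>\<^sup>+f. \<integral>\<^sup>+E. \<integral>\<^sup>+\<theta>. F (f, E, \<theta>, R, C, \<beta>, \<sigma>, \<tau>) \<partial>tree_space t \<partial>clock_space n \<partial>A) \<le> G R C \<beta> \<sigma> \<tau>"
      using le by blast
  qed
qed

fun alg_output :: "((nat \<Rightarrow> real) \<Rightarrow> nat set) \<times> (nat \<Rightarrow> real) \<times> (real \<times> (bool list \<Rightarrow> real)) \<times>
    (nat \<Rightarrow> nat) \<times> (nat \<Rightarrow> nat) \<times> (nat \<Rightarrow> nat) \<times> real \<times> real \<Rightarrow> (nat \<Rightarrow> real) \<Rightarrow> nat set" where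
  "alg_output (f, E, \<theta>, R, C, \<beta>, \<sigma>, \<tau>) x = composed_output n m d t f E \<theta> R C \<beta> \<sigma> \<tau> x"

lemma output_subset:
  assumes "x \<in> Delta n k" "w \<in> space full" shows "alg_output w x \<subseteq> {1..n}"
proof -
  obtain f E \<theta> R C \<beta> \<sigma> \<tau> where w: "w = (f, E, \<theta>, R, C, \<beta>, \<sigma>, \<tau>)" by (metis prod.exhaust)
  have "f \<in> space A" using assms(2) by (simp add: w space_pair_measure)
  from has_stretch_subset[OF A assms(1) this] show ?thesis
    by (simp only: w alg_output.simps composed_output_eq UN_least[OF decode_subset] split: if_split) simp
qed

lemma component_measurable:
  assumes "i \<in> {1..l}" "g \<in> full \<rightarrow>\<^sub>M uniform_map l D"
  shows "(\<lambda>w. g w i) \<in> full \<rightarrow>\<^sub>M count_space UNIV"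
proof -
  have "(\<lambda>w. w i) \<in> uniform_map l D \<rightarrow>\<^sub>M count_space UNIV"
    by (rule measurableI) (auto simp: sets_uniform_map space_uniform_map)
  from measurable_compose[OF assms(2) this] show ?thesis .
qed

lemma pred_output:
  assumes x: "x \<in> Delta n k" and i: "i \<in> {1..n}"
  shows "Measurable.pred full (\<lambda>w. i \<in> alg_output w x)"
proof -
  let ?f = "\<lambda>w. fst w" and ?E = "\<lambda>w. fst (snd w)" and ?\<theta> = "\<lambda>w. fst (snd (snd w))" and ?R = "\<lambda>w. fst (snd (snd (snd w)))"
    and ?C = "\<lambda>w. fst (snd (snd (snd (snd w))))" and ?\<beta> = "\<lambda>w. fst (snd (snd (snd (snd (snd w)))))"
    and ?\<sigma> = "\<lambda>w. fst (snd (snd (snd (snd (snd (snd w))))))" and ?\<tau> = "\<lambda>w. snd (snd (snd (snd (snd (snd (snd w))))))"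
  have eq: "full \<rightarrow>\<^sub>M unif10 = borel_measurable full" by (rule measurable_cong_sets) simp_all
  have "Measurable.pred full (\<lambda>w. i \<in> composed_output n m d t (?f w) (?E w) (?\<theta> w) (?R w) (?C w) (?\<beta> w) (?\<sigma> w) (?\<tau> w) x)"
  proof (rule pred_composed_output)
    show "Measurable.pred full (\<lambda>w. i \<in> fst w x)"
      by (rule measurable_compose[OF measurable_fst has_stretch_pred[OF A x]])
    show "(\<lambda>w. ?E w j) \<in> borel_measurable full" if "j \<in> {1..n}" for j
    proof (rule measurable_compose[OF _ clock_space_component[OF that]])
      show "?E \<in> full \<rightarrow>\<^sub>M clock_space n" by measurable
    qed
    show "?\<theta> \<in> full \<rightarrow>\<^sub>M tree_space t" by measurable
    show "(\<lambda>w. ?R w b) \<in> full \<rightarrow>\<^sub>M count_space UNIV" if "b \<in> {1..m}" for b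
      by (rule component_measurable[OF that, of _ d]) measurable
    show "(\<lambda>w. ?C w i) \<in> full \<rightarrow>\<^sub>M count_space UNIV" if "i \<in> {1..n}" for i
      by (rule component_measurable[OF that, of _ d]) measurable
    show "(\<lambda>w. ?\<beta> w i) \<in> full \<rightarrow>\<^sub>M count_space UNIV" if "i \<in> {1..n}" for i
      by (rule component_measurable[OF that, of _ m]) measurable
    have "?\<sigma> \<in> full \<rightarrow>\<^sub>M unif10" "?\<tau> \<in> full \<rightarrow>\<^sub>M unif10" by measurable
    then show "?\<sigma> \<in> borel_measurable full" "?\<tau> \<in> borel_measurable full" unfolding eq .
  qed (use pivotal_tree_leaves[OF t] i in auto)
  moreover have "alg_output w x = composed_output n m d t (?f w) (?E w) (?\<theta> w) (?R w) (?C w) (?\<beta> w) (?\<sigma> w) (?\<tau> w) x" for w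
    by (cases w, cases "snd (snd (snd (snd (snd (snd w)))))") simp
  ultimately show ?thesis by simp
qed

lemma measurable_card_diff:
  assumes "x \<in> Delta n k" "y \<in> Delta n k"
  shows "(\<lambda>w. set_dist (alg_output w x) (alg_output w y)) \<in> borel_measurable full"
  by (intro measurable_compose[OF _ measurable_ennreal] borel_measurable_card_sym_diff[where A="{1..n}"])
    (use assms output_subset pred_output in auto)

text \<open>The size condition is known for each admissible choice of coins. Integrating the
  indicator of its failure carries it over to the product space.\<close>

lemma output_AE_card:
  assumes x: "x \<in> Delta n k"
  shows "AE w in full. int (card (alg_output w x)) \<in> {\<lfloor>l1norm n x\<rfloor>, \<lceil>l1norm n x\<rceil>}"
proof -
  let ?P = "\<lambda>S :: nat set. int (card S) \<in> {\<lfloor>l1norm n x\<rfloor>, \<lceil>l1norm n x\<rceil>}"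
  have "(\<lambda>w. real (card (sym_diff (alg_output w x) {}))) \<in> borel_measurable full"
    by (rule borel_measurable_card_sym_diff[where A="{1..n}"]) (use x output_subset pred_output in auto)
  then have c: "(\<lambda>w. real (card (alg_output w x))) \<in> borel_measurable full" by simp
  have r: "(\<lambda>r::real. r = a \<or> r = b) \<in> borel \<rightarrow>\<^sub>M count_space UNIV" for a b by measurable
  have z: "int (card S) = z \<longleftrightarrow> real (card S) = real_of_int z" for S :: "nat set" and z by linarith
  have P: "Measurable.pred full (\<lambda>w. ?P (alg_output w x))"
    unfolding insert_iff empty_iff simp_thms z by (rule measurable_compose[OF c r])
  have m: "(\<lambda>w. of_bool (\<not> ?P (alg_output w x)) :: ennreal) \<in> borel_measurable full"
    by (rule measurable_compose[OF P]) simp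
  have "(\<integral>\<^sup>+w. of_bool (\<not> ?P (alg_output w x)) \<partial>full) \<le> (\<integral>\<^sup>+R. \<integral>\<^sup>+C. \<integral>\<^sup>+\<beta>. \<integral>\<^sup>+\<sigma>. \<integral>\<^sup>+\<tau>. 0 \<partial>unif10 \<partial>unif10 \<partial>uniform_map n m \<partial>uniform_map n d \<partial>uniform_map m d)"
  proof (rule nn_integral_full_mono[OF m])
    fix R C \<beta> \<sigma> \<tau> assume "fixed_coins n k m d R C \<beta> \<sigma> \<tau> t A \<alpha>"
    then interpret fixed_coins n k m d R C \<beta> \<sigma> \<tau> t A \<alpha> .
    show "(\<integral>\<^sup>+f. \<integral>\<^sup>+E. \<integral>\<^sup>+\<theta>. of_bool (\<not> ?P (alg_output (f, E, \<theta>, R, C, \<beta>, \<sigma>, \<tau>) x)) \<partial>tree_space t \<partial>clock_space n \<partial>A) \<le> 0"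
    proof (rule nn_integral_le_const_AE[OF prob_A], rule eventually_mono[OF AE_card_out[OF x]],
        rule nn_integral_le_const_AE[OF prob_space_clock_space], erule eventually_mono,
        rule nn_integral_le_const_AE[OF prob_space_tree_space], erule eventually_mono)
      fix f E \<theta> assume "?P (out f E \<theta> x)"
      then show "of_bool (\<not> ?P (alg_output (f, E, \<theta>, R, C, \<beta>, \<sigma>, \<tau>) x)) \<le> (0::ennreal)" by (simp only: alg_output.simps) simp
    qed
  qed
  then have "(\<integral>\<^sup>+w. of_bool (\<not> ?P (alg_output w x)) \<partial>full) = 0" by simp
  then have "AE w in full. of_bool (\<not> ?P (alg_output w x)) = (0::ennreal)"
    using nn_integral_0_iff_AE[OF m] by blast
  then show ?thesis by eventually_elim (simp only: of_bool_eq_0_iff not_not)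
qed

lemma output_marginal:
  assumes x: "x \<in> Delta n k" and i: "i \<in> {1..n}"
  shows "emeasure full {w \<in> space full. i \<in> alg_output w x} = ennreal (x i)"
proof -
  note P = pred_output[OF x i]
  have m: "(\<lambda>w. of_bool (i \<in> alg_output w x) :: ennreal) \<in> borel_measurable full"
    by (rule measurable_compose[OF P]) simp
  have "emeasure full {w \<in> space full. i \<in> alg_output w x} = (\<integral>\<^sup>+w. of_bool (i \<in> alg_output w x) \<partial>full)"
    by (rule nn_integral_of_bool[OF P, symmetric])
  also have "\<dots> = (\<integral>\<^sup>+R. \<integral>\<^sup>+C. \<integral>\<^sup>+\<beta>. \<integral>\<^sup>+\<sigma>. \<integral>\<^sup>+\<tau>. ennreal (x i) \<partial>unif10 \<partial>unif10 \<partial>uniform_map n m \<partial>uniform_map n d \<partial>uniform_map m d)"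
    unfolding nn_integral_full[OF m]
  proof (rule nn_integral_cong, rule nn_integral_cong, rule nn_integral_cong)
    fix R C \<beta>
    assume R: "R \<in> space (uniform_map m d)" and C: "C \<in> space (uniform_map n d)" and \<beta>: "\<beta> \<in> space (uniform_map n m)"
    show "(\<integral>\<^sup>+\<sigma>. \<integral>\<^sup>+\<tau>. \<integral>\<^sup>+f. \<integral>\<^sup>+E. \<integral>\<^sup>+\<theta>. of_bool (i \<in> alg_output (f, E, \<theta>, R, C, \<beta>, \<sigma>, \<tau>) x) \<partial>tree_space t \<partial>clock_space n \<partial>A \<partial>unif10 \<partial>unif10) =
        (\<integral>\<^sup>+\<sigma>. \<integral>\<^sup>+\<tau>. ennreal (x i) \<partial>unif10 \<partial>unif10)"
    proof (rule nn_integral_cong_AE, rule eventually_mono[OF AE_unif10_bounds], rule nn_integral_cong_AE, rule eventually_mono[OF AE_unif10_bounds])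
      fix \<sigma> \<tau> :: real assume "0 \<le> \<sigma> \<and> \<sigma> \<le> 1/10" "0 \<le> \<tau> \<and> \<tau> \<le> 1/10"
      then have "fixed_coins n k m d R C \<beta> \<sigma> \<tau> t A \<alpha>"
        using R C \<beta> A t by (auto simp: fixed_coins_def space_uniform_map PiE_def Pi_def)
      from fixed_coins.out_marginal[OF this x i]
      show "(\<integral>\<^sup>+f. \<integral>\<^sup>+E. \<integral>\<^sup>+\<theta>. of_bool (i \<in> alg_output (f, E, \<theta>, R, C, \<beta>, \<sigma>, \<tau>) x) \<partial>tree_space t \<partial>clock_space n \<partial>A) = ennreal (x i)"
        by simp
    qed
  qed
  also have "\<dots> = ennreal (x i)" by (simp only: nn_integral_const_prob prob_spaces)
  finally show ?thesis .
qed

end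

section \<open>Averaging over the coins\<close>

context composition
begin

text \<open>At most 10 k items exceed 1/10, and 10 k is below m.\<close>

lemma large_count:
  assumes y: "y \<in> Delta n k" shows "real (card {i \<in> {1..n}. 1/10 < y i}) \<le> real m"
proof -
  let ?L = "{i \<in> {1..n}. 1/10 < y i}"
  have "real (card ?L) / 10 = (\<Sum>i\<in>?L. 1/10)" by simp
  also have "\<dots> \<le> (\<Sum>i\<in>?L. y i)" by (rule sum_mono) auto
  also have "\<dots> \<le> (\<Sum>i=1..n. y i)" by (rule sum_mono2) (use Delta_bounds[OF y] in auto)
  also have "\<dots> \<le> real k" by (rule sum_Delta[OF y])
  finally show ?thesis using m_bounds(1) by simp
qed

text \<open>Two overfull events at 2 k^2 / m each, and a collision at no more than 3 m^2 / d = 3 /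
  m; this is where d = m^3 is used.\<close>

lemma bad_coins_probability:
  assumes x: "x \<in> Delta n k" and y: "y \<in> Delta n k"
  shows "(\<integral>\<^sup>+R. \<integral>\<^sup>+C. \<integral>\<^sup>+\<beta>. of_bool (collision m {i \<in> {1..n}. 1/10 < y i} R C \<or> overfull n m \<beta> x \<or> overfull n m \<beta> y)
      \<partial>uniform_map n m \<partial>uniform_map n d \<partial>uniform_map m d) \<le> ennreal (7 * real k ^ 2 / real m)"
proof -
  let ?L = "{i \<in> {1..n}. 1/10 < y i}" and ?o = "2 * real k ^ 2 / real m"
  let ?c = "\<lambda>R C. of_bool (collision m ?L R C) :: ennreal"
  have "(\<integral>\<^sup>+\<beta>. of_bool (collision m ?L R C \<or> overfull n m \<beta> x \<or> overfull n m \<beta> y) \<partial>uniform_map n m) \<le> ennreal (?o + ?o) + 1 * ?c R C" for R C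
  proof -
    have "(\<integral>\<^sup>+\<beta>. of_bool (collision m ?L R C \<or> overfull n m \<beta> x \<or> overfull n m \<beta> y) \<partial>uniform_map n m) \<le>
      (\<integral>\<^sup>+\<beta>. (of_bool (overfull n m \<beta> x) + of_bool (overfull n m \<beta> y)) + ?c R C \<partial>uniform_map n m)"
      by (intro nn_integral_mono) (auto simp: of_bool_def)
    also have "\<dots> = ((\<integral>\<^sup>+\<beta>. of_bool (overfull n m \<beta> x) \<partial>uniform_map n m) + (\<integral>\<^sup>+\<beta>. of_bool (overfull n m \<beta> y) \<partial>uniform_map n m)) + ?c R C"
      by (simp only: nn_integral_add[OF measurable_uniform_map measurable_uniform_map] nn_integral_const_prob[OF prob_spaces(4)])
    also have "\<dots> \<le> (ennreal ?o + ennreal ?o) + ?c R C"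
      by (intro add_mono overfull_probability x y m_bounds order_refl)
    also have "ennreal ?o + ennreal ?o = ennreal (?o + ?o)" by (rule ennreal_plus[symmetric]) auto
    finally show ?thesis by simp
  qed
  then have "(\<integral>\<^sup>+R. \<integral>\<^sup>+C. \<integral>\<^sup>+\<beta>. of_bool (collision m ?L R C \<or> overfull n m \<beta> x \<or> overfull n m \<beta> y)
      \<partial>uniform_map n m \<partial>uniform_map n d \<partial>uniform_map m d) \<le>
    (\<integral>\<^sup>+R. \<integral>\<^sup>+C. ennreal (?o + ?o) + 1 * ?c R C \<partial>uniform_map n d \<partial>uniform_map m d)"
    by (intro nn_integral_mono)
  also have "\<dots> = ennreal (?o + ?o) + 1 * (\<integral>\<^sup>+R. \<integral>\<^sup>+C. ?c R C \<partial>uniform_map n d \<partial>uniform_map m d)"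
    by (simp only: nn_integral_uniform_affine[OF m_bounds(3)])
  also have "\<dots> \<le> ennreal (?o + ?o) + 1 * ennreal ((real (card ?L) ^ 2 + real m ^ 2 + real (card ?L) * real m) / real d)"
    by (intro add_left_mono mult_left_mono collision_probability m_bounds) auto
  also have "\<dots> \<le> ennreal (?o + ?o) + ennreal (3 / real m)"
  proof -
    have l: "real (card ?L) \<le> real m" by (rule large_count[OF y])
    have "real (card ?L) ^ 2 + real m ^ 2 + real (card ?L) * real m \<le> real m ^ 2 + real m ^ 2 + real m * real m"
      using l by (intro add_mono power_mono mult_right_mono) auto
    then have "(real (card ?L) ^ 2 + real m ^ 2 + real (card ?L) * real m) / real d \<le> (3 * real m ^ 2) / real d"
      by (intro divide_right_mono) (auto simp: power2_eq_square)
    also have "\<dots> = 3 / real m" using m_bounds(4) by (simp add: d power2_eq_square power3_eq_cube)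
    finally show ?thesis by (simp add: add_left_mono ennreal_leI)
  qed
  also have "\<dots> = ennreal ((?o + ?o) + 3 / real m)" by (rule ennreal_plus[symmetric]) auto
  also have "\<dots> \<le> ennreal (7 * real k ^ 2 / real m)"
  proof (rule ennreal_leI)
    have "1 \<le> real k ^ 2" using k by simp
    then have "(4 * real k ^ 2 + 3) / real m \<le> 7 * real k ^ 2 / real m" by (intro divide_right_mono) auto
    then show "(?o + ?o) + 3 / real m \<le> 7 * real k ^ 2 / real m" by (simp add: add_divide_distrib)
  qed
  finally show ?thesis .
qed

text \<open>\<alpha> is the cost when both inputs fall back, and 40 k = 2 * 2 k * 10 covers the two
  windows in which only one does. As 41 * 7 = 287 is below 9 * 32, the factor 32 in m yields
  9.\<close>

lemma fallback_cost: "(\<alpha> + 40 * real k) * (7 * real k ^ 2 / real m) \<le> 9"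
proof -
  have k1: "1 \<le> real k" using k by simp
  have "1 * \<alpha> \<le> real k * \<alpha>" "real k * 1 \<le> real k * \<alpha>"
    using k1 \<alpha> by (intro mult_right_mono mult_left_mono; simp)+
  then have "(\<alpha> + 40 * real k) * (7 * real k ^ 2) \<le> (41 * (real k * \<alpha>)) * (7 * real k ^ 2)"
    by (intro mult_right_mono) auto
  also have "\<dots> = 287 * (real k ^ 3 * \<alpha> ^ 1)" by (simp add: power2_eq_square power3_eq_cube)
  also have "\<dots> \<le> 288 * (real k ^ 5 * \<alpha> ^ 5)"
    using k1 \<alpha> by (intro mult_mono power_increasing) auto
  also have "\<dots> \<le> 9 * real m" using m by (simp add: mult_ac)
  finally show ?thesis using m_bounds(4) by (simp add: divide_le_eq)
qed

text \<open>\<Lambda> + 2 from steps without a crossing, 10 (2 \<Lambda> + 4) from crossings and 9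
  from fallbacks, where \<Lambda> is the stretch of the tree.\<close>

abbreviation "composed_stretch \<equiv> 21 * tree_stretch t + 51"

lemma alg_output_step:
  assumes x: "x \<in> Delta n k" and y: "x(u := v) \<in> Delta n k" and u: "u \<in> {1..n}" and v: "x u \<le> v"
  shows "(\<integral>\<^sup>+w. set_dist (alg_output w x) (alg_output w (x(u := v))) \<partial>full) \<le> ennreal (composed_stretch * (v - x u))"
proof -
  define y where "y = x(u := v)"
  define \<epsilon> where "\<epsilon> = v - x u"
  let ?\<Lambda> = "tree_stretch t"
  have \<epsilon>: "0 \<le> \<epsilon>" using v by (simp add: \<epsilon>_def)
  have \<Lambda>: "0 \<le> ?\<Lambda>" by (simp add: tree_stretch_def[OF t])
  have y': "y \<in> Delta n k" using y by (simp add: y_def)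
  define B where "B R C \<beta> = (of_bool (collision m {i \<in> {1..n}. 1/10 < y i} R C \<or> overfull n m \<beta> x \<or> overfull n m \<beta> y) :: ennreal)" for R C \<beta>
  define s where "s \<sigma> = (of_bool (\<sigma> \<in> {x u - 1/10..<v - 1/10}) :: ennreal)" for \<sigma>
  define q where "q \<beta> \<sigma> \<tau> = (of_bool (\<tau> \<in> {1 - bucket_sum n \<sigma> \<beta> x (\<beta> u) - (v - x u)<..1 - bucket_sum n \<sigma> \<beta> x (\<beta> u)}) :: ennreal)" for \<beta> \<sigma> \<tau>
  let ?a = "ennreal (\<alpha> * \<epsilon>)" and ?c = "ennreal ((?\<Lambda> + 2) * \<epsilon>)" and ?k = "ennreal (2 * real k)" and ?e = "ennreal (2 * ?\<Lambda> + 4)" and ?r = "ennreal (10 * \<epsilon>)"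
  have "(\<integral>\<^sup>+w. set_dist (alg_output w x) (alg_output w y) \<partial>full) \<le>
    (\<integral>\<^sup>+R. \<integral>\<^sup>+C. \<integral>\<^sup>+\<beta>. \<integral>\<^sup>+\<sigma>. \<integral>\<^sup>+\<tau>. (?a * B R C \<beta> + ?c + (?k * B R C \<beta> + ?e) * s \<sigma>) + ?k * B R C \<beta> * q \<beta> \<sigma> \<tau>
      \<partial>unif10 \<partial>unif10 \<partial>uniform_map n m \<partial>uniform_map n d \<partial>uniform_map m d)"
  proof (rule nn_integral_full_mono[OF measurable_card_diff[OF x y']])
    fix R C \<beta> \<sigma> \<tau> assume f: "fixed_coins n k m d R C \<beta> \<sigma> \<tau> t A \<alpha>" and b: "\<sigma> \<le> 1/10" "\<tau> \<le> 1/10"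
    interpret coordinate_step n k m d R C \<beta> \<sigma> \<tau> t A \<alpha> x u v y
      using f x y' u v by (simp add: coordinate_step_def coordinate_step_axioms_def y_def)
    show "(\<integral>\<^sup>+f. \<integral>\<^sup>+E. \<integral>\<^sup>+\<theta>. set_dist (alg_output (f, E, \<theta>, R, C, \<beta>, \<sigma>, \<tau>) x) (alg_output (f, E, \<theta>, R, C, \<beta>, \<sigma>, \<tau>) y)
        \<partial>tree_space t \<partial>clock_space n \<partial>A) \<le> (?a * B R C \<beta> + ?c + (?k * B R C \<beta> + ?e) * s \<sigma>) + ?k * B R C \<beta> * q \<beta> \<sigma> \<tau>"
      using step_bound[OF b] \<alpha> unfolding alg_output.simps B_def s_def q_def \<epsilon>_def bad_coins_def window_def by simp
  qed
  also have "\<dots> \<le> (\<integral>\<^sup>+R. \<integral>\<^sup>+C. \<integral>\<^sup>+\<beta>. (?c + ?e * ?r) + (?a + ?k * ?r + ?k * ?r) * B R C \<beta> \<partial>uniform_map n m \<partial>uniform_map n d \<partial>uniform_map m d)"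
  proof (rule nn_integral_mono, rule nn_integral_mono, rule nn_integral_mono)
    \<comment> \<open>The window for \<tau> depends on \<sigma>, so \<tau> is integrated before
      \<sigma>; \<open>B\<close> depends on neither and stays as a factor.\<close>
    fix R C \<beta>
    have q: "q \<beta> \<sigma> \<in> borel_measurable unif10" "(\<integral>\<^sup>+\<tau>. q \<beta> \<sigma> \<tau> \<partial>unif10) \<le> ?r" for \<sigma>
    proof -
      show "q \<beta> \<sigma> \<in> borel_measurable unif10" unfolding q_def by measurable
      show "(\<integral>\<^sup>+\<tau>. q \<beta> \<sigma> \<tau> \<partial>unif10) \<le> ?r"
        unfolding q_def \<epsilon>_def
        using unif10_interval[of "1 - bucket_sum n \<sigma> \<beta> x (\<beta> u) - (v - x u)" "1 - bucket_sum n \<sigma> \<beta> x (\<beta> u)",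
            OF _ insertI2[OF insertI1]] v by simp
    qed
    have s: "s \<in> borel_measurable unif10" "(\<integral>\<^sup>+\<sigma>. s \<sigma> \<partial>unif10) \<le> ?r"
    proof -
      show "s \<in> borel_measurable unif10" unfolding s_def by measurable
      show "(\<integral>\<^sup>+\<sigma>. s \<sigma> \<partial>unif10) \<le> ?r"
        unfolding s_def \<epsilon>_def using unif10_interval[of "x u - 1/10" "v - 1/10", OF _ insertI1] v by simp
    qed
    have "(\<integral>\<^sup>+\<sigma>. \<integral>\<^sup>+\<tau>. (?a * B R C \<beta> + ?c + (?k * B R C \<beta> + ?e) * s \<sigma>) + ?k * B R C \<beta> * q \<beta> \<sigma> \<tau> \<partial>unif10 \<partial>unif10) \<le>
       (\<integral>\<^sup>+\<sigma>. (?a * B R C \<beta> + ?c + (?k * B R C \<beta> + ?e) * s \<sigma>) + ?k * B R C \<beta> * ?r \<partial>unif10)"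
      by (rule nn_integral_mono) (rule nn_integral_affine_le[OF prob_space_unif10 q])
    also have "\<dots> = (\<integral>\<^sup>+\<sigma>. (?a * B R C \<beta> + ?c + ?k * B R C \<beta> * ?r) + (?k * B R C \<beta> + ?e) * s \<sigma> \<partial>unif10)"
      by (intro nn_integral_cong) (simp only: ac_simps)
    also have "\<dots> \<le> (?a * B R C \<beta> + ?c + ?k * B R C \<beta> * ?r) + (?k * B R C \<beta> + ?e) * ?r"
      by (rule nn_integral_affine_le[OF prob_space_unif10 s])
    also have "\<dots> = (?c + ?e * ?r) + (?a + ?k * ?r + ?k * ?r) * B R C \<beta>"
    proof -
      have "(a * b + c + k * b * r) + (k * b + e) * r = (c + e * r) + (a + k * r + k * r) * b" for a b c k e r :: ennreal
        by (simp only: distrib_left distrib_right ac_simps)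
      then show ?thesis .
    qed
    finally show "(\<integral>\<^sup>+\<sigma>. \<integral>\<^sup>+\<tau>. (?a * B R C \<beta> + ?c + (?k * B R C \<beta> + ?e) * s \<sigma>) + ?k * B R C \<beta> * q \<beta> \<sigma> \<tau> \<partial>unif10 \<partial>unif10) \<le> \<dots>" .
  qed
  also have "\<dots> = (?c + ?e * ?r) + (?a + ?k * ?r + ?k * ?r) * (\<integral>\<^sup>+R. \<integral>\<^sup>+C. \<integral>\<^sup>+\<beta>. B R C \<beta> \<partial>uniform_map n m \<partial>uniform_map n d \<partial>uniform_map m d)"
    by (simp only: nn_integral_uniform_affine[OF m_bounds(2)] nn_integral_uniform_affine[OF m_bounds(3)])
  also have "\<dots> \<le> (?c + ?e * ?r) + (?a + ?k * ?r + ?k * ?r) * ennreal (7 * real k ^ 2 / real m)"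
    unfolding B_def by (intro add_left_mono mult_left_mono bad_coins_probability x y') simp
  also have "\<dots> = ennreal (((?\<Lambda> + 2) * \<epsilon> + (2 * ?\<Lambda> + 4) * (10 * \<epsilon>)) + (\<alpha> * \<epsilon> + 2 * real k * (10 * \<epsilon>) + 2 * real k * (10 * \<epsilon>)) * (7 * real k ^ 2 / real m))"
    using \<epsilon> \<Lambda> \<alpha> by (simp only: ennreal_mult'[symmetric] ennreal_plus[symmetric] mult_nonneg_nonneg add_nonneg_nonneg
        zero_le_numeral of_nat_0_le_iff divide_nonneg_nonneg zero_le_power order_trans[OF zero_le_one \<alpha>])
  also have "\<dots> = ennreal ((21 * ?\<Lambda> + 42) * \<epsilon> + ((\<alpha> + 40 * real k) * (7 * real k ^ 2 / real m)) * \<epsilon>)"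
    by (intro arg_cong[where f=ennreal]) (simp add: algebra_simps add_divide_distrib)
  also have "\<dots> \<le> ennreal ((21 * ?\<Lambda> + 42) * \<epsilon> + 9 * \<epsilon>)"
    using fallback_cost \<epsilon> by (intro ennreal_leI add_left_mono mult_right_mono)
  finally show ?thesis by (simp add: y_def \<epsilon>_def algebra_simps)
qed

lemma alg_output_lipschitz:
  assumes "x \<in> Delta n k" "y \<in> Delta n k"
  shows "(\<integral>\<^sup>+w. set_dist (alg_output w x) (alg_output w y) \<partial>full) \<le> ennreal (composed_stretch * l1norm n (\<lambda>i. x i - y i))"
proof (rule lipschitz_from_steps[where D="\<lambda>x y. \<integral>\<^sup>+w. set_dist (alg_output w x) (alg_output w y) \<partial>full", OF _ _ _ _ _ assms])
  fix x y z
  show "(\<integral>\<^sup>+w. set_dist (alg_output w x) (alg_output w x) \<partial>full) = 0" by simp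
  show "(\<integral>\<^sup>+w. set_dist (alg_output w x) (alg_output w y) \<partial>full)
      = (\<integral>\<^sup>+w. set_dist (alg_output w y) (alg_output w x) \<partial>full)" by (simp add: Un_commute)
  assume xyz: "x \<in> Delta n k" "y \<in> Delta n k" "z \<in> Delta n k"
  have "(\<integral>\<^sup>+w. set_dist (alg_output w x) (alg_output w z) \<partial>full) \<le>
    (\<integral>\<^sup>+w. set_dist (alg_output w x) (alg_output w y) + set_dist (alg_output w y) (alg_output w z) \<partial>full)"
    using xyz by (intro nn_integral_mono ennreal_of_nat_le_add sym_diff_triangle finite_subset[OF output_subset] finite_atLeastAtMost)
  also have "\<dots> = (\<integral>\<^sup>+w. set_dist (alg_output w x) (alg_output w y) \<partial>full) +
      (\<integral>\<^sup>+w. set_dist (alg_output w y) (alg_output w z) \<partial>full)"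
    using xyz by (intro nn_integral_add measurable_card_diff)
  finally show "(\<integral>\<^sup>+w. set_dist (alg_output w x) (alg_output w z) \<partial>full) \<le> \<dots>" .
next
  show "0 \<le> composed_stretch" by (simp add: tree_stretch_def[OF t])
qed (rule alg_output_step)

lemma has_stretch_alg_output:
  "has_stretch n k (distr full (map_space n k) (\<lambda>w. \<lambda>x\<in>Delta n k. alg_output w x)) composed_stretch"
proof (rule has_stretch_distrI)
  show "prob_space full" by (intro prob_space_pair prob_spaces)
  show "0 \<le> composed_stretch" by (simp add: tree_stretch_def[OF t])
qed (fact pred_output output_subset output_AE_card output_marginal alg_output_lipschitz)+

end

section \<open>One round of the recursion\<close>

lemma log2_num_buckets:
  assumes k: "1 \<le> k" and \<alpha>: "1 \<le> \<alpha>"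
  shows "32 * real k ^ 5 * \<alpha> ^ 5 \<le> real (num_buckets k \<alpha>)"
    and "log 2 (real (num_buckets k \<alpha>)) \<le> 6 + 5 * log 2 (real k) + 5 * log 2 \<alpha>"
proof -
  let ?X = "real k ^ 5 * \<alpha> ^ 5"
  have X: "1 \<le> ?X" using k \<alpha> mult_mono[of 1 "real k ^ 5" 1 "\<alpha> ^ 5"] by simp
  have nb: "real (num_buckets k \<alpha>) = real_of_int \<lceil>32 * ?X\<rceil>"
    using X by (simp add: num_buckets_def mult.assoc)
  show "32 * real k ^ 5 * \<alpha> ^ 5 \<le> real (num_buckets k \<alpha>)" unfolding nb mult.assoc by (rule le_of_int_ceiling)
  have "real (num_buckets k \<alpha>) \<le> 32 * ?X + 1" unfolding nb by (rule of_int_ceiling_le_add_one)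
  \<comment> \<open>Rounding up is absorbed by doubling, whence 6 in place of 5.\<close>
  also have "\<dots> \<le> 2 ^ 6 * ?X"
  proof -
    have "32 * z + 1 \<le> 2 ^ 6 * z" if "1 \<le> z" for z :: real using that by simp
    then show ?thesis using X by blast
  qed
  finally have "real (num_buckets k \<alpha>) \<le> 2 ^ 6 * ?X" .
  then have "log 2 (real (num_buckets k \<alpha>)) \<le> log 2 (2 ^ 6 * ?X)"
    using X nb by (intro log_mono) (auto simp: less_le_trans[OF _ le_of_int_ceiling])
  also have "\<dots> = log 2 (2 ^ 6) + log 2 ?X" using k \<alpha> by (subst log_mult) auto
  also have "log 2 (2 ^ 6 :: real) = real 6" by (rule log_pow_cancel) auto
  also have "real 6 + log 2 ?X = 6 + 5 * log 2 (real k) + 5 * log 2 \<alpha>"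
    using k \<alpha> by (simp add: log_mult log_nat_power)
  finally show "log 2 (real (num_buckets k \<alpha>)) \<le> 6 + 5 * log 2 (real k) + 5 * log 2 \<alpha>" .
qed

lemma has_stretch_ALG:
  assumes tr: "\<forall>d\<ge>1. pivotal_tree d (tr d)" and nk: "1 \<le> n" "1 \<le> k"
    and A: "has_stretch n k A \<alpha>"
  shows "has_stretch n k (ALG tr n k A \<alpha>) (2048 * (1 + log 2 (real k) + log 2 \<alpha>))"
proof -
  have \<alpha>: "1 \<le> \<alpha>" by (rule has_stretch_ge_1[OF A nk])
  define m where "m = num_buckets k \<alpha>"
  define d where "d = m ^ 3"
  have "0 < 32 * real k ^ 5 * \<alpha> ^ 5" using nk \<alpha> by simp
  also have "\<dots> \<le> real m" unfolding m_def by (rule log2_num_buckets(1)[OF nk(2) \<alpha>])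
  finally have m1: "1 \<le> m" by simp
  then have d1: "1 \<le> d" by (simp add: d_def)
  interpret composition n k m d "tr d" A \<alpha>
    using A \<alpha> tr d1 nk log2_num_buckets(1)[OF nk(2) \<alpha>] by (simp add: composition_def d_def m_def)
  have "ALG tr n k A \<alpha> = distr full (map_space n k) (\<lambda>w. \<lambda>x\<in>Delta n k. alg_output w x)"
    unfolding ALG_def Let_def uniform_map_def m_def[symmetric] d_def[symmetric]
    by (intro arg_cong2[where f="distr _"] refl) (auto simp: fun_eq_iff restrict_def)
  then have "has_stretch n k (ALG tr n k A \<alpha>) composed_stretch" using has_stretch_alg_output by simp
  then show ?thesis
  proof (rule has_stretch_mono)
    have "log 2 (real d) = 3 * log 2 (real m)" using m1 by (simp add: d_def log_nat_power)
    moreover have "tree_stretch (tr d) \<le> 5 + 4 * log 2 (real d)"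
      using tr d1 by (intro tree_stretch_le) auto
    moreover have "log 2 (real m) \<le> 6 + 5 * log 2 (real k) + 5 * log 2 \<alpha>"
      unfolding m_def by (rule log2_num_buckets(2)[OF nk(2) \<alpha>])
    moreover have "0 \<le> log 2 (real k)" "0 \<le> log 2 \<alpha>" using nk \<alpha> by auto
    \<comment> \<open>The constants 21 (5 + 12 * 6) + 51 = 1668 and 21 * 12 * 5 = 1260 are both
      below 2048.\<close>
    ultimately show "composed_stretch \<le> 2048 * (1 + log 2 (real k) + log 2 \<alpha>)" by argo
  qed
qed

section \<open>The recursion\<close>

text \<open>The cap keeps the iterated logarithms away from arguments where \<^const>\<open>log\<close> is negative or junk.\<close>

primrec capped_log :: "nat \<Rightarrow> nat \<Rightarrow> real" where
  "capped_log n 0 = max 1 (log 2 (real n))"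
| "capped_log n (Suc i) = max 1 (log 2 (capped_log n i))"

lemma capped_log_ge_1: "1 \<le> capped_log n i"
  by (cases i) auto

text \<open>The tangent bound for ln at 1, applied to x / 2 and combined with ln 2 \<ge> 1/2. While
  an iterated logarithm stays at 2 or above, it thus drops by at least 1 per step.\<close>

lemma log2_le_minus_1:
  assumes x: "(2::real) \<le> x" shows "log 2 x \<le> x - 1"
proof -
  have "ln (1 / 2) \<le> 1 / 2 - (1::real)" by (rule ln_le_minus_one) simp
  then have l2: "1 / 2 \<le> ln (2::real)" by (simp add: ln_div)
  have "ln (x / 2) \<le> x / 2 - 1" using x by (intro ln_le_minus_one) auto
  then have "ln x - ln 2 \<le> (x - 2) * (1 / 2)" using x by (simp add: ln_div field_simps)
  also have "\<dots> \<le> (x - 2) * ln 2" using x l2 by (intro mult_left_mono) auto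
  finally have "ln x \<le> (x - 1) * ln 2" by (simp add: algebra_simps)
  moreover have "0 < ln (2::real)" by simp
  ultimately show ?thesis unfolding log_def by (simp only: pos_divide_le_eq)
qed

lemma log2_le_self:
  assumes x: "(1::real) \<le> x" shows "log 2 x \<le> x"
proof (cases "2 \<le> x")
  case False
  then have "log 2 x \<le> 1" using x by simp
  then show ?thesis using x by (rule order_trans)
qed (use log2_le_minus_1[of x] in simp)

text \<open>Needed because \<open>log_star\<close> is defined by \<open>LEAST\<close>. If all
  iterates exceeded 1, each would even be at least 2, its logarithm being the next iterate, and
  would drop by 1 forever.\<close>

lemma ex_iterated_log_le_1: "\<exists>i. (log 2 ^^ i) (real n) \<le> 1"
proof (rule ccontr)
  let ?L = "\<lambda>i. (log 2 ^^ i) (real n)"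
  assume "\<not> ?thesis"
  then have gt: "1 < ?L i" for i by (metis not_le)
  have ge: "2 \<le> ?L i" for i
  proof (rule ccontr)
    assume "\<not> 2 \<le> ?L i"
    then have "log 2 (?L i) \<le> log 2 2" using gt[of i] by (intro log_mono) auto
    then show False using gt[of "Suc i"] by simp
  qed
  have "?L i \<le> real n - real i" for i
  proof (induction i)
    case (Suc i) then show ?case using log2_le_minus_1[OF ge[of i]] by simp
  qed simp
  from this[of n] gt[of n] show False by simp
qed

text \<open>The index is off by one because \<open>capped_log n 0\<close> is already one logarithm:
  the tree at level 0 has stretch of order log n.\<close>

lemma capped_log_eq: "Suc i \<le> log_star n \<Longrightarrow> capped_log n i = max 1 ((log 2 ^^ Suc i) (real n))"
proof (induction i)
  case (Suc i)
  have "\<not> (log 2 ^^ Suc i) (real n) \<le> 1"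
    using Suc.prems unfolding log_star_def by (intro not_less_Least) simp
  then show ?case using Suc by simp
qed simp

text \<open>By the offset the value 1 is reached one index earlier, and it persists, log 1 = 0 being
  capped to 1. For n = 1 there is no earlier index, and the cap acts directly.\<close>

lemma capped_log_log_star:
  assumes "1 \<le> n" shows "capped_log n (log_star n) = 1"
proof -
  have le: "(log 2 ^^ log_star n) (real n) \<le> 1"
    unfolding log_star_def using ex_iterated_log_le_1 by (rule LeastI_ex)
  show ?thesis
  proof (cases "log_star n")
    case 0
    then have "n = 1" using le assms by simp
    then show ?thesis using 0 by simp
  next
    case (Suc i)
    then have "capped_log n i = 1" using capped_log_eq[of i n] le by simp
    then show ?thesis using Suc by simp
  qed
qed

text \<open>The two coefficients reproduce themselves in a round: 2^11 = 2048 is the factor of the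
  round, and 2^22 exceeds 2048 * 25, where 25 = 23 + 1 + 1 collects the constant and the two copies
  of 1 + log k.\<close>

lemma recursive_alg_stretch:
  assumes tr: "\<forall>d\<ge>1. pivotal_tree d (tr d)" and nk: "1 \<le> n" "1 \<le> k"
  shows "has_stretch n k (recursive_alg tr n k i) (2 ^ 11 * capped_log n i + 2 ^ 22 * (1 + log 2 (real k)))"
proof (induction i)
  case 0
  have t: "pivotal_tree n (tr n)" using tr nk by simp
  have "has_stretch n k (recursive_alg tr n k 0) (tree_stretch (tr n))"
    using has_stretch_tree_pivotal[OF t] by simp
  then show ?case
  proof (rule has_stretch_mono)
    have "tree_stretch (tr n) \<le> 5 + 4 * log 2 (real n)" by (rule tree_stretch_le[OF t])
    moreover have "0 \<le> log 2 (real k)" using nk by simp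
    ultimately show "tree_stretch (tr n) \<le> 2 ^ 11 * capped_log n 0 + 2 ^ 22 * (1 + log 2 (real k))"
      by (simp add: max_def split: if_splits)
  qed
next
  case (Suc i)
  let ?a = "stretch n k (recursive_alg tr n k i)" and ?V = "capped_log n i" and ?\<kappa> = "1 + log 2 (real k)"
  have a: "has_stretch n k (recursive_alg tr n k i) ?a" "?a \<le> 2 ^ 11 * ?V + 2 ^ 22 * ?\<kappa>"
    by (rule has_stretch_stretch[OF Suc nk])+
  have a1: "1 \<le> ?a" by (rule has_stretch_ge_1[OF a(1) nk])
  have V: "1 \<le> ?V" by (rule capped_log_ge_1)
  have \<kappa>: "1 \<le> ?\<kappa>" using nk by simp
  have "?a \<le> 2 ^ 11 * ?V + 2 ^ 22 * ?\<kappa>" by (rule a)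
  \<comment> \<open>Both numbers are at least 1, so the sum is bounded by a multiple of their
    product, whose logarithm splits; 2^11 + 2^22 \<le> 2^23.\<close>
  also have "\<dots> \<le> 2 ^ 11 * (?V * ?\<kappa>) + 2 ^ 22 * (?V * ?\<kappa>)"
    using V \<kappa> mult_left_mono[of 1 ?\<kappa> ?V] mult_right_mono[of 1 ?V ?\<kappa>] by (intro add_mono mult_left_mono) auto
  also have "\<dots> \<le> 2 ^ 23 * (?V * ?\<kappa>)" using V \<kappa> by simp
  finally have "log 2 ?a \<le> log 2 (2 ^ 23 * (?V * ?\<kappa>))" using a1 by (intro log_mono) auto
  also have "\<dots> = log 2 (2 ^ 23) + log 2 (?V * ?\<kappa>)" using V \<kappa> by (subst log_mult) auto
  also have "log 2 (2 ^ 23 :: real) = real 23" by (rule log_pow_cancel) auto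
  also have "log 2 (?V * ?\<kappa>) = log 2 ?V + log 2 ?\<kappa>" using V \<kappa> by (subst log_mult) auto
  also have "log 2 ?\<kappa> \<le> ?\<kappa>" by (rule log2_le_self[OF \<kappa>])
  also have "log 2 ?V \<le> capped_log n (Suc i)" by simp
  finally have l: "log 2 ?a \<le> 23 + capped_log n (Suc i) + ?\<kappa>" by simp
  have "has_stretch n k (recursive_alg tr n k (Suc i)) (2048 * (?\<kappa> + log 2 ?a))"
    using has_stretch_ALG[OF tr nk a(1)] by simp
  then show ?case
  proof (rule has_stretch_mono)
    show "2048 * (?\<kappa> + log 2 ?a) \<le> 2 ^ 11 * capped_log n (Suc i) + 2 ^ 22 * ?\<kappa>" using l \<kappa> by simp
  qed
qed

theorem theorem3p11:
  shows "\<exists>c::real. c > 0 \<and>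
    (\<forall>(tr :: nat \<Rightarrow> btree) (n :: nat) (k :: nat).
       (\<forall>d\<ge>1. pivotal_tree d (tr d)) \<longrightarrow> n \<ge> 1 \<longrightarrow> k \<ge> 1 \<longrightarrow>
       (\<exists>i::nat.
          \<bar>real i - real (log_star n)\<bar> \<le> c * max 1 (log 2 (real (log_star n))) \<and>
          real i \<le> c * max 1 (real (log_star n)) \<and>
          has_stretch n k (recursive_alg tr n k i) (c * max 1 (log 2 (real k)))))"
proof (intro exI[of _ "2 ^ 24 :: real"] conjI allI impI)
  fix tr :: "nat \<Rightarrow> btree" and n k :: nat
  assume a: "\<forall>d\<ge>1. pivotal_tree d (tr d)" "n \<ge> 1" "k \<ge> 1"
  \<comment> \<open>The witness is \<open>log_star n\<close> itself, with deviation 0. For the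
    constant, 2^11 + 2^22 (1 + log k) is at most 2^24 max 1 (log k).\<close>
  have "has_stretch n k (recursive_alg tr n k (log_star n)) (2 ^ 11 * 1 + 2 ^ 22 * (1 + log 2 (real k)))"
    using recursive_alg_stretch[OF a, of "log_star n"] by (simp only: capped_log_log_star[OF a(2)])
  then have "has_stretch n k (recursive_alg tr n k (log_star n)) (2 ^ 24 * max 1 (log 2 (real k)))"
    by (rule has_stretch_mono) (simp add: max_def)
  moreover have "real (log_star n) \<le> 2 ^ 24 * max 1 (real (log_star n))" by simp
  moreover have "\<bar>real (log_star n) - real (log_star n)\<bar> \<le> 2 ^ 24 * max 1 (log 2 (real (log_star n)))" by simp
  ultimately show "\<exists>i::nat.
          \<bar>real i - real (log_star n)\<bar> \<le> 2 ^ 24 * max 1 (log 2 (real (log_star n))) \<and>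
          real i \<le> 2 ^ 24 * max 1 (real (log_star n)) \<and>
          has_stretch n k (recursive_alg tr n k i) (2 ^ 24 * max 1 (log 2 (real k)))" by blast
qed simp

end
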